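(* Let $(\bar M,g)$ be a compact connected smooth Riemannian manifold of dimension $n\geq 3$ with nonempty smooth boundary $\partial M$. Then for every real number $\tau\geq 2$ there exists $u\in C^\infty(\bar M)$ such that the conformal metric $g_u=e^{2u}g$ satisfies $$A^{\tau}_{g_u}>0 \quad\text{in } \bar M,$$ that is, the symmetric $2$-tensor $A^{\tau}_{g_u}$ is positive definite at every point of $\bar M$.
   Context: $\bar M=M\cup\partial M$ denotes the compact manifold including its boundary, and $g$ is smooth up to the boundary; $C^\infty(\bar M)$ denotes real-valued functions smooth up to the boundary. For a Riemannian metric $g$ on an $n$-dimensional manifold, $n\ge 3$, with Ricci tensor $Ric_g$ and scalar curvature $R_g$ (with respect to the Levi-Civita connection), and for $\tau\in\mathbb{R}$, the modified Schouten tensor is $$A_g^{\tau}=\frac{1}{n-2}\left(Ric_g-\frac{\tau}{2(n-1)}R_g\, g\right).$$ *)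

theory Defs
  imports "HOL-Analysis.Analysis"
begin

section \<open>Smooth functions on arbitrary subsets of Euclidean space\<close>

text \<open>On open sets, \<open>Ck_on m W h\<close> says that all iterated directional derivatives up to order
  \<open>m\<close> exist and are continuous. On a general set (here: relatively open subsets of a half-space),
  a function is smooth if it locally extends to a smooth function on an open set; this is
  smoothness up to the boundary.\<close>

primrec Ck_on :: "nat \<Rightarrow> 'a::euclidean_space set \<Rightarrow> ('a \<Rightarrow> 'b::real_normed_vector) \<Rightarrow> bool" where
  "Ck_on 0 W h \<longleftrightarrow> continuous_on W h"
| "Ck_on (Suc m) W h \<longleftrightarrow>
     (\<forall>x\<in>W. h differentiable (at x)) \<and> (\<forall>v. Ck_on m W (\<lambda>x. frechet_derivative h (at x) v))"

definition smooth_on :: "'a::euclidean_space set \<Rightarrow> ('a \<Rightarrow> 'b::real_normed_vector) \<Rightarrow> bool" where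
  "smooth_on S f \<longleftrightarrow>
     (\<forall>x\<in>S. \<exists>W h. open W \<and> x \<in> W \<and> (\<forall>m. Ck_on m W h) \<and> (\<forall>y\<in>S \<inter> W. h y = f y))"

section \<open>Smooth manifolds with boundary\<close>

text \<open>The model is \<open>{x \<in> \<real>\<^sup>n. 0 \<le> x\<^sub>k}\<close>, where \<open>k\<close> is an arbitrary index from the
  \<open>n\<close>-element index type. Interior charts are those whose image misses \<open>x\<^sub>k = 0\<close>.\<close>

definition halfspace :: "'n::finite \<Rightarrow> (real^'n) set" where
  "halfspace k = {x. 0 \<le> x $ k}"

text \<open>A chart consists of its domain and its coordinate map; values of the coordinate map outside
  the domain are irrelevant.\<close>

type_synonym ('a, 'n) chart = "'a set \<times> ('a \<Rightarrow> real^'n)"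

definition chart_image :: "('a, 'n::finite) chart \<Rightarrow> (real^'n) set" where
  "chart_image c = snd c ` fst c"

definition chart_inv :: "('a, 'n::finite) chart \<Rightarrow> real^'n \<Rightarrow> 'a" where
  "chart_inv c = inv_into (fst c) (snd c)"

definition overlap :: "('a, 'n::finite) chart \<Rightarrow> ('a, 'n) chart \<Rightarrow> (real^'n) set" where
  "overlap c d = snd c ` (fst c \<inter> fst d)"

definition transition :: "('a, 'n::finite) chart \<Rightarrow> ('a, 'n) chart \<Rightarrow> real^'n \<Rightarrow> real^'n" where
  "transition c d = snd d \<circ> chart_inv c"

definition is_chart :: "'n::finite \<Rightarrow> 'a::topological_space set \<Rightarrow> ('a, 'n) chart \<Rightarrow> bool" where
  "is_chart k M c \<longleftrightarrow>
     openin (top_of_set M) (fst c) \<and>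
     openin (top_of_set (halfspace k)) (chart_image c) \<and>
     homeomorphism (fst c) (chart_image c) (snd c) (chart_inv c)"

text \<open>The Hausdorff property is part of the type class of the points. Second countability is not
  stated separately: it is automatic for compact \<open>M\<close>, the only case considered here.\<close>

definition smooth_manifold_with_boundary ::
    "'n::finite \<Rightarrow> 'a::t2_space set \<Rightarrow> ('a, 'n) chart set \<Rightarrow> bool" where
  "smooth_manifold_with_boundary k M \<A> \<longleftrightarrow>
     (\<forall>c\<in>\<A>. is_chart k M c) \<and> (\<Union>c\<in>\<A>. fst c) = M \<and>
     (\<forall>c\<in>\<A>. \<forall>d\<in>\<A>. smooth_on (overlap c d) (transition c d))"

definition manifold_boundary :: "'n::finite \<Rightarrow> ('a, 'n) chart set \<Rightarrow> 'a set" where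
  "manifold_boundary k \<A> = {p. \<exists>c\<in>\<A>. p \<in> fst c \<and> snd c p $ k = 0}"

text \<open>Membership in \<open>C\<^sup>\<infinity>(M)\<close>, smooth up to the boundary.\<close>

definition smooth_function :: "('a, 'n::finite) chart set \<Rightarrow> ('a \<Rightarrow> real) \<Rightarrow> bool" where
  "smooth_function \<A> u \<longleftrightarrow> (\<forall>c\<in>\<A>. smooth_on (chart_image c) (u \<circ> chart_inv c))"

section \<open>Covariant 2-tensors and Riemannian metrics\<close>

text \<open>A covariant 2-tensor field is given classically by its components: \<open>T c x\<close> is the matrix of
  the tensor at the point with coordinates \<open>x\<close> in the chart \<open>c\<close>, and different charts are related
  by the transformation law.\<close>

type_synonym ('a, 'n) tensor2 = "('a, 'n) chart \<Rightarrow> real^'n \<Rightarrow> real^'n^'n"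

definition tensor_law :: "('a, 'n::finite) chart set \<Rightarrow> ('a, 'n) tensor2 \<Rightarrow> bool" where
  "tensor_law \<A> T \<longleftrightarrow>
     (\<forall>c\<in>\<A>. \<forall>d\<in>\<A>. \<forall>x\<in>overlap c d.
        let J = jacobian (transition c d) (at x within overlap c d)
        in T c x = transpose J ** T d (transition c d x) ** J)"

definition positive_definite :: "real^'n^'n \<Rightarrow> bool" where
  "positive_definite B \<longleftrightarrow> transpose B = B \<and> (\<forall>v. v \<noteq> 0 \<longrightarrow> 0 < v \<bullet> (B *v v))"

definition tensor_positive :: "('a, 'n::finite) chart set \<Rightarrow> ('a, 'n) tensor2 \<Rightarrow> bool" where
  "tensor_positive \<A> T \<longleftrightarrow> (\<forall>c\<in>\<A>. \<forall>x\<in>chart_image c. positive_definite (T c x))"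

definition riemannian_metric :: "('a, 'n::finite) chart set \<Rightarrow> ('a, 'n) tensor2 \<Rightarrow> bool" where
  "riemannian_metric \<A> g \<longleftrightarrow>
     (\<forall>c\<in>\<A>. smooth_on (chart_image c) (g c)) \<and> tensor_law \<A> g \<and> tensor_positive \<A> g"

section \<open>Curvature in local coordinates\<close>

text \<open>Throughout, \<open>S\<close> is the image of a chart and \<open>g\<close> the component matrix of the metric on \<open>S\<close>.
  Derivatives are taken within \<open>S\<close>, so that they also make sense (and are unique, see
  \<open>frechet_derivative_within_halfspace\<close>) at points of the boundary hyperplane.\<close>

definition pd :: "(real^'n) set \<Rightarrow> 'n::finite \<Rightarrow> (real^'n \<Rightarrow> real) \<Rightarrow> real^'n \<Rightarrow> real" where
  "pd S i f x = frechet_derivative f (at x within S) (axis i 1)"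

text \<open>\<open>christoffel S g l i j x\<close> is $\Gamma^l_{ij}$, i.e.\ the Levi-Civita connection acts by
  $\nabla_{\partial_i}\partial_j = \sum_l \Gamma^l_{ij}\,\partial_l$; that these are the symbols of the unique
  torsion-free metric connection is \<open>christoffel_iff_torsion_free_metric\<close>.\<close>

definition christoffel ::
    "(real^'n) set \<Rightarrow> (real^'n \<Rightarrow> real^'n^'n) \<Rightarrow> 'n::finite \<Rightarrow> 'n \<Rightarrow> 'n \<Rightarrow> real^'n \<Rightarrow> real" where
  "christoffel S g l i j x =
     (1/2) * (\<Sum>m\<in>UNIV. matrix_inv (g x) $ l $ m *
        (pd S i (\<lambda>y. g y $ j $ m) x + pd S j (\<lambda>y. g y $ i $ m) x - pd S m (\<lambda>y. g y $ i $ j) x))"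

text \<open>\<open>riemann S g l k i j x\<close> is the coefficient of \<open>\<partial>\<^sub>l\<close> in
  $R(\partial_i,\partial_j)\partial_k
    = \nabla_{\partial_i}\nabla_{\partial_j}\partial_k - \nabla_{\partial_j}\nabla_{\partial_i}\partial_k$,
  and the Ricci tensor is the trace $Ric(Y,Z) = \mathrm{tr}(X \mapsto R(X,Y)Z)$.\<close>

definition riemann ::
    "(real^'n) set \<Rightarrow> (real^'n \<Rightarrow> real^'n^'n) \<Rightarrow> 'n::finite \<Rightarrow> 'n \<Rightarrow> 'n \<Rightarrow> 'n \<Rightarrow> real^'n \<Rightarrow> real" where
  "riemann S g l k i j x =
     pd S i (christoffel S g l j k) x - pd S j (christoffel S g l i k) x +
     (\<Sum>m\<in>UNIV. christoffel S g l i m x * christoffel S g m j k x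
             - christoffel S g l j m x * christoffel S g m i k x)"

definition ricci :: "(real^'n) set \<Rightarrow> (real^'n \<Rightarrow> real^'n^'n) \<Rightarrow> real^'n \<Rightarrow> real^'n^'n::finite" where
  "ricci S g x = (\<chi> j k. \<Sum>i\<in>UNIV. riemann S g i k i j x)"

definition scalar_curvature ::
    "(real^'n) set \<Rightarrow> (real^'n \<Rightarrow> real^'n^'n) \<Rightarrow> real^'n::finite \<Rightarrow> real" where
  "scalar_curvature S g x = (\<Sum>i\<in>UNIV. \<Sum>j\<in>UNIV. matrix_inv (g x) $ i $ j * ricci S g x $ i $ j)"

definition modified_schouten :: "real \<Rightarrow> ('a, 'n::finite) tensor2 \<Rightarrow> ('a, 'n) tensor2" where
  "modified_schouten \<tau> g c x =
     (let n = real CARD('n); S = chart_image c in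
      (1 / (n - 2)) *\<^sub>R
        (ricci S (g c) x - (\<tau> / (2 * (n - 1)) * scalar_curvature S (g c) x) *\<^sub>R g c x))"

text \<open>The metric \<open>e\<^bsup>2u\<^esup> g\<close>.\<close>

definition conformal_metric :: "('a \<Rightarrow> real) \<Rightarrow> ('a, 'n::finite) tensor2 \<Rightarrow> ('a, 'n) tensor2" where
  "conformal_metric u g c x = exp (2 * u (chart_inv c x)) *\<^sub>R g c x"

section \<open>The derivatives and the connection above are well defined\<close>

lemma frechet_derivative_within_halfspace:
  fixes f :: "real^'n \<Rightarrow> 'b::real_normed_vector"
  assumes S: "openin (top_of_set (halfspace k)) S" and x: "x \<in> S"
    and f: "(f has_derivative f') (at x within S)"
  shows "frechet_derivative f (at x within S) = f'"
proof -
  obtain e where e: "e > 0" "ball x e \<inter> halfspace k \<subseteq> S"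
    using S x by (metis openin_contains_ball)
  have xk: "0 \<le> x $ k"
    using S x by (auto simp: halfspace_def dest: openin_imp_subset)
  have "(f has_derivative frechet_derivative f (at x within S)) (at x within S)"
    using f frechet_derivative_works differentiableI by blast
  moreover have "\<exists>d. 0 < \<bar>d\<bar> \<and> \<bar>d\<bar> < r \<and> x + d *\<^sub>R b \<in> S"
    if b: "b \<in> Basis" and r: "0 < r" for b :: "real^'n" and r :: real
  proof -
    define d where "d = min r e / 2"
    have d: "0 < d" "d < r" "d < e" using r e(1) by (auto simp: d_def min_def)
    obtain i where i: "b = axis i 1"
      using b by (auto simp: Basis_vec_def)
    have "x + d *\<^sub>R b \<in> halfspace k"
      using xk d by (auto simp: halfspace_def i axis_def)
    moreover have "x + d *\<^sub>R b \<in> ball x e"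
      using d b by (auto simp: dist_norm)
    ultimately show ?thesis
      using e(2) d by (intro exI[of _ d]) auto
  qed
  ultimately show ?thesis
    using frechet_derivative_unique_within[of f _ x S f'] f by blast
qed

lemma pd_cong:
  assumes "x \<in> S" "\<And>y. y \<in> S \<Longrightarrow> f y = h y"
  shows "pd S i f x = pd S i h x"
proof -
  have "(f has_derivative D) (at x within S) \<longleftrightarrow> (h has_derivative D) (at x within S)" for D
    using assms by (metis has_derivative_transform)
  then show ?thesis
    by (simp add: pd_def frechet_derivative_def)
qed

lemma christoffel_iff_torsion_free_metric:
  fixes g :: "real^'n \<Rightarrow> real^'n^'n" and \<Gamma> :: "'n \<Rightarrow> 'n \<Rightarrow> 'n \<Rightarrow> real"
  assumes g: "\<And>y. y \<in> S \<Longrightarrow> positive_definite (g y)" and x: "x \<in> S"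
  shows "(\<forall>l i j. \<Gamma> l i j = christoffel S g l i j x) \<longleftrightarrow>
    (\<forall>l i j. \<Gamma> l i j = \<Gamma> l j i) \<and>
    (\<forall>m i j. pd S m (\<lambda>y. g y $ i $ j) x = (\<Sum>l\<in>UNIV. \<Gamma> l m i * g x $ l $ j + \<Gamma> l m j * g x $ i $ l))"
    (is "?L \<longleftrightarrow> ?T \<and> ?C")
proof -
  define D where "D m i j = pd S m (\<lambda>y. g y $ i $ j) x" for m i j
  define F where "F m i j = (D i j m + D j i m - D m i j) / 2" for m i j
  define low where "low \<Gamma> m i j = (\<Sum>l\<in>UNIV. g x $ m $ l * \<Gamma> l i j)"
    for \<Gamma> :: "'n \<Rightarrow> 'n \<Rightarrow> 'n \<Rightarrow> real" and m i j
  have gsym: "g y $ i $ j = g y $ j $ i" if "y \<in> S" for y i j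
  proof -
    have "transpose (g y) $ i $ j = g y $ i $ j"
      using g[OF that] by (simp add: positive_definite_def)
    then show ?thesis by (simp add: transpose_def)
  qed
  have D_sym: "D m i j = D m j i" for m i j
    unfolding D_def by (rule pd_cong[OF x]) (rule gsym)
  have "\<forall>v. g x *v v = 0 \<longrightarrow> v = 0"
    using g[OF x] unfolding positive_definite_def by force
  then have "invertible (g x)"
    by (simp add: invertible_left_inverse matrix_left_invertible_ker)
  then have inv: "g x ** matrix_inv (g x) = mat 1 \<and> matrix_inv (g x) ** g x = mat 1"
    unfolding invertible_def matrix_inv_def by (rule someI_ex)
  have I1: "(\<Sum>m\<in>UNIV. matrix_inv (g x) $ l $ m * g x $ m $ p) = (if l = p then 1 else 0)" for l p
    using arg_cong[OF conjunct2[OF inv], of "\<lambda>B. B $ l $ p"]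
    by (simp add: matrix_matrix_mult_def mat_def)
  have I2: "(\<Sum>m\<in>UNIV. g x $ l $ m * matrix_inv (g x) $ m $ p) = (if l = p then 1 else 0)" for l p
    using arg_cong[OF conjunct1[OF inv], of "\<lambda>B. B $ l $ p"]
    by (simp add: matrix_matrix_mult_def mat_def)
  have chr: "christoffel S g l i j x = (\<Sum>m\<in>UNIV. matrix_inv (g x) $ l $ m * F m i j)" for l i j
    by (simp add: christoffel_def F_def D_def sum_distrib_left)
  have "low \<Gamma> p i j = F p i j" if "\<And>l. \<Gamma> l i j = christoffel S g l i j x" for p i j
  proof -
    have "low \<Gamma> p i j = (\<Sum>l\<in>UNIV. \<Sum>m\<in>UNIV. g x $ p $ l * matrix_inv (g x) $ l $ m * F m i j)"
      by (simp add: low_def that chr sum_distrib_left mult.assoc)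
    also have "\<dots> = (\<Sum>m\<in>UNIV. (\<Sum>l\<in>UNIV. g x $ p $ l * matrix_inv (g x) $ l $ m) * F m i j)"
      by (subst sum.swap) (simp add: sum_distrib_right)
    finally show ?thesis by (simp add: I2 if_distrib[where f="\<lambda>a. a * _"] cong: if_cong)
  qed
  moreover have "\<Gamma> l i j = christoffel S g l i j x" if "\<And>p. low \<Gamma> p i j = F p i j" for l i j
  proof -
    have "christoffel S g l i j x
        = (\<Sum>m\<in>UNIV. \<Sum>p\<in>UNIV. matrix_inv (g x) $ l $ m * g x $ m $ p * \<Gamma> p i j)"
      by (simp add: chr that[symmetric] low_def sum_distrib_left mult.assoc)
    also have "\<dots> = (\<Sum>p\<in>UNIV. (\<Sum>m\<in>UNIV. matrix_inv (g x) $ l $ m * g x $ m $ p) * \<Gamma> p i j)"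
      by (subst sum.swap) (simp add: sum_distrib_right)
    finally show ?thesis by (simp add: I1 if_distrib[where f="\<lambda>a. a * _"] cong: if_cong)
  qed
  ultimately have L: "?L \<longleftrightarrow> (\<forall>p i j. low \<Gamma> p i j = F p i j)" by blast
  have C: "?C \<longleftrightarrow> (\<forall>m i j. D m i j = low \<Gamma> j m i + low \<Gamma> i m j)"
    by (simp add: D_def low_def sum.distrib gsym[OF x] mult.commute)
  show ?thesis
  proof
    assume l: ?L
    have F_sym: "F m i j = F m j i" for m i j
      using D_sym[of m i j] by (simp add: F_def)
    have ?T using l F_sym by (simp add: chr)
    moreover have ?C
    proof -
      have "D m i j = F j m i + F i m j" for m i j
        using D_sym[of m i j] D_sym[of j m i] D_sym[of i m j] by (simp add: F_def field_simps)
      then show ?thesis using l L C by simp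
    qed
    ultimately show "?T \<and> ?C" ..
  next
    assume tc: "?T \<and> ?C"
    then have T': "low \<Gamma> p i j = low \<Gamma> p j i" for p i j by (simp add: low_def)
    have C': "D m i j = low \<Gamma> j m i + low \<Gamma> i m j" for m i j using tc C by blast
    have "low \<Gamma> p i j = F p i j" for p i j
      using T'[of p i j] T'[of i p j] T'[of j p i] by (simp add: F_def C')
    then show ?L using L by blast
  qed
qed

end

theory Submission
  imports Defs
begin

text \<open>Take \<open>u = exp (t f)\<close> where \<open>f \<ge> 0\<close> is smooth without critical points. With \<open>\<phi> = exp (t f)\<close> and
  \<open>c = (\<tau> - 1) / (n - 2)\<close>, the modified Schouten tensor of the metric \<open>e\<^bsup>2u\<^esup> g\<close> is
  \<open>A + t \<phi> (c \<Delta>f g - \<nabla>\<^sup>2f) + t\<^sup>2 \<phi> (c |df|\<^sup>2 g - df\<^sup>2) + t\<^sup>2 \<phi>\<^sup>2 (df\<^sup>2 + (\<tau> - 2) / 2 |df|\<^sup>2 g)\<close>.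
  Since \<open>\<phi> \<ge> 1\<close>, the last summand absorbs the negative \<open>df\<^sup>2\<close> of the third one, and for large \<open>t\<close> the
  remaining \<open>t\<^sup>2 \<phi> c |df|\<^sup>2 g\<close> dominates everything else by compactness.

  To find \<open>f\<close>, perturb any function by small multiples of cut-off coordinate functions; by Sard's
  theorem the critical points become nondegenerate, hence finite in number. Composing with an
  injective local diffeomorphism of \<open>M\<close> into itself whose image misses a critical point lowers
  their number. Such maps exist for every point: points near the boundary are avoided by pushing
  the boundary inwards, and the set of avoidable points is open and closed in \<open>M\<close>.\<close>

subsection \<open>Smooth functions\<close>

text \<open>For \<open>\<tau> = 2\<close> the part of the tensor that is quadratic in du reduces to
  the square of du, which is positive only along the gradient, so a large multiple of f would not do
  as u. The exponential makes the Laplacian of u contribute \<open>c |df|\<^sup>2 g\<close> at order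
  \<open>t\<^sup>2 \<phi>\<close>, positive in all directions. The price is the negative rank-one
  part of the Hessian, which is harmful because c may lie below 1; the bound
  \<open>\<phi> \<ge> 1\<close> pays for it.

  A critical point is a zero of the full differential, at boundary points too. Compactness forces f
  to have a maximum; without critical points it has to lie on the boundary, and a nonempty boundary
  is what allows this. Pushing the boundary inwards is the device that starts the removal.

  The estimate is made on finitely many compact coordinate cells and then carried to every chart by
  the transformation laws of Ricci and scalar curvature, which are derived from the component
  formulas. Positive definiteness includes symmetry of the matrix, so the symmetry of the Ricci
  components has to be established as well.\<close>

abbreviation "fderiv f x \<equiv> frechet_derivative f (at x)"

abbreviation smooth_ext :: "'a::euclidean_space set \<Rightarrow> ('a \<Rightarrow> 'b::real_normed_vector) \<Rightarrow> 'a \<Rightarrow> 'a set \<Rightarrow> ('a \<Rightarrow> 'b) \<Rightarrow> bool" where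
  "smooth_ext S f x W h \<equiv> open W \<and> x \<in> W \<and> (\<forall>m. Ck_on m W h) \<and> (\<forall>y. y \<in> S \<longrightarrow> y \<in> W \<longrightarrow> h y = f y)"

text \<open>\<open>Ck_on\<close> refers to the derivative chosen by
  \<open>frechet_derivative\<close>. An explicit derivative may take its place, because functions
  that agree on an open set have the same derivatives of all orders there.\<close>

lemma Ck_on_SucI:
  assumes "\<And>x. x \<in> W \<Longrightarrow> (f has_derivative f' x) (at x)" "\<And>v. Ck_on m W (\<lambda>x. f' x v)" "open W"
  shows "Ck_on (Suc m) W f"
proof -
  have cong: "Ck_on m W f \<longleftrightarrow> Ck_on m W g" if "\<And>x. x \<in> W \<Longrightarrow> f x = g x"
    for f g :: "'a \<Rightarrow> 'b"
    using that
  proof (induction m arbitrary: f g)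
    case 0 then show ?case by (simp cong: continuous_on_cong)
  next
    case (Suc m)
    have *: "(f has_derivative D) (at x) \<longleftrightarrow> (g has_derivative D) (at x)" if "x \<in> W" for x D
      using has_derivative_transform_within_open[OF _ assms(3) that, of f D UNIV g]
        has_derivative_transform_within_open[OF _ assms(3) that, of g D UNIV f] Suc.prems by metis
    then have "fderiv f x = fderiv g x" if "x \<in> W" for x
      using that by (simp add: frechet_derivative_def)
    then have "Ck_on m W (\<lambda>x. fderiv f x v) = Ck_on m W (\<lambda>x. fderiv g x v)" for v
      by (intro Suc.IH) simp
    with * show ?case by (simp add: differentiable_def)
  qed
  have "fderiv f x = f' x" if "x \<in> W" for x
    using frechet_derivative_at[OF assms(1)[OF that]] by simp
  then have "Ck_on m W (\<lambda>x. fderiv f x v)" for v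
    using cong[of "\<lambda>x. fderiv f x v" "\<lambda>x. f' x v"] assms(2) by simp
  with assms(1) show ?thesis by (auto simp: differentiable_def)
qed

lemma Ck_on_deriv:
  assumes "Ck_on (Suc m) W f" "x \<in> W"
  shows "(f has_derivative fderiv f x) (at x)"
  using assms by (simp add: frechet_derivative_works[symmetric])

lemma Ck_on_Suc_imp: "Ck_on (Suc m) W f \<Longrightarrow> Ck_on m W f"
proof (induction m arbitrary: f)
  case 0
  then show ?case
    by (auto intro!: continuous_at_imp_continuous_on differentiable_imp_continuous_within)
qed simp

lemma Ck_on_subset: "Ck_on m W f \<Longrightarrow> V \<subseteq> W \<Longrightarrow> Ck_on m V f"
  by (induction m arbitrary: f) (auto intro: continuous_on_subset)

lemma Ck_on_cong:
  assumes "open W" "\<And>x. x \<in> W \<Longrightarrow> f x = g x" "Ck_on m W f"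
  shows "Ck_on m W g"
proof (cases m)
  case 0 then show ?thesis using assms by (simp cong: continuous_on_cong)
next
  case (Suc l)
  have "(g has_derivative fderiv f x) (at x)" if "x \<in> W" for x
    using has_derivative_transform_within_open[OF Ck_on_deriv[of l W f x] assms(1) that] assms Suc that by auto
  moreover have "Ck_on l W (\<lambda>x. fderiv f x v)" for v
    using assms(3) Suc by simp
  ultimately show ?thesis unfolding Suc by (intro Ck_on_SucI assms(1)) auto
qed

lemma Ck_on_const: "open W \<Longrightarrow> Ck_on m W (\<lambda>x. c)"
proof (induction m arbitrary: c)
  case (Suc m)
  then show ?case by (intro Ck_on_SucI[where f'="\<lambda>x v. 0"]) auto
qed simp

lemma Ck_on_bounded_linear:
  assumes "open W" "bounded_linear L" shows "Ck_on m W L"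
proof (cases m)
  case 0 with assms show ?thesis by (simp add: linear_continuous_on)
next
  case (Suc l)
  show ?thesis unfolding Suc
    by (rule Ck_on_SucI[where f'="\<lambda>x. L"])
      (auto intro: assms bounded_linear_imp_has_derivative Ck_on_const)
qed

lemma Ck_on_linear_comp:
  assumes "open W" "bounded_linear L" "Ck_on m W f" shows "Ck_on m W (\<lambda>x. L (f x))"
  using assms(3)
proof (induction m arbitrary: f)
  case 0 then show ?case
    using assms by (auto intro: bounded_linear.continuous_on)
next
  case (Suc l)
  show ?case
  proof (rule Ck_on_SucI[where f'="\<lambda>x v. L (fderiv f x v)"])
    fix x assume "x \<in> W"
    then show "((\<lambda>x. L (f x)) has_derivative (\<lambda>v. L (fderiv f x v))) (at x)"
      using bounded_linear.has_derivative[OF assms(2) Ck_on_deriv[OF Suc.prems]] by simp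
  qed (use Suc assms in auto)
qed

lemma Ck_on_add:
  assumes "open W" "Ck_on m W f" "Ck_on m W g" shows "Ck_on m W (\<lambda>x. f x + g x)"
  using assms(2,3)
proof (induction m arbitrary: f g)
  case 0 then show ?case by (auto intro: continuous_intros)
next
  case (Suc l)
  show ?case
  proof (rule Ck_on_SucI[where f'="\<lambda>x v. fderiv f x v + fderiv g x v"])
    fix x assume "x \<in> W"
    then show "((\<lambda>x. f x + g x) has_derivative (\<lambda>v. fderiv f x v + fderiv g x v)) (at x)"
      using Ck_on_deriv[OF Suc.prems(1)] Ck_on_deriv[OF Suc.prems(2)] by (intro has_derivative_add) auto
  qed (use Suc assms in auto)
qed

text \<open>Both summands of the product rule are again of the form \<open>B\<close> applied to two
  functions that are differentiable one time less, so the induction closes with \<open>f\<close> and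
  \<open>g\<close> arbitrary.\<close>

lemma Ck_on_bilinear:
  assumes "open W" "bounded_bilinear B" "Ck_on m W f" "Ck_on m W g"
  shows "Ck_on m W (\<lambda>x. B (f x) (g x))"
  using assms(3,4)
proof (induction m arbitrary: f g)
  case 0 then show ?case using assms by (auto intro: bounded_bilinear.continuous_on)
next
  case (Suc l)
  show ?case
  proof (rule Ck_on_SucI[where f'="\<lambda>x v. B (f x) (fderiv g x v) + B (fderiv f x v) (g x)"])
    fix x assume "x \<in> W"
    then show "((\<lambda>x. B (f x) (g x)) has_derivative (\<lambda>v. B (f x) (fderiv g x v) + B (fderiv f x v) (g x))) (at x)"
      using Ck_on_deriv[OF Suc.prems(1)] Ck_on_deriv[OF Suc.prems(2)]
      by (intro bounded_bilinear.FDERIV[OF assms(2)]) auto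
  next
    fix v
    show "Ck_on l W (\<lambda>x. B (f x) (fderiv g x v) + B (fderiv f x v) (g x))"
      using Suc.prems Ck_on_Suc_imp[OF Suc.prems(1)] Ck_on_Suc_imp[OF Suc.prems(2)]
      by (intro Ck_on_add assms(1) Suc.IH) auto
  qed (use assms in auto)
qed

lemma Ck_on_sum:
  assumes "open W" "\<And>i. i \<in> I \<Longrightarrow> Ck_on m W (f i)"
  shows "Ck_on m W (\<lambda>x. \<Sum>i\<in>I. f i x)"
  using assms(2)
  by (induction I rule: infinite_finite_induct) (auto intro: Ck_on_const Ck_on_add assms(1))

text \<open>Expanding the chain rule over \<open>Basis\<close> turns the derivative into a sum of
  products of a component of the derivative of \<open>\<phi>\<close> with a partial derivative of
  \<open>h\<close> composed with \<open>\<phi>\<close>. The induction hypothesis, general in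
  \<open>h\<close>, covers the second factor.\<close>

lemma Ck_on_compose:
  fixes \<phi> :: "'a::euclidean_space \<Rightarrow> 'b::euclidean_space" and h :: "'b \<Rightarrow> 'c::real_normed_vector"
  assumes "open W" "open V" "\<phi> ` W \<subseteq> V" "Ck_on m W \<phi>" "Ck_on m V h"
  shows "Ck_on m W (\<lambda>x. h (\<phi> x))"
  using assms(4,5)
proof (induction m arbitrary: h)
  case 0
  then show ?case using assms(3) continuous_on_compose2[of V h W \<phi>] by auto
next
  case (Suc l)
  let ?d = "\<lambda>x v. \<Sum>b\<in>Basis. (fderiv \<phi> x v \<bullet> b) *\<^sub>R fderiv h (\<phi> x) b"
  show ?case
  proof (rule Ck_on_SucI[where f'="?d"])
    fix x assume x: "x \<in> W"
    have h': "(h has_derivative fderiv h (\<phi> x)) (at (\<phi> x))"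
      using Ck_on_deriv[OF Suc.prems(2)] x assms(3) by auto
    then have lin: "linear (fderiv h (\<phi> x))"
      using has_derivative_linear by blast
    have "((\<lambda>x. h (\<phi> x)) has_derivative (\<lambda>v. fderiv h (\<phi> x) (fderiv \<phi> x v))) (at x)"
      using has_derivative_compose[OF Ck_on_deriv[OF Suc.prems(1) x] h'] .
    moreover have "fderiv h (\<phi> x) (fderiv \<phi> x v) = ?d x v" for v
      by (subst euclidean_representation[of "fderiv \<phi> x v", symmetric])
        (simp add: linear_sum[OF lin] linear_cmul[OF lin] del: euclidean_representation)
    ultimately show "((\<lambda>x. h (\<phi> x)) has_derivative ?d x) (at x)" by simp
  next
    fix v
    have "Ck_on l W (\<lambda>x. fderiv h (\<phi> x) b)" for b
      using Suc.prems Ck_on_Suc_imp[OF Suc.prems(1)] by (intro Suc.IH) auto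
    then show "Ck_on l W (\<lambda>x. ?d x v)"
      using Suc.prems(1)
      by (intro Ck_on_sum assms(1) Ck_on_bilinear[OF _ bounded_bilinear_scaleR])
        (auto intro: Ck_on_linear_comp[OF assms(1) bounded_linear_inner_left])
  qed (use assms in auto)
qed

lemma Ck_on_exp: "Ck_on m UNIV (exp :: real \<Rightarrow> real)"
proof (induction m)
  case 0 show ?case by (simp add: continuous_on_exp)
next
  case (Suc m)
  show ?case
  proof (rule Ck_on_SucI[where f'="\<lambda>x v. v * exp x"])
    show "Ck_on m UNIV (\<lambda>x. v * exp x)" for v :: real
      by (intro Ck_on_bilinear[OF _ bounded_bilinear_mult] Ck_on_const Suc) auto
  qed (auto intro!: derivative_eq_intros)
qed

lemma Ck_on_inverse: "Ck_on m (- {0}) (inverse :: real \<Rightarrow> real)"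
proof (induction m)
  case 0 show ?case by (simp add: continuous_on_inverse)
next
  case (Suc m)
  show ?case
  proof (rule Ck_on_SucI[where f'="\<lambda>x v. (- v) * (inverse x * inverse x)"])
    show "(inverse has_derivative (\<lambda>v. - v * (inverse x * inverse x))) (at x)" if "x \<in> - {0}" for x :: real
      using has_derivative_inverse'[of x UNIV] that by (simp add: algebra_simps)
    show "Ck_on m (- {0}) (\<lambda>x. (- v) * (inverse x * inverse x))" for v :: real
      by (intro Ck_on_bilinear[OF _ bounded_bilinear_mult] Ck_on_const Suc) auto
  qed auto
qed

section \<open>Smoothness on arbitrary sets through local extensions\<close>

lemma smooth_onD:
  assumes "smooth_on S f" "x \<in> S"
  shows "\<exists>W h. smooth_ext S f x W h"
proof -
  from bspec[OF assms(1)[unfolded smooth_on_def] assms(2)]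
  obtain W h where "open W" "x \<in> W" "\<forall>m. Ck_on m W h" "\<forall>y\<in>S \<inter> W. h y = f y" by (elim exE conjE)
  then show ?thesis by (intro exI[of _ W] exI[of _ h] conjI) simp_all
qed

lemma smooth_on_open:
  assumes "open W" "\<And>m. Ck_on m W f" shows "smooth_on W f"
  unfolding smooth_on_def
  by (intro ballI exI[of _ W] exI[of _ f] conjI allI assms) auto

lemma smooth_onI:
  assumes "\<And>x. x \<in> S \<Longrightarrow> \<exists>W h. smooth_ext S f x W h"
  shows "smooth_on S f"
  unfolding smooth_on_def
proof
  fix x assume "x \<in> S"
  from assms[OF this] obtain W h where "open W" "x \<in> W" "\<forall>m. Ck_on m W h" "\<forall>y. y \<in> S \<longrightarrow> y \<in> W \<longrightarrow> h y = f y"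
    by (elim exE conjE)
  then show "\<exists>W h. open W \<and> x \<in> W \<and> (\<forall>m. Ck_on m W h) \<and> (\<forall>y\<in>S \<inter> W. h y = f y)"
    by (intro exI[of _ W] exI[of _ h] conjI) simp_all
qed

lemma smooth_on_subset:
  assumes "smooth_on S f" "T \<subseteq> S" shows "smooth_on T f"
proof (rule smooth_onI)
  fix x assume "x \<in> T"
  then have "x \<in> S" using assms(2) by auto
  from smooth_onD[OF assms(1) this] obtain W h where "open W" "x \<in> W" "\<forall>m. Ck_on m W h" "\<forall>y. y \<in> S \<longrightarrow> y \<in> W \<longrightarrow> h y = f y"
    by (elim exE conjE)
  then show "\<exists>W h. smooth_ext T f x W h"
    using assms(2) by (intro exI[of _ W] exI[of _ h] conjI) auto
qed

lemma smooth_on_local: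
  assumes "\<And>x. x \<in> S \<Longrightarrow> \<exists>U g. open U \<and> x \<in> U \<and> smooth_on (S \<inter> U) g \<and> (\<forall>y\<in>S \<inter> U. f y = g y)"
  shows "smooth_on S f"
  unfolding smooth_on_def
proof
  fix x assume "x \<in> S"
  then obtain U g where U: "open U" "x \<in> U" "smooth_on (S \<inter> U) g" "\<forall>y\<in>S \<inter> U. f y = g y"
    using assms by blast
  have "x \<in> S \<inter> U" using \<open>x \<in> S\<close> U by simp
  from smooth_onD[OF U(3) this] obtain W h where W: "open W" "x \<in> W" "\<forall>m. Ck_on m W h" "\<forall>y. y \<in> S \<inter> U \<longrightarrow> y \<in> W \<longrightarrow> h y = g y"
    by (elim exE conjE)
  show "\<exists>W h. open W \<and> x \<in> W \<and> (\<forall>m. Ck_on m W h) \<and> (\<forall>y\<in>S \<inter> W. h y = f y)"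
    using U W by (intro exI[of _ "W \<inter> U"] exI[of _ h]) (auto intro: Ck_on_subset)
qed

lemma smooth_on_cong:
  assumes "smooth_on S f" "\<And>x. x \<in> S \<Longrightarrow> f x = g x" shows "smooth_on S g"
proof (rule smooth_onI)
  fix x assume "x \<in> S"
  from smooth_onD[OF assms(1) this] obtain W h where "open W" "x \<in> W" "\<forall>m. Ck_on m W h" "\<forall>y. y \<in> S \<longrightarrow> y \<in> W \<longrightarrow> h y = f y"
    by (elim exE conjE)
  then show "\<exists>W h. smooth_ext S g x W h"
    using assms(2) by (intro exI[of _ W] exI[of _ h] conjI) auto
qed

lemma smooth_on_compose:
  fixes f :: "'a::euclidean_space \<Rightarrow> 'b::euclidean_space" and g :: "'b \<Rightarrow> 'c::real_normed_vector"
  assumes "smooth_on S f" "smooth_on T g" "f ` S \<subseteq> T"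
  shows "smooth_on S (\<lambda>x. g (f x))"
  unfolding smooth_on_def
proof
  fix x assume x: "x \<in> S"
  obtain W h where W': "open W" "x \<in> W" "\<forall>m. Ck_on m W h" "\<forall>y. y \<in> S \<longrightarrow> y \<in> W \<longrightarrow> h y = f y"
    using smooth_onD[OF assms(1) x] by (elim exE conjE)
  note W = W'(1,2) W'(3)[rule_format] W'(4)[rule_format]
  have fx: "f x \<in> T" using assms(3) x by auto
  obtain V k where V': "open V" "f x \<in> V" "\<forall>m. Ck_on m V k" "\<forall>y. y \<in> T \<longrightarrow> y \<in> V \<longrightarrow> k y = g y"
    using smooth_onD[OF assms(2) fx] by (elim exE conjE)
  note V = V'(1,2) V'(3)[rule_format] V'(4)[rule_format]
  have "continuous_on W h" using W(3)[of 0] by simp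
  then have o: "open (W \<inter> h -` V)" using W(1) V(1) by (simp add: continuous_open_preimage)
  have "h x = f x" using W x by blast
  show "\<exists>W h. open W \<and> x \<in> W \<and> (\<forall>m. Ck_on m W h) \<and> (\<forall>y\<in>S \<inter> W. h y = g (f y))"
  proof (intro exI[of _ "W \<inter> h -` V"] exI[of _ "\<lambda>x. k (h x)"] conjI allI ballI)
    show "Ck_on m (W \<inter> h -` V) (\<lambda>x. k (h x))" for m
      by (rule Ck_on_compose[OF o V(1)]) (use W V Ck_on_subset[OF W(3)] in auto)
    show "k (h y) = g (f y)" if "y \<in> S \<inter> (W \<inter> h -` V)" for y
      using that W(4)[of y] V(4)[of "f y"] assms(3) by auto
  qed (use o W V \<open>h x = f x\<close> in auto)
qed

text \<open>Two local extensions are restricted to the intersection of their domains and combined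
  there. This serves all operations at once, including unary ones, for which \<open>F\<close>
  ignores its second argument.\<close>

lemma smooth_on_binary:
  fixes S :: "'a::euclidean_space set"
  assumes F: "\<And>(W::'a set) h k m. open W \<Longrightarrow> Ck_on m W h \<Longrightarrow> Ck_on m W k \<Longrightarrow> Ck_on m W (\<lambda>x. F (h x) (k x))"
    and "smooth_on S f" "smooth_on S g"
  shows "smooth_on S (\<lambda>x. F (f x) (g x))"
proof (rule smooth_onI)
  fix x assume x: "x \<in> S"
  obtain W h where W: "open W" "x \<in> W" "\<forall>m. Ck_on m W h" "\<forall>y. y \<in> S \<longrightarrow> y \<in> W \<longrightarrow> h y = f y"
    using smooth_onD[OF assms(2) x] by (elim exE conjE)
  obtain V k where V: "open V" "x \<in> V" "\<forall>m. Ck_on m V k" "\<forall>y. y \<in> S \<longrightarrow> y \<in> V \<longrightarrow> k y = g y"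
    using smooth_onD[OF assms(3) x] by (elim exE conjE)
  have "Ck_on m (W \<inter> V) h" "Ck_on m (W \<inter> V) k" for m
    by (rule Ck_on_subset[OF W(3)[rule_format]] Ck_on_subset[OF V(3)[rule_format]], blast)+
  then have "Ck_on m (W \<inter> V) (\<lambda>x. F (h x) (k x))" for m
    by (rule F[OF open_Int[OF W(1) V(1)]])
  then show "\<exists>W h. smooth_ext S (\<lambda>y. F (f y) (g y)) x W h"
    using W V by (intro exI[of _ "W \<inter> V"] exI[of _ "\<lambda>x. F (h x) (k x)"] conjI) auto
qed

lemma smooth_on_bilinear:
  assumes "bounded_bilinear B" "smooth_on S f" "smooth_on S g"
  shows "smooth_on S (\<lambda>x. B (f x) (g x))"
  by (rule smooth_on_binary[OF Ck_on_bilinear[OF _ assms(1)] assms(2,3)])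

lemma smooth_on_add:
  assumes "smooth_on S f" "smooth_on S g"
  shows "smooth_on S (\<lambda>x. f x + g x)"
  by (rule smooth_on_binary[OF Ck_on_add assms])

lemma smooth_on_const: "smooth_on S (\<lambda>x. c)"
  by (rule smooth_on_subset[OF smooth_on_open[OF open_UNIV]]) (auto intro: Ck_on_const)

lemma smooth_on_bounded_linear: "bounded_linear L \<Longrightarrow> smooth_on S L"
  by (rule smooth_on_subset[OF smooth_on_open[OF open_UNIV]]) (auto intro: Ck_on_bounded_linear)

lemma smooth_on_linear_comp:
  assumes "bounded_linear L" "smooth_on S f"
  shows "smooth_on S (\<lambda>x. L (f x))"
  by (rule smooth_on_binary[where F="\<lambda>a b. L a", OF Ck_on_linear_comp[OF _ assms(1)] assms(2,2)])

lemma smooth_on_id: "smooth_on S (\<lambda>x. x)"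
  by (intro smooth_on_bounded_linear bounded_linear_ident)

lemmas smooth_on_scaleR = smooth_on_bilinear[OF bounded_bilinear_scaleR]
lemmas smooth_on_mult = smooth_on_bilinear[OF bounded_bilinear_mult]
lemmas smooth_on_inner = smooth_on_bilinear[OF bounded_bilinear_inner]

lemma smooth_on_minus: "smooth_on S f \<Longrightarrow> smooth_on S (\<lambda>x. - f x)"
  by (rule smooth_on_linear_comp) (intro bounded_linear_minus bounded_linear_ident)

lemma smooth_on_diff: "smooth_on S f \<Longrightarrow> smooth_on S g \<Longrightarrow> smooth_on S (\<lambda>x. f x - g x)"
  using smooth_on_add[OF _ smooth_on_minus, of S f g] by simp

lemma smooth_on_sum:
  "(\<And>i. i \<in> I \<Longrightarrow> smooth_on S (f i)) \<Longrightarrow> smooth_on S (\<lambda>x. \<Sum>i\<in>I. f i x)"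
  by (induction I rule: infinite_finite_induct) (auto intro: smooth_on_const smooth_on_add)

lemma smooth_on_prod:
  fixes f :: "'i \<Rightarrow> 'a::euclidean_space \<Rightarrow> real"
  shows "(\<And>i. i \<in> I \<Longrightarrow> smooth_on S (f i)) \<Longrightarrow> smooth_on S (\<lambda>x. \<Prod>i\<in>I. f i x)"
  by (induction I rule: infinite_finite_induct) (auto intro: smooth_on_const smooth_on_mult)

lemma smooth_on_nth: "smooth_on S f \<Longrightarrow> smooth_on S (\<lambda>x. f x $ i)"
  by (rule smooth_on_linear_comp) (rule bounded_linear_vec_nth)

lemma smooth_on_vec:
  fixes f :: "'a::euclidean_space \<Rightarrow> 'b::real_normed_vector ^ 'm::finite"
  assumes "\<And>i. smooth_on S (\<lambda>x. f x $ i)"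
  shows "smooth_on S f"
proof -
  have "bounded_linear (\<lambda>y::'b. axis i y :: 'b ^ 'm)" for i
  proof (rule bounded_linear_intro[where K=1])
    fix x :: 'b
    have "(norm ((axis i x :: 'b ^ 'm) $ j))\<^sup>2 = (if j = i then (norm x)\<^sup>2 else 0)" for j
      by (simp add: axis_def)
    then show "norm (axis i x :: 'b ^ 'm) \<le> norm x * 1"
      by (simp add: norm_vec_def L2_set_def)
  qed (auto simp: vec_eq_iff axis_def)
  then have "smooth_on S (\<lambda>x. axis i (f x $ i) :: 'b ^ 'm)" for i
    by (rule smooth_on_linear_comp) (rule assms)
  then have "smooth_on S (\<lambda>x. \<Sum>i\<in>UNIV. axis i (f x $ i) :: 'b ^ 'm)"
    by (intro smooth_on_sum) auto
  moreover have "(\<Sum>i\<in>UNIV. axis i (v $ i)) = v" for v :: "'b ^ 'm"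
    by (simp add: vec_eq_iff axis_def)
  ultimately show ?thesis by simp
qed

lemma smooth_on_exp: "smooth_on S f \<Longrightarrow> smooth_on S (\<lambda>x. exp (f x :: real))"
  by (rule smooth_on_compose[OF _ smooth_on_open[OF open_UNIV Ck_on_exp]]) auto

lemma smooth_on_inverse: "smooth_on S f \<Longrightarrow> (\<And>x. x \<in> S \<Longrightarrow> f x \<noteq> 0) \<Longrightarrow> smooth_on S (\<lambda>x. inverse (f x :: real))"
  by (rule smooth_on_compose[OF _ smooth_on_open[OF _ Ck_on_inverse]]) auto

lemma smooth_on_continuous: "smooth_on S f \<Longrightarrow> continuous_on S f"
proof -
  assume f: "smooth_on S f"
  have "continuous (at x within S) f" if x: "x \<in> S" for x
  proof -
    obtain W h where W': "open W" "x \<in> W" "\<forall>m. Ck_on m W h" "\<forall>y. y \<in> S \<longrightarrow> y \<in> W \<longrightarrow> h y = f y"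
    using smooth_onD[OF f x] by (elim exE conjE)
  note W = W'(1,2) W'(3)[rule_format] W'(4)[rule_format]
    have "continuous (at x within S) h"
      using W(1,2) W(3)[of 0] by (simp add: continuous_on_eq_continuous_at continuous_at_imp_continuous_within)
    moreover have "eventually (\<lambda>y. h y = f y) (at x within S)"
      using W by (auto simp: eventually_at_topological)
    moreover have "h x = f x" using W x by blast
    ultimately show ?thesis
      unfolding continuous_within using tendsto_cong by metis
  qed
  then show ?thesis by (simp add: continuous_on_eq_continuous_within)
qed

lemma smooth_on_det:
  assumes "smooth_on S A"
  shows "smooth_on S (\<lambda>x. det (A x :: real^'n^'n))"
  unfolding det_def by (intro smooth_on_sum smooth_on_mult smooth_on_const smooth_on_prod smooth_on_nth assms)

section \<open>Directional derivatives on relatively open subsets of a half-space\<close>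

abbreviation hopen :: "'n::finite \<Rightarrow> (real^'n) set \<Rightarrow> bool" where
  "hopen k S \<equiv> openin (top_of_set (halfspace k)) S"

text \<open>Arbitrary directions in place of the coordinate directions of \<open>pd\<close> make the
  derivative a linear map, so that connection and curvature can be treated as multilinear maps
  without indices.\<close>

definition dd :: "'a::real_normed_vector set \<Rightarrow> ('a \<Rightarrow> 'b::real_normed_vector) \<Rightarrow> 'a \<Rightarrow> 'a \<Rightarrow> 'b" where
  "dd S f v x = frechet_derivative f (at x within S) v"

lemma pd_dd: "pd S i f x = dd S f (axis i 1) x"
  by (simp add: pd_def dd_def)

lemma dd_eqI:
  assumes "(f has_derivative f') (at x within S)" "hopen k S" "x \<in> S"
  shows "dd S f v x = f' v"
  using frechet_derivative_within_halfspace[OF assms(2,3,1)] by (simp add: dd_def)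

text \<open>Derivatives within \<open>S\<close> are unique even on the boundary hyperplane, so they
  coincide with the derivatives of any smooth extension. Facts about interior derivatives thereby
  reach boundary points.\<close>

lemma smooth_on_extension:
  assumes "hopen k S" "smooth_on S f" "x \<in> S"
  obtains W h where "open W" "x \<in> W" "\<forall>m. Ck_on m W h" "\<forall>y. y \<in> S \<longrightarrow> y \<in> W \<longrightarrow> h y = f y"
    "\<forall>y v. y \<in> S \<longrightarrow> y \<in> W \<longrightarrow> dd S f v y = fderiv h y v"
    "\<forall>y. y \<in> S \<longrightarrow> y \<in> W \<longrightarrow> (f has_derivative fderiv h y) (at y within S)"
proof -
  obtain W h where W: "open W" "x \<in> W" "\<forall>m. Ck_on m W h" "\<forall>y. y \<in> S \<longrightarrow> y \<in> W \<longrightarrow> h y = f y"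
    using smooth_onD[OF assms(2,3)] by (elim exE conjE)
  have d: "(f has_derivative fderiv h y) (at y within S)" if y: "y \<in> S" "y \<in> W" for y
  proof -
    obtain e where e: "e > 0" "ball y e \<subseteq> W" using W(1) y(2) openE by blast
    have "(h has_derivative fderiv h y) (at y within S)"
      using Ck_on_deriv[OF W(3)[rule_format, of "Suc 0"] y(2)] has_derivative_at_withinI by blast
    then show ?thesis
      by (rule has_derivative_transform_within[OF _ e(1) y(1)]) (use W(4) e(2) in \<open>auto simp: dist_commute subset_iff\<close>)
  qed
  then have "dd S f v y = fderiv h y v" if "y \<in> S" "y \<in> W" for y v
    using dd_eqI[OF _ assms(1)] that by blast
  with d W show thesis by (intro that[of W h]) simp_all
qed

lemma smooth_on_dd:
  assumes "hopen k S" "smooth_on S f"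
  shows "smooth_on S (dd S f v)"
proof (rule smooth_onI)
  fix x assume "x \<in> S"
  then obtain W h where W: "open W" "x \<in> W" "\<forall>m. Ck_on m W h" "\<forall>y. y \<in> S \<longrightarrow> y \<in> W \<longrightarrow> h y = f y"
    "\<forall>y v. y \<in> S \<longrightarrow> y \<in> W \<longrightarrow> dd S f v y = fderiv h y v"
    by (rule smooth_on_extension[OF assms])
  have "Ck_on m W (\<lambda>y. fderiv h y v)" for m
    using W(3)[rule_format, of "Suc m"] by simp
  then show "\<exists>W h. smooth_ext S (dd S f v) x W h"
    using W by (intro exI[of _ W] exI[of _ "\<lambda>y. fderiv h y v"]) simp
qed

lemma has_derivative_dd:
  assumes "hopen k S" "smooth_on S f" "x \<in> S"
  shows "(f has_derivative (\<lambda>v. dd S f v x)) (at x within S)"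
proof -
  obtain W h where W: "x \<in> W" "\<forall>y v. y \<in> S \<longrightarrow> y \<in> W \<longrightarrow> dd S f v y = fderiv h y v"
    "\<forall>y. y \<in> S \<longrightarrow> y \<in> W \<longrightarrow> (f has_derivative fderiv h y) (at y within S)"
    by (rule smooth_on_extension[OF assms])
  then have "(\<lambda>v. dd S f v x) = fderiv h x" using assms(3) by auto
  then show ?thesis using W assms(3) by simp
qed

lemma linear_dd:
  assumes "hopen k S" "smooth_on S f" "x \<in> S"
  shows "linear (\<lambda>v. dd S f v x)"
  using has_derivative_dd[OF assms] has_derivative_linear by blast

text \<open>The mean value theorem is applied twice: along \<open>v\<close> to the difference of
  \<open>h\<close> on two parallel segments, then along \<open>w\<close> to the directional
  derivative of \<open>h\<close> in direction \<open>v\<close>.\<close>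

lemma second_difference_MVT:
  fixes h :: "'a::euclidean_space \<Rightarrow> real"
  assumes C: "Ck_on 2 W h" and W: "ball x r \<subseteq> W" and t: "0 < t" "t * (norm v + norm w) < r"
  shows "\<exists>\<xi>\<in>ball x r. h (x + t *\<^sub>R v + t *\<^sub>R w) - h (x + t *\<^sub>R v) - h (x + t *\<^sub>R w) + h x
     = t * t * fderiv (\<lambda>y. fderiv h y v) \<xi> w"
proof -
  let ?d = "\<lambda>y. fderiv h y v" and ?dd = "\<lambda>y. fderiv (\<lambda>y. fderiv h y v) y"
  have C2: "Ck_on (Suc (Suc 0)) W h" using C by (simp add: numeral_2_eq_2)
  have in_ball: "x + s *\<^sub>R v + s' *\<^sub>R w \<in> ball x r" if "0 \<le> s" "s \<le> t" "0 \<le> s'" "s' \<le> t" for s s'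
  proof -
    have "norm (s *\<^sub>R v + s' *\<^sub>R w) \<le> s * norm v + s' * norm w"
      using norm_triangle_ineq[of "s *\<^sub>R v" "s' *\<^sub>R w"] that by simp
    also have "\<dots> \<le> t * norm v + t * norm w"
      using that by (intro add_mono mult_right_mono) auto
    also have "\<dots> < r" using t by (simp add: distrib_left)
    finally show ?thesis by (simp add: dist_norm norm_minus_commute add.assoc add.commute[of "s' *\<^sub>R w"])
  qed
  have h': "(h has_derivative fderiv h y) (at y)" if "y \<in> ball x r" for y
    using Ck_on_deriv[OF C2] that W by blast
  have h'': "(?d has_derivative
      ?dd y) (at y)" if "y \<in> ball x r" for y
  proof -
    have "Ck_on (Suc 0) W ?d" using C2 by simp
    then show ?thesis using Ck_on_deriv that W by blast
  qed
  have line: "((\<lambda>s. f (a + s *\<^sub>R u)) has_real_derivative fderiv f (a + s *\<^sub>R u) u) (at s)"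
    if "(f has_derivative fderiv f (a + s *\<^sub>R u)) (at (a + s *\<^sub>R u))" for f :: "'a \<Rightarrow> real" and a u s
  proof -
    have "((\<lambda>s. f (a + s *\<^sub>R u)) has_derivative (\<lambda>d. fderiv f (a + s *\<^sub>R u) (d *\<^sub>R u))) (at s)"
      by (rule has_derivative_compose[where f="\<lambda>s. a + s *\<^sub>R u" and g=f and f'="\<lambda>d. d *\<^sub>R u"])
        (auto intro!: derivative_eq_intros that)
    moreover have "linear (fderiv f (a + s *\<^sub>R u))"
      using that has_derivative_linear by blast
    ultimately show ?thesis
      by (simp add: has_field_derivative_def linear_cmul mult_commute_abs)
  qed
  let ?\<phi> = "\<lambda>s. h (x + t *\<^sub>R w + s *\<^sub>R v) - h (x + s *\<^sub>R v)"
  obtain s where s: "0 < s" "s < t" "?\<phi> t - ?\<phi> 0 = (t - 0) * (?d (x + t *\<^sub>R w + s *\<^sub>R v) - ?d (x + s *\<^sub>R v))"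
  proof (rule exE[OF MVT2[OF t(1), of ?\<phi> "\<lambda>s. ?d (x + t *\<^sub>R w + s *\<^sub>R v) - ?d (x + s *\<^sub>R v)"]])
    fix s assume s: "0 \<le> s" "s \<le> t"
    show "(?\<phi> has_real_derivative ?d (x + t *\<^sub>R w + s *\<^sub>R v) - ?d (x + s *\<^sub>R v)) (at s)"
      using in_ball[of s t] in_ball[of s 0] s t
      by (intro DERIV_diff line h') (auto simp: add_ac)
  qed (use that in auto)
  obtain s' where s': "0 < s'" "s' < t" "?d (x + s *\<^sub>R v + t *\<^sub>R w) - ?d (x + s *\<^sub>R v + 0 *\<^sub>R w)
    = (t - 0) * ?dd (x + s *\<^sub>R v + s' *\<^sub>R w) w"
  proof (rule exE[OF MVT2[OF t(1), of "\<lambda>s'. ?d (x + s *\<^sub>R v + s' *\<^sub>R w)" "\<lambda>s'. ?dd (x + s *\<^sub>R v + s' *\<^sub>R w) w"]])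
    fix s' assume "0 \<le> s'" "s' \<le> t"
    then show "((\<lambda>s'. ?d (x + s *\<^sub>R v + s' *\<^sub>R w)) has_real_derivative
       ?dd (x + s *\<^sub>R v + s' *\<^sub>R w) w) (at s')"
      using in_ball[of s s'] s by (intro line h'') auto
  qed (use that in auto)
  have "?\<phi> t - ?\<phi> 0 = t * (t * ?dd (x + s *\<^sub>R v + s' *\<^sub>R w) w)"
    using s(3) s'(3) by (simp add: add_ac)
  then show ?thesis
    using in_ball[of s s'] s s'
    by (intro bexI[of _ "x + s *\<^sub>R v + s' *\<^sub>R w"]) (auto simp: add_ac algebra_simps)
qed

text \<open>The second difference is symmetric in \<open>v\<close> and \<open>w\<close>, so the two
  mixed derivatives agree at suitable points arbitrarily close to \<open>x\<close>; continuity
  brings the equality to \<open>x\<close> itself.\<close>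

lemma Ck_on_commute_real:
  fixes h :: "'a::euclidean_space \<Rightarrow> real"
  assumes C: "Ck_on 2 W h" and W: "open W" "x \<in> W"
  shows "fderiv (\<lambda>y. fderiv h y v) x w
       = fderiv (\<lambda>y. fderiv h y w) x v"
    (is "?F v w x = ?F w v x")
proof (rule ccontr)
  assume ne: "?F v w x \<noteq> ?F w v x"
  \<comment> \<open>Half the supposed gap: values within \<open>e\<close> of the two different
    numbers cannot coincide.\<close>
  define e where "e = \<bar>?F v w x - ?F w v x\<bar> / 2"
  have e: "e > 0" using ne by (simp add: e_def)
  have cont: "continuous_on W (?F v w)" for v w using C by (simp add: numeral_2_eq_2)
  have "\<exists>d>0. \<forall>y. dist y x < d \<longrightarrow> dist (?F v w y) (?F v w x) < e" for v w
    using cont[of v w] W e by (simp add: continuous_on_eq_continuous_at continuous_at_eps_delta)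
  then obtain d1 d2 where d: "d1 > 0" "d2 > 0" "\<And>y. dist y x < d1 \<Longrightarrow> dist (?F v w y) (?F v w x) < e"
    "\<And>y. dist y x < d2 \<Longrightarrow> dist (?F w v y) (?F w v x) < e" by metis
  obtain d3 where d3: "d3 > 0" "ball x d3 \<subseteq> W" using W openE by blast
  define r where "r = min d1 (min d2 d3)"
  have r: "r > 0" "ball x r \<subseteq> W" "r \<le> d1" "r \<le> d2" using d d3 by (auto simp: r_def)
  \<comment> \<open>Small enough to keep the parallelogram spanned by \<open>t v\<close> and
    \<open>t w\<close> inside the ball; the added 1 avoids division by zero when both vectors
    vanish.\<close>
  define t where "t = r / (2 * (norm v + norm w + 1))"
  have pos: "norm v + norm w + 1 > 0" by (simp add: add_nonneg_pos)
  have t: "t > 0" "t * (norm v + norm w) < r"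
  proof -
    show "t > 0" using r pos by (simp add: t_def)
    have "t * (norm v + norm w) \<le> t * (norm v + norm w + 1)" using \<open>t > 0\<close> by simp
    also have "\<dots> = r / 2" using pos by (simp add: t_def field_simps)
    also have "\<dots> < r" using r by simp
    finally show "t * (norm v + norm w) < r" .
  qed
  obtain \<xi> where \<xi>: "\<xi> \<in> ball x r" "h (x + t *\<^sub>R v + t *\<^sub>R w) - h (x + t *\<^sub>R v) - h (x + t *\<^sub>R w) + h x = t * t * ?F v w \<xi>"
    using second_difference_MVT[OF C r(2) t] by blast
  obtain \<eta> where \<eta>: "\<eta> \<in> ball x r" "h (x + t *\<^sub>R w + t *\<^sub>R v) - h (x + t *\<^sub>R w) - h (x + t *\<^sub>R v) + h x = t * t * ?F w v \<eta>"
    using second_difference_MVT[OF C r(2) t(1), of w v] t(2) by (auto simp: add.commute)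
  have "t * t * ?F v w \<xi> = t * t * ?F w v \<eta>"
  proof -
    have "x + t *\<^sub>R w + t *\<^sub>R v = x + t *\<^sub>R v + t *\<^sub>R w" by (simp add: add_ac)
    then have "h (x + t *\<^sub>R w + t *\<^sub>R v) = h (x + t *\<^sub>R v + t *\<^sub>R w)" by (rule arg_cong)
    with \<eta>(2) \<xi>(2) show ?thesis by linarith
  qed
  then have "?F v w \<xi> = ?F w v \<eta>" using t by simp
  moreover have "\<bar>?F v w \<xi> - ?F v w x\<bar> < e" "\<bar>?F w v \<eta> - ?F w v x\<bar> < e"
    using d(3)[of \<xi>] d(4)[of \<eta>] \<xi>(1) \<eta>(1) r by (auto simp: dist_commute dist_real_def)
  moreover have False if "a = b" "\<bar>a - c\<bar> < \<bar>c - d\<bar> / 2" "\<bar>b - d\<bar> < \<bar>c - d\<bar> / 2" for a b c d :: real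
    using that by (auto simp: abs_if field_simps split: if_splits)
  ultimately show False unfolding e_def by blast
qed

lemma dd_linear_comp:
  assumes "bounded_linear L" "hopen k S" "smooth_on S f" "x \<in> S"
  shows "dd S (\<lambda>x. L (f x)) v x = L (dd S f v x)"
  by (rule dd_eqI[OF bounded_linear.has_derivative[OF assms(1) has_derivative_dd[OF assms(2-4)]] assms(2,4)])

lemma dd_cong:
  assumes "x \<in> S" "\<And>y. y \<in> S \<Longrightarrow> f y = h y"
  shows "dd S f v x = dd S h v x"
proof -
  have "(f has_derivative D) (at x within S) \<longleftrightarrow> (h has_derivative D) (at x within S)" for D
    using assms by (metis has_derivative_transform)
  then show ?thesis
    by (simp add: dd_def frechet_derivative_def)
qed

lemma dd_commute_real:
  fixes f :: "real^'n \<Rightarrow> real"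
  assumes S: "hopen k S" "smooth_on S f" "x \<in> S"
  shows "dd S (dd S f v) w x = dd S (dd S f w) v x"
proof -
  obtain W h where W: "open W" "x \<in> W" "\<forall>m. Ck_on m W h" "\<forall>y. y \<in> S \<longrightarrow> y \<in> W \<longrightarrow> h y = f y"
    "\<forall>y v. y \<in> S \<longrightarrow> y \<in> W \<longrightarrow> dd S f v y = fderiv h y v"
    by (rule smooth_on_extension[OF S])
  have "dd S (dd S f v) w x = fderiv (\<lambda>y. fderiv h y v) x w" for v w
  proof -
    let ?D = "\<lambda>y. fderiv h y v"
    obtain e where e: "e > 0" "ball x e \<subseteq> W" using W(1,2) openE by blast
    have "Ck_on (Suc 0) W ?D" using W(3)[rule_format, of "Suc (Suc 0)"] by simp
    then have "(?D has_derivative fderiv ?D x) (at x within S)"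
      using Ck_on_deriv W(2) has_derivative_at_withinI by blast
    then have "(dd S f v has_derivative fderiv ?D x) (at x within S)"
      by (rule has_derivative_transform_within[OF _ e(1) S(3)]) (use W(5) e(2) in \<open>auto simp: dist_commute subset_iff\<close>)
    then show ?thesis by (rule dd_eqI[OF _ S(1,3)])
  qed
  then show ?thesis
    using Ck_on_commute_real[OF W(3)[rule_format] W(1,2)] by simp
qed

lemma dd_commute:
  fixes f :: "real^'n \<Rightarrow> 'b::euclidean_space"
  assumes S: "hopen k S" "smooth_on S f" "x \<in> S"
  shows "dd S (dd S f v) w x = dd S (dd S f w) v x"
proof (rule euclidean_eqI)
  fix b :: 'b assume "b \<in> Basis"
  have L: "bounded_linear (\<lambda>y. y \<bullet> b)" by (rule bounded_linear_inner_left)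
  have "dd S (dd S f v) w x \<bullet> b = dd S (dd S (\<lambda>y. f y \<bullet> b) v) w x" for v w
    using dd_linear_comp[OF L S(1) smooth_on_dd[OF S(1,2)] S(3)] dd_linear_comp[OF L S(1,2)]
    by (subst dd_cong[OF S(3), of "dd S (\<lambda>y. f y \<bullet> b) v" "\<lambda>y. dd S f v y \<bullet> b"]) simp_all
  then show "dd S (dd S f v) w x \<bullet> b = dd S (dd S f w) v x \<bullet> b"
    using dd_commute_real[OF S(1) smooth_on_linear_comp[OF L S(2)] S(3)] by simp
qed

subsection \<open>The Levi-Civita connection and its curvature in a patch\<close>

lemma linear_eq_axis:
  fixes f g :: "real^'n \<Rightarrow> 'b::real_vector"
  assumes "linear f" "linear g" "\<And>i. f (axis i 1) = g (axis i 1)"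
  shows "f v = g v"
proof -
  have "f (\<Sum>i\<in>UNIV. v $ i *\<^sub>R axis i 1) = g (\<Sum>i\<in>UNIV. v $ i *\<^sub>R axis i 1)"
    using assms by (simp add: linear_sum linear_cmul)
  then show ?thesis using basis_expansion[of v] by (simp add: scalar_mult_eq_scaleR)
qed

lemma linear_axis_sum:
  fixes f :: "real^'n \<Rightarrow> 'b::real_vector"
  assumes "linear f"
  shows "f v = (\<Sum>i\<in>UNIV. v $ i *\<^sub>R f (axis i 1))"
  by (rule linear_eq_axis[OF assms])
    (auto intro!: linearI simp: sum.distrib scaleR_left_distrib scaleR_sum_right axis_def
      if_distrib[where f="\<lambda>c. c *\<^sub>R _"] cong: if_cong)

text \<open>Product rule for a linear map depending on \<open>y\<close>, evaluated at a moving
  vector. Expanding that vector in coordinates means that only derivatives of \<open>F\<close> at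
  fixed vectors occur, and no operator-valued functions.\<close>

lemma has_derivative_linear_family:
  fixes F :: "'z::real_normed_vector \<Rightarrow> real^'n \<Rightarrow> 'b::real_normed_vector" and u :: "'z \<Rightarrow> real^'n"
  assumes lin: "\<And>y. y \<in> S \<Longrightarrow> linear (F y)" and lin': "\<And>z. linear (\<lambda>a. F' a z)"
    and F: "\<And>a. ((\<lambda>y. F y a) has_derivative F' a) (at x within S)"
    and u: "(u has_derivative u') (at x within S)" and x: "x \<in> S"
  shows "((\<lambda>y. F y (u y)) has_derivative (\<lambda>z. F' (u x) z + F x (u' z))) (at x within S)"
proof -
  have "((\<lambda>y. \<Sum>i\<in>UNIV. u y $ i *\<^sub>R F y (axis i 1)) has_derivative
      (\<lambda>z. \<Sum>i\<in>UNIV. u x $ i *\<^sub>R F' (axis i 1) z + u' z $ i *\<^sub>R F x (axis i 1))) (at x within S)"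
    by (intro has_derivative_sum has_derivative_scaleR F bounded_linear.has_derivative[OF bounded_linear_vec_nth u])
  moreover have "(\<Sum>i\<in>UNIV. u x $ i *\<^sub>R F' (axis i 1) z + u' z $ i *\<^sub>R F x (axis i 1)) = F' (u x) z + F x (u' z)" for z
    using linear_axis_sum[OF lin'[of z], of "u x"] linear_axis_sum[OF lin[OF x], of "u' z"]
    by (simp add: sum.distrib)
  ultimately have "((\<lambda>y. \<Sum>i\<in>UNIV. u y $ i *\<^sub>R F y (axis i 1)) has_derivative
      (\<lambda>z. F' (u x) z + F x (u' z))) (at x within S)" by simp
  then show ?thesis
    by (rule has_derivative_transform[OF x, rotated]) (rule linear_axis_sum[OF lin])
qed

lemma has_derivative_bilinear_family:
  fixes F :: "'z::real_normed_vector \<Rightarrow> real^'n \<Rightarrow> real^'m \<Rightarrow> 'b::real_normed_vector"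
  assumes lin: "\<And>y b. y \<in> S \<Longrightarrow> linear (\<lambda>a. F y a b)" "\<And>y a. y \<in> S \<Longrightarrow> linear (F y a)"
    and lin': "\<And>z b. linear (\<lambda>a. F' a b z)" "\<And>z a. linear (\<lambda>b. F' a b z)"
    and F: "\<And>a b. ((\<lambda>y. F y a b) has_derivative F' a b) (at x within S)"
    and u: "(u has_derivative u') (at x within S)" and w: "(w has_derivative w') (at x within S)" and x: "x \<in> S"
  shows "((\<lambda>y. F y (u y) (w y)) has_derivative
     (\<lambda>z. F' (u x) (w x) z + F x (u' z) (w x) + F x (u x) (w' z))) (at x within S)"
  by (rule has_derivative_linear_family[where F="\<lambda>y. F y (u y)" and F'="\<lambda>b z. F' (u x) b z + F x (u' z) b"])
    (auto intro!: lin lin' x w linear_compose_add has_derivative_linear_family[where F="\<lambda>y a. F y a _" and F'="\<lambda>a. F' a _"] F u)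

lemma linear_dd_family:
  assumes "hopen k S" "x \<in> S" "\<And>y. y \<in> S \<Longrightarrow> linear (F y)" "\<And>a. smooth_on S (\<lambda>y. F y a)"
  shows "linear (\<lambda>a. dd S (\<lambda>y. F y a) z x)"
proof (rule linearI)
  fix a b
  have "dd S (\<lambda>y. F y (a + b)) z x = dd S (\<lambda>y. F y a + F y b) z x"
    by (rule dd_cong[OF assms(2)]) (simp add: linear_add assms(3))
  also have "\<dots> = dd S (\<lambda>y. F y a) z x + dd S (\<lambda>y. F y b) z x"
    by (rule dd_eqI[OF _ assms(1,2)]) (intro has_derivative_add has_derivative_dd[OF assms(1) assms(4) assms(2)])
  finally show "dd S (\<lambda>y. F y (a + b)) z x = dd S (\<lambda>y. F y a) z x + dd S (\<lambda>y. F y b) z x" .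
next
  fix r a
  have "dd S (\<lambda>y. F y (r *\<^sub>R a)) z x = dd S (\<lambda>y. r *\<^sub>R F y a) z x"
    by (rule dd_cong[OF assms(2)]) (simp add: linear_cmul assms(3))
  also have "\<dots> = r *\<^sub>R dd S (\<lambda>y. F y a) z x"
    by (rule dd_linear_comp[OF bounded_linear_scaleR_right assms(1) assms(4) assms(2)])
  finally show "dd S (\<lambda>y. F y (r *\<^sub>R a)) z x = r *\<^sub>R dd S (\<lambda>y. F y a) z x" .
qed

section \<open>Inverse matrices and their smooth dependence on the matrix\<close>

lemma positive_definite_invertible:
  fixes A :: "real^'n^'n"
  assumes "positive_definite A" shows "invertible A"
proof -
  have "\<forall>v. A *v v = 0 \<longrightarrow> v = 0" using assms unfolding positive_definite_def by force
  then show ?thesis by (simp add: invertible_left_inverse matrix_left_invertible_ker)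
qed

lemma matrix_inv_works:
  fixes A :: "real^'n^'n"
  assumes "invertible A" shows "A ** matrix_inv A = mat 1" "matrix_inv A ** A = mat 1"
proof -
  have "A ** matrix_inv A = mat 1 \<and> matrix_inv A ** A = mat 1"
    using assms unfolding invertible_def matrix_inv_def by (rule someI_ex)
  then show "A ** matrix_inv A = mat 1" "matrix_inv A ** A = mat 1" by auto
qed

lemma matrix_inv_unique:
  fixes A B :: "real^'n^'n"
  assumes "A ** B = mat 1" shows "matrix_inv A = B"
proof -
  have BA: "B ** A = mat 1" using assms by (simp add: matrix_left_right_inverse)
  then have "invertible A" using assms by (auto simp: invertible_def)
  then have "matrix_inv A = matrix_inv A ** (A ** B)" by (simp add: assms)
  also have "\<dots> = B" using matrix_inv_works(2)[OF \<open>invertible A\<close>] by (simp add: matrix_mul_assoc)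
  finally show ?thesis .
qed

text \<open>Cramer's rule displays the entries of the inverse as quotients of determinants, from
  which their smoothness can be read off.\<close>

lemma matrix_inv_cramer:
  fixes A :: "real^'n^'n"
  assumes "invertible A"
  shows "matrix_inv A $ l $ m = det (\<chi> i j. if j = l then axis m 1 $ i else A $ i $ j) * inverse (det A)"
proof -
  have d: "det A \<noteq> 0" using assms invertible_det_nz by blast
  have "A *v (matrix_inv A *v axis m 1) = axis m 1"
    by (simp add: matrix_vector_mul_assoc matrix_inv_works(1)[OF assms])
  then have "matrix_inv A *v axis m 1 = (\<chi> l. det (\<chi> i j. if j = l then axis m 1 $ i else A $ i $ j) / det A)"
    by (rule iffD1[OF cramer[OF d]])
  then have "(matrix_inv A *v axis m 1) $ l = det (\<chi> i j. if j = l then axis m 1 $ i else A $ i $ j) / det A"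
    by simp
  moreover have "(matrix_inv A *v axis m 1) $ l = matrix_inv A $ l $ m"
    by (simp add: matrix_vector_mult_basis column_def)
  ultimately show ?thesis by (simp add: divide_inverse)
qed

lemma smooth_on_matrix_inv:
  fixes A :: "'a::euclidean_space \<Rightarrow> real^'n^'n"
  assumes A: "smooth_on S A" and inv: "\<And>x. x \<in> S \<Longrightarrow> invertible (A x)"
  shows "smooth_on S (\<lambda>x. matrix_inv (A x))"
proof (rule smooth_on_vec, rule smooth_on_vec)
  fix l m
  have "smooth_on S (\<lambda>x. (\<chi> i j. if j = l then axis m 1 $ i else A x $ i $ j) :: real^'n^'n)"
  proof (rule smooth_on_vec, rule smooth_on_vec)
    fix i j
    show "smooth_on S (\<lambda>x. ((\<chi> i j. if j = l then axis m 1 $ i else A x $ i $ j) :: real^'n^'n) $ i $ j)"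
      by (cases "j = l") (simp_all add: smooth_on_const smooth_on_nth[OF smooth_on_nth[OF A]])
  qed
  then have "smooth_on S (\<lambda>x. det (\<chi> i j. if j = l then axis m 1 $ i else A x $ i $ j) * inverse (det (A x)))"
    using inv invertible_det_nz by (intro smooth_on_mult smooth_on_det smooth_on_inverse A) auto
  then show "smooth_on S (\<lambda>x. matrix_inv (A x) $ l $ m)"
    by (rule smooth_on_cong) (simp add: matrix_inv_cramer inv)
qed

definition bform :: "(real^'n \<Rightarrow> real^'n^'n) \<Rightarrow> real^'n \<Rightarrow> real^'n \<Rightarrow> real^'n \<Rightarrow> real" where
  "bform g x v w = v \<bullet> (g x *v w)"

text \<open>Christoffel symbols and curvature as multilinear maps: \<open>Rm S g x z v w\<close> is \<open>R(z,v)w\<close> at \<open>x\<close>.\<close>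

definition Gam :: "(real^'n) set \<Rightarrow> (real^'n \<Rightarrow> real^'n^'n) \<Rightarrow> real^'n \<Rightarrow> real^'n \<Rightarrow> real^'n \<Rightarrow> real^'n::finite" where
  "Gam S g x v w = (\<chi> l. \<Sum>i\<in>UNIV. \<Sum>j\<in>UNIV. christoffel S g l i j x * v $ i * w $ j)"

definition Rm :: "(real^'n) set \<Rightarrow> (real^'n \<Rightarrow> real^'n^'n) \<Rightarrow> real^'n \<Rightarrow> real^'n \<Rightarrow> real^'n \<Rightarrow> real^'n \<Rightarrow> real^'n::finite" where
  "Rm S g x z v w = dd S (\<lambda>y. Gam S g y v w) z x - dd S (\<lambda>y. Gam S g y z w) v x
     + Gam S g x z (Gam S g x v w) - Gam S g x v (Gam S g x z w)"

lemma sum_axis: "(\<Sum>j\<in>UNIV. f j * axis i (1::real) $ j) = f i"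
  by (simp add: axis_def if_distrib[where f="\<lambda>c. _ * c"] cong: if_cong)

lemma Gam_axis: "Gam S g x (axis i 1) (axis j 1) = (\<chi> l. christoffel S g l i j x)"
  by (simp add: Gam_def vec_eq_iff sum_axis)

lemma Gam_axis2: "Gam S g x (axis i 1) w = (\<chi> l. \<Sum>j\<in>UNIV. christoffel S g l i j x * w $ j)"
proof -
  have "(\<Sum>i'\<in>UNIV. \<Sum>j\<in>UNIV. christoffel S g l i' j x * axis i 1 $ i' * w $ j)
      = (\<Sum>j\<in>UNIV. (\<Sum>i'\<in>UNIV. christoffel S g l i' j x * axis i 1 $ i') * w $ j)" for l
    by (subst sum.swap) (simp add: sum_distrib_right)
  then show ?thesis by (simp add: Gam_def sum_axis)
qed

lemma linear_Gam1: "linear (\<lambda>v. Gam S g x v w)"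
  by (rule linearI) (auto simp: Gam_def vec_eq_iff algebra_simps sum.distrib sum_distrib_left)

lemma linear_Gam2: "linear (Gam S g x v)"
  by (rule linearI) (auto simp: Gam_def vec_eq_iff algebra_simps sum.distrib sum_distrib_left)

lemma linear_bform1: "linear (\<lambda>v. bform g x v w)"
  by (rule linearI) (auto simp: bform_def inner_left_distrib)

lemma linear_bform2: "linear (bform g x v)"
  by (rule linearI) (auto simp: bform_def matrix_vector_right_distrib inner_right_distrib matrix_vector_mult_scaleR)

lemma bform_axis: "bform g x (axis i 1) (axis j 1) = g x $ i $ j"
  by (simp add: bform_def inner_axis' matrix_vector_mult_basis column_def)

section \<open>The Levi-Civita connection in one patch\<close>

locale metric_patch =
  fixes k :: "'n::finite" and S :: "(real^'n) set" and g :: "real^'n \<Rightarrow> real^'n^'n"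
  assumes hopen: "hopen k S" and smooth_g: "smooth_on S g"
    and pos: "\<And>x. x \<in> S \<Longrightarrow> positive_definite (g x)"
begin

abbreviation "B \<equiv> bform g"
abbreviation "\<Gamma> \<equiv> Gam S g"

lemma B_sym: "x \<in> S \<Longrightarrow> B x v w = B x w v"
  using pos[of x] unfolding positive_definite_def bform_def
  by (metis dot_lmul_matrix inner_commute transpose_matrix_vector)

lemma g_sym: "x \<in> S \<Longrightarrow> g x $ i $ j = g x $ j $ i"
  using B_sym[of x "axis i 1" "axis j 1"] by (simp add: bform_axis)

lemma B_pos: "x \<in> S \<Longrightarrow> v \<noteq> 0 \<Longrightarrow> 0 < B x v v"
  using pos[of x] unfolding positive_definite_def bform_def by blast

lemma inv_g: "x \<in> S \<Longrightarrow> invertible (g x)"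
  by (rule positive_definite_invertible[OF pos])

lemma smooth_B: "smooth_on S (\<lambda>y. B y v w)"
  unfolding bform_def inner_vec_def matrix_vector_mult_def
  by (simp, intro smooth_on_sum smooth_on_mult smooth_on_const smooth_on_nth smooth_g)

lemma smooth_inv: "smooth_on S (\<lambda>y. matrix_inv (g y))"
  by (rule smooth_on_matrix_inv[OF smooth_g inv_g])

lemma smooth_christoffel: "smooth_on S (christoffel S g l i j)"
proof -
  have "smooth_on S (pd S i (\<lambda>y. g y $ j $ m))" for i j m
    unfolding pd_dd[abs_def] by (intro smooth_on_dd[OF hopen] smooth_on_nth smooth_g)
  then show ?thesis unfolding christoffel_def[abs_def]
    by (intro smooth_on_sum smooth_on_mult smooth_on_const smooth_on_nth smooth_inv smooth_on_diff smooth_on_add)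
qed

lemma smooth_Gam: "smooth_on S (\<lambda>y. \<Gamma> y v w)"
  by (rule smooth_on_vec, simp add: Gam_def, intro smooth_on_sum smooth_on_mult smooth_on_const smooth_christoffel)

lemma levi_civita:
  assumes x: "x \<in> S"
  shows "(\<forall>l i j. (\<Lambda> :: 'n \<Rightarrow> 'n \<Rightarrow> 'n \<Rightarrow> real) l i j = christoffel S g l i j x) \<longleftrightarrow>
    (\<forall>l i j. \<Lambda> l i j = \<Lambda> l j i) \<and>
    (\<forall>m i j. pd S m (\<lambda>y. g y $ i $ j) x = (\<Sum>l\<in>UNIV. \<Lambda> l m i * g x $ l $ j + \<Lambda> l m j * g x $ i $ l))"
  by (rule christoffel_iff_torsion_free_metric[OF pos x])

lemma Gam_sym:
  assumes "x \<in> S" shows "\<Gamma> x v w = \<Gamma> x w v"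
proof -
  have "christoffel S g l i j x = christoffel S g l j i x" for l i j
    using levi_civita[OF assms, of "\<lambda>l i j. christoffel S g l i j x"] by blast
  then have "\<Gamma> x (axis i 1) (axis j 1) = \<Gamma> x (axis j 1) (axis i 1)" for i j
    by (simp add: Gam_axis)
  then have "\<Gamma> x (axis i 1) w = \<Gamma> x w (axis i 1)" for i w
    by (rule linear_eq_axis[where f="\<Gamma> x (axis i 1)" and g="\<lambda>w. \<Gamma> x w (axis i 1)", OF linear_Gam2 linear_Gam1])
  then show ?thesis
    by (rule linear_eq_axis[where f="\<lambda>v. \<Gamma> x v w" and g="\<Gamma> x w", OF linear_Gam1 linear_Gam2])
qed

lemma bform_axis_left: "B x u (axis j 1) = (\<Sum>l\<in>UNIV. u $ l * g x $ l $ j)"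
  by (simp add: bform_def inner_vec_def matrix_vector_mult_basis column_def)

lemma bform_axis_right: "B x (axis i 1) u = (\<Sum>l\<in>UNIV. u $ l * g x $ i $ l)"
  by (simp add: bform_def inner_axis' matrix_vector_mult_def mult.commute)

lemma linear_dd_B:
  assumes x: "x \<in> S"
  shows "linear (\<lambda>z. dd S (\<lambda>y. B y v w) z x)" "linear (\<lambda>v. dd S (\<lambda>y. B y v w) z x)" "linear (\<lambda>w. dd S (\<lambda>y. B y v w) z x)"
  by (rule linear_dd[OF hopen smooth_B x],
      rule linear_dd_family[OF hopen x linear_bform1 smooth_B],
      rule linear_dd_family[OF hopen x linear_bform2 smooth_B])

text \<open>Both sides are linear in each of \<open>z\<close>, \<open>v\<close> and
  \<open>w\<close>, so the identity spreads from coordinate vectors one argument at a time.\<close>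

lemma compatI:
  assumes x: "x \<in> S" and lin: "\<And>w. linear (\<lambda>v. G v w)" "\<And>v. linear (G v)"
    and basis: "\<And>m i j. dd S (\<lambda>y. B y (axis i 1) (axis j 1)) (axis m 1) x
     = B x (G (axis m 1) (axis i 1)) (axis j 1) + B x (axis i 1) (G (axis m 1) (axis j 1))"
  shows "dd S (\<lambda>y. B y v w) z x = B x (G z v) w + B x v (G z w)"
proof -
  have l1: "linear (\<lambda>z. B x (G z v) w + B x v (G z w))" for v w
    by (intro linear_compose_add linear_compose[OF lin(1) linear_bform1, unfolded o_def] linear_compose[OF lin(1) linear_bform2, unfolded o_def])
  have l2: "linear (\<lambda>v. B x (G z v) w + B x v (G z w))" for z w
    by (intro linear_compose_add linear_compose[OF lin(2) linear_bform1, unfolded o_def] linear_bform1)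
  have l3: "linear (\<lambda>w. B x (G z v) w + B x v (G z w))" for z v
    by (intro linear_compose_add linear_compose[OF lin(2) linear_bform2, unfolded o_def] linear_bform2)
  have "dd S (\<lambda>y. B y (axis i 1) (axis j 1)) z x = B x (G z (axis i 1)) (axis j 1) + B x (axis i 1) (G z (axis j 1))" for i j
    by (rule linear_eq_axis[where f="\<lambda>z. dd S (\<lambda>y. B y (axis i 1) (axis j 1)) z x", OF linear_dd_B(1)[OF x] l1]) (rule basis)
  then have "dd S (\<lambda>y. B y v (axis j 1)) z x = B x (G z v) (axis j 1) + B x v (G z (axis j 1))" for j
    by (rule linear_eq_axis[where f="\<lambda>v. dd S (\<lambda>y. B y v (axis j 1)) z x", OF linear_dd_B(2)[OF x] l2])
  then show ?thesis
    by (rule linear_eq_axis[where f="\<lambda>w. dd S (\<lambda>y. B y v w) z x", OF linear_dd_B(3)[OF x] l3])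
qed

lemma compat:
  assumes x: "x \<in> S"
  shows "dd S (\<lambda>y. B y v w) z x = B x (\<Gamma> x z v) w + B x v (\<Gamma> x z w)"
proof -
  have "\<forall>m i j. pd S m (\<lambda>y. g y $ i $ j) x = (\<Sum>l\<in>UNIV. christoffel S g l m i x * g x $ l $ j + christoffel S g l m j x * g x $ i $ l)"
    using levi_civita[OF x, of "\<lambda>l i j. christoffel S g l i j x"] by blast
  then have "dd S (\<lambda>y. B y (axis i 1) (axis j 1)) (axis m 1) x
     = B x (\<Gamma> x (axis m 1) (axis i 1)) (axis j 1) + B x (axis i 1) (\<Gamma> x (axis m 1) (axis j 1))" for m i j
    by (simp add: bform_axis pd_dd[symmetric] bform_axis_left bform_axis_right Gam_axis sum.distrib)
  from compatI[OF x linear_Gam1 linear_Gam2 this] show ?thesis by blast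
qed

text \<open>Uniqueness of the torsion-free metric connection in vector form. It is the tool for
  computing connections: a bilinear candidate that is symmetric and compatible with the metric has
  to be \<open>\<Gamma>\<close>. Both the coordinate change and the conformal change rest on
  it.\<close>

lemma Gam_unique:
  assumes x: "x \<in> S" and lin: "\<And>w. linear (\<lambda>v. G v w)" "\<And>v. linear (G v)"
    and sym: "\<And>v w. G v w = G w v"
    and comp: "\<And>z v w. dd S (\<lambda>y. B y v w) z x = B x (G z v) w + B x v (G z w)"
  shows "\<Gamma> x v w = G v w"
proof -
  have "pd S m (\<lambda>y. g y $ i $ j) x = (\<Sum>l\<in>UNIV. G (axis m 1) (axis i 1) $ l * g x $ l $ j + G (axis m 1) (axis j 1) $ l * g x $ i $ l)" for m i j
    using comp[of "axis i 1" "axis j 1" "axis m 1"]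
    by (simp add: bform_axis pd_dd[symmetric] bform_axis_left bform_axis_right sum.distrib)
  moreover have "G (axis i 1) (axis j 1) $ l = G (axis j 1) (axis i 1) $ l" for i j l
    using sym by simp
  ultimately have "\<forall>l i j. G (axis i 1) (axis j 1) $ l = christoffel S g l i j x"
    using levi_civita[OF x, of "\<lambda>l i j. G (axis i 1) (axis j 1) $ l"] by blast
  then have "\<Gamma> x (axis i 1) (axis j 1) = G (axis i 1) (axis j 1)" for i j
    by (simp add: Gam_axis vec_eq_iff)
  then have "\<Gamma> x (axis i 1) w = G (axis i 1) w" for i w
    by (rule linear_eq_axis[where f="\<Gamma> x (axis i 1)" and g="G (axis i 1)", OF linear_Gam2 lin(2)])
  then show ?thesis
    by (rule linear_eq_axis[where f="\<lambda>v. \<Gamma> x v w" and g="\<lambda>v. G v w", OF linear_Gam1 lin(1)])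
qed

section \<open>Curvature as a multilinear map and the Ricci tensor as its trace\<close>

abbreviation "DGam x z v w \<equiv> dd S (\<lambda>y. \<Gamma> y v w) z x"

lemma linear_DGam:
  assumes x: "x \<in> S"
  shows "linear (\<lambda>z. DGam x z v w)" "linear (\<lambda>v. DGam x z v w)" "linear (\<lambda>w. DGam x z v w)"
  by (rule linear_dd[OF hopen smooth_Gam x],
      rule linear_dd_family[OF hopen x linear_Gam1 smooth_Gam],
      rule linear_dd_family[OF hopen x linear_Gam2 smooth_Gam])

lemma linear_Rm:
  assumes x: "x \<in> S"
  shows "linear (\<lambda>z. Rm S g x z v w)" "linear (\<lambda>v. Rm S g x z v w)" "linear (\<lambda>w. Rm S g x z v w)"
  unfolding Rm_def
  by (intro linear_compose_add linear_compose_sub linear_DGam[OF x] linear_Gam1 linear_Gam2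
      linear_compose[OF linear_Gam1 linear_Gam2, unfolded o_def] linear_compose[OF linear_Gam2 linear_Gam2, unfolded o_def])+

lemma ricci_Rm:
  assumes x: "x \<in> S"
  shows "ricci S g x $ j $ m = (\<Sum>i\<in>UNIV. Rm S g x (axis i 1) (axis j 1) (axis m 1) $ i)"
proof -
  have D: "dd S (\<lambda>y. \<Gamma> y (axis j 1) (axis m 1)) (axis i 1) x $ l = pd S i (christoffel S g l j m) x" for i j m l
  proof -
    have "(\<lambda>y. \<Gamma> y (axis j 1) (axis m 1) $ l) = christoffel S g l j m"
      by (simp add: fun_eq_iff Gam_axis)
    then show ?thesis
      using dd_linear_comp[OF bounded_linear_vec_nth[of l] hopen smooth_Gam x, of "axis j 1" "axis m 1" "axis i 1"]
      by (simp add: pd_dd)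
  qed
  have Q: "\<Gamma> x (axis i 1) (\<Gamma> x (axis j 1) (axis m 1)) $ l = (\<Sum>p\<in>UNIV. christoffel S g l i p x * christoffel S g p j m x)" for i j m l
    by (subst Gam_axis2) (simp add: Gam_axis)
  have "Rm S g x (axis i 1) (axis j 1) (axis m 1) $ i = riemann S g i m i j x" for i
    by (simp add: Rm_def riemann_def D Q sum_subtractf)
  then show ?thesis by (simp add: ricci_def)
qed

text \<open>Multilinearity of \<open>Rm\<close> extends the component formula to arbitrary vectors
  and exhibits Ricci as the trace over the first slot, a form that is stable under linear
  isomorphisms.\<close>

lemma ricci_form:
  assumes x: "x \<in> S"
  shows "v \<bullet> (ricci S g x *v w) = (\<Sum>i\<in>UNIV. Rm S g x (axis i 1) v w $ i)"
proof -
  have l: "linear (\<lambda>v. \<Sum>i\<in>UNIV. Rm S g x (axis i 1) v w $ i)" "linear (\<lambda>w. \<Sum>i\<in>UNIV. Rm S g x (axis i 1) v w $ i)" for v w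
    using linear_compose[OF linear_Rm(2)[OF x] bounded_linear.linear[OF bounded_linear_vec_nth], unfolded o_def]
      linear_compose[OF linear_Rm(3)[OF x] bounded_linear.linear[OF bounded_linear_vec_nth], unfolded o_def]
    by (auto intro: linear_compose_sum)
  have "axis j 1 \<bullet> (ricci S g x *v axis k 1) = (\<Sum>i\<in>UNIV. Rm S g x (axis i 1) (axis j 1) (axis k 1) $ i)" for j k
    by (simp add: inner_axis' matrix_vector_mult_basis column_def ricci_Rm[OF x])
  then have "axis j 1 \<bullet> (ricci S g x *v w) = (\<Sum>i\<in>UNIV. Rm S g x (axis i 1) (axis j 1) w $ i)" for j w
    by (rule linear_eq_axis[where f="\<lambda>w. axis j 1 \<bullet> (ricci S g x *v w)", OF linear_bform2[of "\<lambda>x. ricci S g x", unfolded bform_def] l(2)])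
  then show ?thesis
    by (rule linear_eq_axis[where f="\<lambda>v. v \<bullet> (ricci S g x *v w)", OF linear_bform1[of "\<lambda>x. ricci S g x", unfolded bform_def] l(1)])
qed

end

section \<open>Symmetry of the Ricci tensor\<close>

lemma bounded_bilinear_matrix_mult: "bounded_bilinear ((**) :: real^'n^'m \<Rightarrow> real^'p^'n \<Rightarrow> real^'p^'m)"
  unfolding bilinear_conv_bounded_bilinear[symmetric] bilinear_def
  by (auto intro!: linearI simp: matrix_matrix_mult_def vec_eq_iff algebra_simps sum.distrib sum_distrib_left)

lemma trace_matrix: "trace (matrix f) = (\<Sum>i\<in>UNIV. f (axis i 1) $ i)"
  by (simp add: trace_def matrix_def)

text \<open>Lowering and then raising the index gives back the vector. This evaluates all later
  contractions with the inverse metric.\<close>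

lemma (in metric_patch) matrix_inv_form:
  assumes x: "x \<in> S"
  shows "(\<Sum>j\<in>UNIV. matrix_inv (g x) $ i $ j * B x (axis j 1) v) = v $ i"
proof -
  have "(matrix_inv (g x) *v (g x *v v)) $ i = v $ i"
    by (simp add: matrix_vector_mul_assoc matrix_inv_works[OF inv_g[OF x]])
  then show ?thesis
    by (simp add: matrix_vector_mult_def[of "matrix_inv (g x)"] bform_def inner_axis')
qed

context metric_patch
begin

text \<open>By metric compatibility the trace of
  \<open>g\<^sup>-\<^sup>1 \<partial>\<^sub>w g\<close> splits into two sums, each of which is the
  trace of \<open>\<Gamma> x w\<close>. The right-hand side is the derivative of the logarithm of
  the volume density.\<close>

lemma trace_Gam:
  assumes x: "x \<in> S"
  shows "(\<Sum>i\<in>UNIV. \<Gamma> x (axis i 1) w $ i) = 1/2 * trace (matrix_inv (g x) ** dd S g w x)"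
proof -
  have entry: "dd S g w x $ m $ i = B x (\<Gamma> x w (axis m 1)) (axis i 1) + B x (axis m 1) (\<Gamma> x w (axis i 1))" for m i
  proof -
    have "dd S g w x $ m $ i = dd S (\<lambda>y. g y $ m $ i) w x"
      using dd_linear_comp[OF bounded_linear_vec_nth[of m] hopen smooth_g x, of w]
        dd_linear_comp[OF bounded_linear_vec_nth[of i] hopen smooth_on_nth[OF smooth_g, of m] x, of w] by simp
    then show ?thesis using compat[OF x, of "axis m 1" "axis i 1" w] by (simp add: bform_axis)
  qed
  have isym: "matrix_inv (g x) $ i $ m = matrix_inv (g x) $ m $ i" for i m
  proof -
    have "g x ** transpose (matrix_inv (g x)) = mat 1"
      using matrix_inv_works(2)[OF inv_g[OF x]] pos[OF x] unfolding positive_definite_def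
      by (metis matrix_transpose_mul transpose_mat)
    from matrix_inv_unique[OF this] have "transpose (matrix_inv (g x)) $ m $ i = matrix_inv (g x) $ m $ i" by simp
    then show ?thesis by (simp add: transpose_def)
  qed
  have "trace (matrix_inv (g x) ** dd S g w x) = (\<Sum>i\<in>UNIV. \<Sum>m\<in>UNIV. matrix_inv (g x) $ i $ m * dd S g w x $ m $ i)"
    by (simp add: trace_def matrix_matrix_mult_def)
  also have "\<dots> = (\<Sum>i\<in>UNIV. \<Sum>m\<in>UNIV. matrix_inv (g x) $ i $ m * B x (\<Gamma> x w (axis m 1)) (axis i 1))
      + (\<Sum>i\<in>UNIV. \<Sum>m\<in>UNIV. matrix_inv (g x) $ i $ m * B x (axis m 1) (\<Gamma> x w (axis i 1)))"
    by (simp add: entry distrib_left sum.distrib)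
  also have "(\<Sum>i\<in>UNIV. \<Sum>m\<in>UNIV. matrix_inv (g x) $ i $ m * B x (\<Gamma> x w (axis m 1)) (axis i 1))
      = (\<Sum>m\<in>UNIV. \<Sum>i\<in>UNIV. matrix_inv (g x) $ m $ i * B x (axis i 1) (\<Gamma> x w (axis m 1)))"
    by (subst sum.swap) (simp add: isym[of _ "_"] B_sym[OF x, of "axis _ 1"] isym)
  finally show ?thesis
    using Gam_sym[OF x, of w] by (simp add: matrix_inv_form[OF x])
qed

text \<open>Differentiate the constant product of \<open>g\<close> and its inverse, then multiply by
  the inverse from the left.\<close>

lemma dd_matrix_inv:
  assumes x: "x \<in> S"
  shows "dd S (\<lambda>y. matrix_inv (g y)) v x = - (matrix_inv (g x) ** dd S g v x ** matrix_inv (g x))"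
proof -
  let ?i = "\<lambda>y. matrix_inv (g y)"
  have "((\<lambda>y. g y ** ?i y) has_derivative (\<lambda>v. g x ** dd S ?i v x + dd S g v x ** ?i x)) (at x within S)"
    by (rule bounded_bilinear.FDERIV[OF bounded_bilinear_matrix_mult has_derivative_dd[OF hopen smooth_g x] has_derivative_dd[OF hopen smooth_inv x]])
  from dd_eqI[OF this hopen x] have "dd S (\<lambda>y. g y ** ?i y) v x = g x ** dd S ?i v x + dd S g v x ** ?i x" .
  moreover have "dd S (\<lambda>y. g y ** ?i y) v x = dd S (\<lambda>y. mat 1) v x"
    by (rule dd_cong[OF x]) (simp add: matrix_inv_works(1) inv_g)
  moreover have "dd S (\<lambda>y. mat 1 :: real^'n^'n) v x = 0"
    by (rule dd_eqI[OF has_derivative_const hopen x])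
  ultimately have "g x ** dd S ?i v x = - (dd S g v x ** ?i x)" by (simp add: eq_neg_iff_add_eq_0)
  then have "?i x ** (g x ** dd S ?i v x) = ?i x ** (- (dd S g v x ** ?i x))" by simp
  moreover have "?i x ** (g x ** dd S ?i v x) = dd S ?i v x"
    by (simp add: matrix_mul_assoc matrix_inv_works(2)[OF inv_g[OF x]])
  moreover have "?i x ** (- (dd S g v x ** ?i x)) = - (?i x ** dd S g v x ** ?i x)"
    using bounded_bilinear.minus_right[OF bounded_bilinear_matrix_mult] by (metis matrix_mul_assoc)
  ultimately show ?thesis by simp
qed

text \<open>The only term of the Ricci tensor that is not visibly symmetric is the derivative of the trace
  of \<open>\<Gamma>\<close>, and that trace is half the trace of \<open>g\<^sup>-\<^sup>1 \<partial>g\<close>.\<close>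

lemma ricci_trace_symmetric:
  assumes x: "x \<in> S"
  shows "(\<Sum>i\<in>UNIV. Rm S g x (axis i 1) v w $ i) = (\<Sum>i\<in>UNIV. Rm S g x (axis i 1) w v $ i)"
proof -
  let ?i = "\<lambda>y. matrix_inv (g y)"
  have D: "DGam x z v w = DGam x z w v" for z v w
    by (rule dd_cong[OF x]) (rule Gam_sym)
  \<comment> \<open>This is a second derivative of the log volume density: one term is symmetric
    since partial derivatives commute, the other since the trace is cyclic.\<close>
  have div: "(\<Sum>i\<in>UNIV. DGam x v (axis i 1) w $ i) = (\<Sum>i\<in>UNIV. DGam x w (axis i 1) v $ i)" for v w
  proof -
    have "(\<Sum>i\<in>UNIV. DGam x v (axis i 1) w $ i) = 1/2 * trace (?i x ** dd S (dd S g w) v x)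
        - 1/2 * trace ((?i x ** dd S g v x) ** (?i x ** dd S g w x))" for v w
    proof -
      have "((\<lambda>y. \<Sum>i\<in>UNIV. \<Gamma> y (axis i 1) w $ i) has_derivative (\<lambda>v. \<Sum>i\<in>UNIV. DGam x v (axis i 1) w $ i)) (at x within S)"
        by (intro has_derivative_sum bounded_linear.has_derivative[OF bounded_linear_vec_nth] has_derivative_dd[OF hopen smooth_Gam x])
      from dd_eqI[OF this hopen x]
      have "(\<Sum>i\<in>UNIV. DGam x v (axis i 1) w $ i) = dd S (\<lambda>y. \<Sum>i\<in>UNIV. \<Gamma> y (axis i 1) w $ i) v x" by simp
      also have "\<dots> = dd S (\<lambda>y. 1/2 * trace (?i y ** dd S g w y)) v x"
        by (rule dd_cong[OF x]) (rule trace_Gam)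
      also have "\<dots> = 1/2 * trace (?i x ** dd S (dd S g w) v x + dd S ?i v x ** dd S g w x)"
      proof (rule dd_eqI[OF _ hopen x])
        have tr: "bounded_linear (trace :: real^'n^'n \<Rightarrow> real)"
          unfolding linear_conv_bounded_linear[symmetric]
          by (rule linearI) (auto simp: trace_def sum.distrib sum_distrib_left)
        show "((\<lambda>y. 1/2 * trace (?i y ** dd S g w y)) has_derivative
          (\<lambda>v. 1/2 * trace (?i x ** dd S (dd S g w) v x + dd S ?i v x ** dd S g w x))) (at x within S)"
          by (intro bounded_linear.has_derivative[OF bounded_linear_mult_right] bounded_linear.has_derivative[OF tr]
              bounded_bilinear.FDERIV[OF bounded_bilinear_matrix_mult] has_derivative_dd[OF hopen _ x] smooth_inv smooth_on_dd[OF hopen smooth_g])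
      qed
      also have "\<dots> = 1/2 * trace (?i x ** dd S (dd S g w) v x) - 1/2 * trace ((?i x ** dd S g v x) ** (?i x ** dd S g w x))"
      proof -
        have "- (?i x ** dd S g v x ** ?i x) ** dd S g w x = - ((?i x ** dd S g v x) ** (?i x ** dd S g w x))"
          using bounded_bilinear.minus_left[OF bounded_bilinear_matrix_mult] by (metis matrix_mul_assoc)
        then show ?thesis
          by (simp add: dd_matrix_inv[OF x] trace_add) (simp add: trace_def sum_negf sum_subtractf)
      qed
      finally show ?thesis .
    qed
    then show ?thesis
      using dd_commute[OF hopen smooth_g x, of w v] trace_mul_sym[of "?i x ** dd S g v x" "?i x ** dd S g w x"] by simp
  qed
  \<comment> \<open>The part of Ricci that is quadratic in \<open>\<Gamma>\<close> is the trace of a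
    product of two endomorphisms, hence symmetric in \<open>v\<close> and \<open>w\<close>.\<close>
  have "trace (matrix (\<Gamma> x v) ** matrix (\<Gamma> x w)) = trace (matrix (\<Gamma> x w) ** matrix (\<Gamma> x v))"
    by (rule trace_mul_sym)
  then have "trace (matrix (\<Gamma> x v \<circ> \<Gamma> x w)) = trace (matrix (\<Gamma> x w \<circ> \<Gamma> x v))"
    by (simp add: matrix_compose linear_Gam2)
  then have quad: "(\<Sum>i\<in>UNIV. \<Gamma> x v (\<Gamma> x (axis i 1) w) $ i) = (\<Sum>i\<in>UNIV. \<Gamma> x w (\<Gamma> x (axis i 1) v) $ i)"
    by (simp add: trace_matrix Gam_sym[OF x, of "axis _ 1"])
  show ?thesis
    using div[of v w] quad D[where v=v and w=w] Gam_sym[OF x, of v w]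
    by (simp add: Rm_def sum.distrib sum_subtractf)
qed

lemma ricci_symmetric:
  assumes x: "x \<in> S" shows "transpose (ricci S g x) = ricci S g x"
  using ricci_trace_symmetric[OF x] by (simp add: transpose_def vec_eq_iff ricci_Rm[OF x])

end

subsection \<open>Change of coordinates\<close>

locale isometric_patches = p1: metric_patch k S1 g1 + p2: metric_patch k S2 g2
  for k :: "'n::finite" and S1 g1 S2 g2 +
  fixes y :: "real^'n \<Rightarrow> real^'n"
  assumes smooth_y: "smooth_on S1 y" and maps: "y ` S1 \<subseteq> S2"
    and iso: "\<And>x v w. x \<in> S1 \<Longrightarrow> bform g1 x v w = bform g2 (y x) (dd S1 y v x) (dd S1 y w x)"
begin

abbreviation "J x v \<equiv> dd S1 y v x"
abbreviation "H x z v \<equiv> dd S1 (dd S1 y v) z x"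

lemma linear_J: "x \<in> S1 \<Longrightarrow> linear (J x)"
  by (rule linear_dd[OF p1.hopen smooth_y])

text \<open>A vector killed by the differential has length zero for the pulled-back metric. In equal
  dimensions injectivity makes the differential an isomorphism.\<close>

lemma inj_J:
  assumes x: "x \<in> S1" shows "inj (J x)"
proof (rule linear_injective_0[OF linear_J[OF x], THEN iffD2], intro allI impI)
  fix v assume "J x v = 0"
  then have "bform g1 x v v = 0" using iso[OF x, of v v] by (simp add: bform_def)
  then show "v = 0" using p1.B_pos[OF x, of v] by fastforce
qed

lemma linear_H: "x \<in> S1 \<Longrightarrow> linear (\<lambda>z. H x z v)" "x \<in> S1 \<Longrightarrow> linear (H x z)"
  by (rule linear_dd[OF p1.hopen smooth_on_dd[OF p1.hopen smooth_y]], assumption)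
    (rule linear_dd_family[OF p1.hopen _ linear_J smooth_on_dd[OF p1.hopen smooth_y]])

lemma has_derivative_J: "x \<in> S1 \<Longrightarrow> (dd S1 y v has_derivative (\<lambda>z. H x z v)) (at x within S1)"
  by (rule has_derivative_dd[OF p1.hopen smooth_on_dd[OF p1.hopen smooth_y]])

lemma has_derivative_comp_y:
  assumes "smooth_on S2 f" "x \<in> S1"
  shows "((\<lambda>q. f (y q)) has_derivative (\<lambda>z. dd S2 f (J x z) (y x))) (at x within S1)"
proof (rule has_derivative_in_compose[OF has_derivative_dd[OF p1.hopen smooth_y assms(2)]])
  show "(f has_derivative (\<lambda>v. dd S2 f v (y x))) (at (y x) within y ` S1)"
    using has_derivative_dd[OF p2.hopen assms(1)] maps assms(2) by (blast intro: has_derivative_subset)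
qed

text \<open>The inhomogeneous law with the second derivative \<open>H\<close> of the coordinate
  change. Pulling the target connection back gives a symmetric metric connection, so uniqueness
  identifies it.\<close>

lemma Gam_law:
  assumes x: "x \<in> S1"
  shows "J x (Gam S1 g1 x v w) = H x v w + Gam S2 g2 (y x) (J x v) (J x w)"
proof -
  have yx: "y x \<in> S2" using maps x by auto
  obtain K where K: "linear K" "\<And>v. K (J x v) = v" "\<And>v. J x (K v) = v"
    using linear_injective_isomorphism[OF linear_J[OF x] inj_J[OF x]] by blast
  \<comment> \<open>The law solved for the source connection; \<open>K\<close> is the inverse of the
    differential.\<close>
  define G where "G v w = K (H x v w + Gam S2 g2 (y x) (J x v) (J x w))" for v w
  have JG: "J x (G v w) = H x v w + Gam S2 g2 (y x) (J x v) (J x w)" for v w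
    by (simp add: G_def K)
  have "Gam S1 g1 x v w = G v w" for v w
  proof (rule p1.Gam_unique[OF x])
    show "linear (\<lambda>v. G v w)" for w unfolding G_def
      by (rule linear_compose[OF _ K(1), unfolded o_def])
        (intro linear_compose_add linear_H[OF x] linear_compose[OF linear_J[OF x] linear_Gam1, unfolded o_def])
    show "linear (G v)" for v unfolding G_def
      by (rule linear_compose[OF _ K(1), unfolded o_def])
        (intro linear_compose_add linear_H[OF x] linear_compose[OF linear_J[OF x] linear_Gam2, unfolded o_def])
    show "G v w = G w v" for v w
      using dd_commute[OF p1.hopen smooth_y x, of v w] p2.Gam_sym[OF yx, of "J x v"] by (simp add: G_def)
    fix z v w
    have "((\<lambda>q. bform g2 (y q) (J q v) (J q w)) has_derivative
      (\<lambda>z. dd S2 (\<lambda>q. bform g2 q (J x v) (J x w)) (J x z) (y x) + bform g2 (y x) (H x z v) (J x w) + bform g2 (y x) (J x v) (H x z w))) (at x within S1)"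
      by (rule has_derivative_bilinear_family[where F="\<lambda>q. bform g2 (y q)" and F'="\<lambda>a b z. dd S2 (\<lambda>q. bform g2 q a b) (J x z) (y x)"])
        (auto intro: linear_bform1 linear_bform2 p2.linear_dd_B[OF yx] has_derivative_comp_y[OF p2.smooth_B x] has_derivative_J x)
    note dd_eqI[OF this p1.hopen x]
    moreover have "dd S1 (\<lambda>q. bform g1 q v w) z x = dd S1 (\<lambda>q. bform g2 (y q) (J q v) (J q w)) z x"
      by (rule dd_cong[OF x]) (rule iso)
    ultimately show "dd S1 (\<lambda>q. bform g1 q v w) z x = bform g1 x (G z v) w + bform g1 x v (G z w)"
      by (simp add: p2.compat[OF yx] iso[OF x] JG linear_add[OF linear_bform1] linear_add[OF linear_bform2])
  qed
  then show ?thesis by (simp add: JG)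
qed

text \<open>\<open>Gam_law\<close> is differentiated once more and antisymmetrized in
  \<open>z\<close> and \<open>v\<close>. The terms with \<open>H\<close> cancel against those
  produced by the quadratic part of the curvature.\<close>

lemma Rm_law:
  assumes x: "x \<in> S1"
  shows "J x (Rm S1 g1 x z v w) = Rm S2 g2 (y x) (J x z) (J x v) (J x w)"
proof -
  have yx: "y x \<in> S2" using maps x by auto
  let ?G1 = "Gam S1 g1 x" and ?G2 = "Gam S2 g2 (y x)"
  have der: "H x z (?G1 v w) + J x (dd S1 (\<lambda>q. Gam S1 g1 q v w) z x) =
    dd S1 (dd S1 (dd S1 y w) v) z x + (dd S2 (\<lambda>q. Gam S2 g2 q (J x v) (J x w)) (J x z) (y x)
      + ?G2 (H x z v) (J x w) + ?G2 (J x v) (H x z w))" for z v w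
  proof -
    have "((\<lambda>q. J q (Gam S1 g1 q v w)) has_derivative (\<lambda>z. H x z (?G1 v w) + J x (dd S1 (\<lambda>q. Gam S1 g1 q v w) z x))) (at x within S1)"
      by (rule has_derivative_linear_family[where F'="\<lambda>a z. H x z a"])
        (auto intro: linear_J linear_H[OF x] has_derivative_J x has_derivative_dd[OF p1.hopen p1.smooth_Gam])
    note L = dd_eqI[OF this p1.hopen x, of z]
    have "((\<lambda>q. Gam S2 g2 (y q) (J q v) (J q w)) has_derivative
      (\<lambda>z. dd S2 (\<lambda>q. Gam S2 g2 q (J x v) (J x w)) (J x z) (y x) + ?G2 (H x z v) (J x w) + ?G2 (J x v) (H x z w))) (at x within S1)"
      by (rule has_derivative_bilinear_family[where F="\<lambda>q. Gam S2 g2 (y q)" and F'="\<lambda>a b z. dd S2 (\<lambda>q. Gam S2 g2 q a b) (J x z) (y x)"])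
        (auto intro: linear_Gam1 linear_Gam2 p2.linear_DGam[OF yx] has_derivative_comp_y[OF p2.smooth_Gam x] has_derivative_J x)
    note R = dd_eqI[OF has_derivative_add[OF has_derivative_dd[OF p1.hopen smooth_on_dd[OF p1.hopen smooth_on_dd[OF p1.hopen smooth_y]] x, of w v] this] p1.hopen x, of z]
    have "dd S1 (\<lambda>q. J q (Gam S1 g1 q v w)) z x = dd S1 (\<lambda>q. H q v w + Gam S2 g2 (y q) (J q v) (J q w)) z x"
      by (rule dd_cong[OF x]) (rule Gam_law)
    then show ?thesis unfolding L R .
  qed
  \<comment> \<open>Third derivatives of the coordinate change are symmetric in \<open>z\<close> and
    \<open>v\<close> and therefore drop out of the antisymmetrization.\<close>
  have sym3: "dd S1 (dd S1 (dd S1 y w) v) z x = dd S1 (dd S1 (dd S1 y w) z) v x"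
    by (rule dd_commute[OF p1.hopen smooth_on_dd[OF p1.hopen smooth_y] x])
  have Hs: "H x z v = H x v z" for z v
    by (rule dd_commute[OF p1.hopen smooth_y x])
  have der': "J x (dd S1 (\<lambda>q. Gam S1 g1 q v w) z x) =
    dd S1 (dd S1 (dd S1 y w) v) z x + (dd S2 (\<lambda>q. Gam S2 g2 q (J x v) (J x w)) (J x z) (y x)
      + ?G2 (H x z v) (J x w) + ?G2 (J x v) (H x z w)) - H x z (?G1 v w)" for z v w
    using der[where z=z and v=v and w=w] by (simp add: eq_diff_eq add.commute)
  show ?thesis
    unfolding Rm_def linear_add[OF linear_J[OF x]] linear_diff[OF linear_J[OF x]] der' Gam_law[OF x] linear_add[OF linear_Gam2]
    by (simp add: sym3 Hs[of z v] algebra_simps)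
qed

text \<open>By \<open>Rm_law\<close> the two endomorphisms whose traces are Ricci are conjugate
  under the differential, so their traces agree.\<close>

lemma ricci_law:
  assumes x: "x \<in> S1"
  shows "v \<bullet> (ricci S1 g1 x *v w) = J x v \<bullet> (ricci S2 g2 (y x) *v J x w)"
proof -
  have yx: "y x \<in> S2" using maps x by auto
  let ?L1 = "\<lambda>z. Rm S1 g1 x z v w" and ?L2 = "\<lambda>z. Rm S2 g2 (y x) z (J x v) (J x w)"
  have "J x \<circ> ?L1 = ?L2 \<circ> J x" by (simp add: fun_eq_iff Rm_law[OF x])
  then have eq: "matrix (J x) ** matrix ?L1 = matrix ?L2 ** matrix (J x)"
    using matrix_compose[OF p1.linear_Rm(1)[OF x] linear_J[OF x]] matrix_compose[OF linear_J[OF x] p2.linear_Rm(1)[OF yx]]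
    by metis
  obtain K where K: "K ** matrix (J x) = mat 1"
    using inj_J[OF x] linear_J[OF x] matrix_left_invertible_injective[of "matrix (J x)"] by auto
  have "trace (matrix ?L1) = trace (K ** (matrix (J x) ** matrix ?L1))"
    by (simp add: matrix_mul_assoc K)
  also have "\<dots> = trace ((matrix ?L2 ** matrix (J x)) ** K)"
    by (simp add: eq trace_mul_sym[of K])
  also have "\<dots> = trace (matrix ?L2)"
    using matrix_left_right_inverse[of K "matrix (J x)"] K by (simp add: matrix_mul_assoc[symmetric])
  finally show ?thesis
    by (simp add: trace_matrix p1.ricci_form[OF x] p2.ricci_form[OF yx])
qed

end

subsection \<open>Conformal change of the metric\<close>

lemma linear_axis_sum_real:
  fixes f :: "real^'n \<Rightarrow> real"
  assumes "linear f"
  shows "(\<Sum>i\<in>UNIV. f (axis i 1) * v $ i) = f v"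
  using linear_axis_sum[OF assms, of v] by (simp add: mult.commute)

locale conformal_patch = metric_patch k S g
  for k :: "'n::finite" and S g +
  fixes u :: "real^'n \<Rightarrow> real"
  assumes smooth_u: "smooth_on S u"
begin

text \<open>\<open>U\<close> is the gradient of \<open>u\<close> and \<open>nU x z\<close> its covariant derivative along \<open>z\<close>; \<open>D\<close> is the difference of the
  Levi-Civita connections of \<open>e\<^bsup>2u\<^esup> g\<close> and \<open>g\<close>; \<open>nrm\<close> is \<open>|du|\<^sup>2\<close>.\<close>

definition "gu x = exp (2 * u x) *\<^sub>R g x"
definition "U x = matrix_inv (g x) *v (\<chi> i. dd S u (axis i 1) x)"
definition "D x v w = dd S u v x *\<^sub>R w + dd S u w x *\<^sub>R v - B x v w *\<^sub>R U x"
definition "hess x z w = dd S (dd S u w) z x - dd S u (\<Gamma> x z w) x"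
definition "nU x z = dd S U z x + \<Gamma> x z (U x)"
definition "lap x = (\<Sum>i\<in>UNIV. nU x (axis i 1) $ i)"
definition "nrm x = dd S u (U x) x"

abbreviation "du x v \<equiv> dd S u v x"

sublocale u: metric_patch k S gu
proof
  show "smooth_on S gu" unfolding gu_def[abs_def]
    by (intro smooth_on_scaleR smooth_on_exp smooth_on_mult smooth_on_const smooth_u smooth_g)
  show "positive_definite (gu x)" if "x \<in> S" for x
    using pos[OF that] by (simp add: positive_definite_def gu_def transpose_scalar scaleR_matrix_vector_assoc[symmetric])
qed (rule hopen)

lemma B_gu: "bform gu x v w = exp (2 * u x) * B x v w"
  by (simp add: bform_def gu_def scaleR_matrix_vector_assoc[symmetric])

lemma linear_du: "x \<in> S \<Longrightarrow> linear (du x)"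
  by (rule linear_dd[OF hopen smooth_u])

lemma B_U:
  assumes x: "x \<in> S" shows "B x (U x) w = du x w"
proof -
  have "g x *v U x = (\<chi> i. du x (axis i 1))"
    by (simp add: U_def matrix_vector_mul_assoc matrix_inv_works[OF inv_g[OF x]])
  then have "B x w (U x) = (\<Sum>i\<in>UNIV. w $ i * du x (axis i 1))"
    by (simp add: bform_def inner_vec_def)
  then show ?thesis
    using linear_axis_sum_real[OF linear_du[OF x], of w] B_sym[OF x] by (simp add: mult.commute)
qed

lemma smooth_U: "smooth_on S U"
  by (rule smooth_on_vec, simp add: U_def matrix_vector_mult_def,
      intro smooth_on_sum smooth_on_mult smooth_on_nth smooth_inv smooth_on_dd[OF hopen smooth_u])

lemma linear_D1:
  assumes x: "x \<in> S" shows "linear (\<lambda>v. D x v w)"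
  by (rule linearI) (simp_all add: D_def linear_add[OF linear_du[OF x]] linear_cmul[OF linear_du[OF x]]
      linear_add[OF linear_bform1] linear_cmul[OF linear_bform1] algebra_simps)

lemma linear_D2:
  assumes x: "x \<in> S" shows "linear (D x v)"
  by (rule linearI) (simp_all add: D_def linear_add[OF linear_du[OF x]] linear_cmul[OF linear_du[OF x]]
      linear_add[OF linear_bform2] linear_cmul[OF linear_bform2] algebra_simps)

lemma linear_hess:
  assumes x: "x \<in> S" shows "linear (\<lambda>z. hess x z w)" "linear (hess x z)"
  unfolding hess_def
  by (intro linear_compose_sub linear_compose[OF _ linear_du[OF x], unfolded o_def] linear_Gam1 linear_Gam2
      linear_dd[OF hopen smooth_on_dd[OF hopen smooth_u] x]
      linear_dd_family[OF hopen x linear_du smooth_on_dd[OF hopen smooth_u]])+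

text \<open>Differentiating \<open>B x (U x) w = du x w\<close> and removing the derivative of the
  metric by compatibility shows that the covariant derivative of the gradient is metrically dual to
  the Hessian.\<close>

lemma B_nU:
  assumes x: "x \<in> S" shows "B x (nU x z) w = hess x z w"
proof -
  have "((\<lambda>q. B q (U q) w) has_derivative (\<lambda>z. dd S (\<lambda>q. B q (U x) w) z x + B x (dd S U z x) w)) (at x within S)"
    by (rule has_derivative_linear_family[where F="\<lambda>q a. B q a w" and F'="\<lambda>a z. dd S (\<lambda>q. B q a w) z x"])
      (auto intro: linear_bform1 linear_dd_B[OF x] has_derivative_dd[OF hopen smooth_B x] has_derivative_dd[OF hopen smooth_U x] x)
  note dd_eqI[OF this hopen x]
  moreover have "dd S (\<lambda>q. B q (U q) w) z x = dd S (dd S u w) z x"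
    by (rule dd_cong[OF x]) (rule B_U)
  ultimately show ?thesis
    by (simp add: compat[OF x] B_U[OF x] hess_def nU_def linear_add[OF linear_bform1])
qed

text \<open>The tensor \<open>D\<close> is symmetric, and its contribution to compatibility is
  exactly \<open>2 * du x z * B x v w\<close>, the term that comes from differentiating the
  conformal factor. Uniqueness of the connection does the rest.\<close>

lemma Gam_u:
  assumes x: "x \<in> S" shows "Gam S gu x v w = \<Gamma> x v w + D x v w"
proof (rule u.Gam_unique[OF x])
  show "linear (\<lambda>v. \<Gamma> x v w + D x v w)" for w by (intro linear_compose_add linear_Gam1 linear_D1 x)
  show "linear (\<lambda>w. \<Gamma> x v w + D x v w)" for v by (intro linear_compose_add linear_Gam2 linear_D2 x)
  show "\<Gamma> x v w + D x v w = \<Gamma> x w v + D x w v" for v w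
    using Gam_sym[OF x, of v w] B_sym[OF x, of v w] by (simp add: D_def)
  fix z v w
  have "((\<lambda>q. exp (2 * u q) * B q v w) has_derivative
      (\<lambda>z. exp (2 * u x) * dd S (\<lambda>q. B q v w) z x + (exp (2 * u x) * (2 * du x z)) * B x v w)) (at x within S)"
    using has_derivative_mult[OF has_derivative_exp[OF has_derivative_mult_right[OF has_derivative_dd[OF hopen smooth_u x], of 2]] has_derivative_dd[OF hopen smooth_B x, of v w]]
    by (simp add: mult_ac)
  from dd_eqI[OF this hopen x]
  have "dd S (\<lambda>q. bform gu q v w) z x = exp (2 * u x) * (dd S (\<lambda>q. B q v w) z x + 2 * du x z * B x v w)"
    by (simp add: B_gu algebra_simps)
  moreover have "B x (D x z v) w + B x v (D x z w) = 2 * du x z * B x v w"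
    using B_sym[OF x, of v z] B_sym[OF x, of v "U x"] B_sym[OF x, of z w]
    by (simp add: D_def linear_add[OF linear_bform1] linear_add[OF linear_bform2] linear_diff[OF linear_bform1]
        linear_diff[OF linear_bform2] linear_cmul[OF linear_bform1] linear_cmul[OF linear_bform2] B_U[OF x] algebra_simps)
  ultimately have "dd S (\<lambda>q. bform gu q v w) z x
      = exp (2 * u x) * (dd S (\<lambda>q. B q v w) z x + (B x (D x z v) w + B x v (D x z w)))" by simp
  then show "dd S (\<lambda>q. bform gu q v w) z x
      = bform gu x (\<Gamma> x z v + D x z v) w + bform gu x v (\<Gamma> x z w + D x z w)"
    by (simp add: B_gu compat[OF x] linear_add[OF linear_bform1] linear_add[OF linear_bform2] algebra_simps)
qed

lemma dd_Gam_u: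
  assumes x: "x \<in> S"
  shows "dd S (\<lambda>q. Gam S gu q v w) z x = DGam x z v w + dd S (dd S u v) z x *\<^sub>R w + dd S (dd S u w) z x *\<^sub>R v
     - (B x (\<Gamma> x z v) w + B x v (\<Gamma> x z w)) *\<^sub>R U x - B x v w *\<^sub>R dd S U z x"
proof -
  note hd = has_derivative_dd[OF hopen _ x]
  have "((\<lambda>q. \<Gamma> q v w + (du q v *\<^sub>R w + du q w *\<^sub>R v - B q v w *\<^sub>R U q)) has_derivative
     (\<lambda>z. DGam x z v w + (dd S (dd S u v) z x *\<^sub>R w + dd S (dd S u w) z x *\<^sub>R v
     - (B x v w *\<^sub>R dd S U z x + dd S (\<lambda>q. B q v w) z x *\<^sub>R U x)))) (at x within S)"
    by (intro has_derivative_add has_derivative_diff hd smooth_Gam has_derivative_scaleR smooth_B smooth_U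
        has_derivative_scaleR_left smooth_on_dd[OF hopen smooth_u])
  note dd_eqI[OF this hopen x]
  moreover have "dd S (\<lambda>q. Gam S gu q v w) z x = dd S (\<lambda>q. \<Gamma> q v w + (du q v *\<^sub>R w + du q w *\<^sub>R v - B q v w *\<^sub>R U q)) z x"
    by (rule dd_cong[OF x]) (simp add: Gam_u D_def)
  ultimately show ?thesis by (simp add: compat[OF x] algebra_simps)
qed

text \<open>The curvature of a connection changed by \<open>D\<close> gains the antisymmetrized
  covariant derivative of \<open>D\<close>, which is the line with Hessian terms, and the commutator
  of \<open>D\<close> with itself, which gives the terms quadratic in du.\<close>

lemma Rm_u:
  assumes x: "x \<in> S"
  shows "Rm S gu x z v w = Rm S g x z v w
    + hess x z w *\<^sub>R v - hess x v w *\<^sub>R z - B x v w *\<^sub>R nU x z + B x z w *\<^sub>R nU x v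
    - (du x z * du x w) *\<^sub>R v + (du x v * du x w) *\<^sub>R z - (B x v w * nrm x) *\<^sub>R z + (B x z w * nrm x) *\<^sub>R v
    - (du x v * B x z w) *\<^sub>R U x + (du x z * B x v w) *\<^sub>R U x"
proof -
  have syms: "\<Gamma> x v z = \<Gamma> x z v" "B x v z = B x z v" "dd S (dd S u v) z x = dd S (dd S u z) v x"
    "B x v (\<Gamma> x z w) = B x (\<Gamma> x z w) v" "B x z (\<Gamma> x v w) = B x (\<Gamma> x v w) z" "B x z (U x) = du x z" "B x v (U x) = du x v"
    using Gam_sym[OF x] B_sym[OF x] dd_commute[OF hopen smooth_u x] B_U[OF x] by metis+
  note lin = linear_add[OF linear_Gam2] linear_diff[OF linear_Gam2] linear_cmul[OF linear_Gam2]
    linear_add[OF linear_du[OF x]] linear_diff[OF linear_du[OF x]] linear_cmul[OF linear_du[OF x]]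
    linear_add[OF linear_bform2] linear_diff[OF linear_bform2] linear_cmul[OF linear_bform2]
  \<comment> \<open>On vectors the numeral \<open>2\<close> is the vector with all components 2 and
    the product is componentwise; this turns such a product back into a scaling.\<close>
  have two: "q * 2 = 2 *\<^sub>R q" for q :: "real^'n" by (simp add: vec_eq_iff)
  show ?thesis
    unfolding Rm_def dd_Gam_u[OF x] Gam_u[OF x] hess_def nU_def nrm_def
    unfolding D_def lin
    by (simp add: syms lin algebra_simps) (simp add: two algebra_simps)
qed

lemma ricci_u:
  assumes x: "x \<in> S"
  shows "v \<bullet> (ricci S gu x *v w) = v \<bullet> (ricci S g x *v w)
    - (real CARD('n) - 2) * hess x v w - lap x * B x v w
    + (real CARD('n) - 2) * (du x v * du x w) - (real CARD('n) - 2) * nrm x * B x v w"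
proof -
  \<comment> \<open>Contractions over the first slot: a linear functional of that slot paired with a
    fixed vector is the functional evaluated at this vector.\<close>
  have t: "(\<Sum>i\<in>UNIV. hess x (axis i 1) w * v $ i) = hess x v w"
     "(\<Sum>i\<in>UNIV. B x (axis i 1) w * nU x v $ i) = hess x v w"
     "(\<Sum>i\<in>UNIV. du x (axis i 1) * v $ i) = du x v"
     "(\<Sum>i\<in>UNIV. B x (axis i 1) w * v $ i) = B x v w"
     "(\<Sum>i\<in>UNIV. B x (axis i 1) w * U x $ i) = du x w"
     "(\<Sum>i\<in>UNIV. du x (axis i 1) * U x $ i) = nrm x"
    using linear_axis_sum_real[OF linear_hess(1)[OF x]] linear_axis_sum_real[OF linear_bform1[of g x w]]
      linear_axis_sum_real[OF linear_du[OF x]] B_nU[OF x] B_U[OF x] by (simp_all add: nrm_def)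
  have "Rm S gu x (axis i 1) v w $ i = Rm S g x (axis i 1) v w $ i
     + hess x (axis i 1) w * v $ i - hess x v w * axis i 1 $ i - B x v w * nU x (axis i 1) $ i + B x (axis i 1) w * nU x v $ i
     - du x w * (du x (axis i 1) * v $ i) + du x v * du x w * axis i 1 $ i - B x v w * nrm x * axis i 1 $ i + nrm x * (B x (axis i 1) w * v $ i)
     - du x v * (B x (axis i 1) w * U x $ i) + B x v w * (du x (axis i 1) * U x $ i)" for i
    by (simp add: Rm_u[OF x])
  then have "v \<bullet> (ricci S gu x *v w) = v \<bullet> (ricci S g x *v w)
     + hess x v w - hess x v w * real CARD('n) - B x v w * lap x + hess x v w
     - du x w * du x v + du x v * du x w * real CARD('n) - B x v w * nrm x * real CARD('n) + nrm x * B x v w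
     - du x v * du x w + B x v w * nrm x"
    by (simp only: ricci_form[OF x] u.ricci_form[OF x] sum.distrib sum_subtractf sum_distrib_left[symmetric] t lap_def) simp
  then show ?thesis
    by (simp add: algebra_simps)
qed

lemma scalar_curvature_form:
  "scalar_curvature S g x = (\<Sum>i\<in>UNIV. \<Sum>j\<in>UNIV. matrix_inv (g x) $ i $ j * (axis i 1 \<bullet> (ricci S g x *v axis j 1)))"
  by (simp add: scalar_curvature_def inner_axis' matrix_vector_mult_basis column_def)

lemma matrix_inv_gu: "x \<in> S \<Longrightarrow> matrix_inv (gu x) = exp (- 2 * u x) *\<^sub>R matrix_inv (g x)"
  by (rule matrix_inv_unique)
    (simp add: gu_def bounded_bilinear.scaleR_left[OF bounded_bilinear_matrix_mult]
      bounded_bilinear.scaleR_right[OF bounded_bilinear_matrix_mult] matrix_inv_works(1)[OF inv_g] exp_minus)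

lemma lap_form:
  assumes x: "x \<in> S"
  shows "(\<Sum>i\<in>UNIV. \<Sum>j\<in>UNIV. matrix_inv (g x) $ i $ j * hess x (axis i 1) (axis j 1)) = lap x"
proof -
  have "(\<Sum>j\<in>UNIV. matrix_inv (g x) $ i $ j * hess x (axis i 1) (axis j 1)) = nU x (axis i 1) $ i" for i
    using matrix_inv_form[OF x, of i "nU x (axis i 1)"] B_sym[OF x, of "axis _ 1" "nU x (axis i 1)"] by (simp add: B_nU[OF x])
  then show ?thesis by (simp add: lap_def)
qed

lemma nrm_form:
  assumes x: "x \<in> S"
  shows "(\<Sum>i\<in>UNIV. \<Sum>j\<in>UNIV. matrix_inv (g x) $ i $ j * (du x (axis i 1) * du x (axis j 1))) = nrm x"
proof -
  have "(\<Sum>j\<in>UNIV. matrix_inv (g x) $ i $ j * (du x (axis i 1) * du x (axis j 1))) = du x (axis i 1) * U x $ i" for i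
    using matrix_inv_form[OF x, of i "U x"] B_sym[OF x, of "axis _ 1" "U x"]
    by (simp add: B_U[OF x] sum_distrib_left mult_ac flip: matrix_inv_form[OF x, of i "U x"])
  then show ?thesis using linear_axis_sum_real[OF linear_du[OF x], of "U x"] by (simp add: nrm_def)
qed

text \<open>The trace of \<open>ricci_u\<close>. The factor on the left undoes the
  \<open>exp (- 2 * u x)\<close> in the inverse of the conformal metric.\<close>

lemma scalar_curvature_u:
  assumes x: "x \<in> S"
  shows "exp (2 * u x) * scalar_curvature S gu x = scalar_curvature S g x
    - 2 * (real CARD('n) - 1) * lap x - (real CARD('n) - 1) * (real CARD('n) - 2) * nrm x"
proof -
  let ?i = "matrix_inv (g x)"
  have tB: "(\<Sum>i\<in>UNIV. \<Sum>j\<in>UNIV. ?i $ i $ j * B x (axis i 1) (axis j 1)) = real CARD('n)"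
  proof -
    have "(\<Sum>j\<in>UNIV. ?i $ i $ j * B x (axis i 1) (axis j 1)) = 1" for i
      using matrix_inv_form[OF x, of i "axis i 1"] B_sym[OF x, of "axis i 1"] by simp
    then show ?thesis by simp
  qed
  have "exp (2 * u x) * scalar_curvature S gu x = (\<Sum>i\<in>UNIV. \<Sum>j\<in>UNIV. ?i $ i $ j * (axis i 1 \<bullet> (ricci S gu x *v axis j 1)))"
  proof -
    have e: "exp (2 * u x) * (inverse (exp (2 * u x)) * a) = a" for a by (simp add: field_simps)
    show ?thesis
      by (simp add: e scalar_curvature_def inner_axis' matrix_vector_mult_basis column_def matrix_inv_gu[OF x] sum_distrib_left exp_minus mult.assoc)
  qed
  also have "\<dots> = (\<Sum>i\<in>UNIV. \<Sum>j\<in>UNIV. ?i $ i $ j * (axis i 1 \<bullet> (ricci S g x *v axis j 1))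
     - (real CARD('n) - 2) * (?i $ i $ j * hess x (axis i 1) (axis j 1))
     - (lap x + (real CARD('n) - 2) * nrm x) * (?i $ i $ j * B x (axis i 1) (axis j 1))
     + (real CARD('n) - 2) * (?i $ i $ j * (du x (axis i 1) * du x (axis j 1))))"
    by (intro sum.cong refl) (simp add: ricci_u[OF x] algebra_simps)
  also have "\<dots> = scalar_curvature S g x - (real CARD('n) - 2) * lap x
     - (lap x + (real CARD('n) - 2) * nrm x) * real CARD('n) + (real CARD('n) - 2) * nrm x"
    by (simp add: sum.distrib sum_subtractf scalar_curvature_form flip: sum_distrib_left tB lap_form[OF x] nrm_form[OF x])
  also have "\<dots> = scalar_curvature S g x
    - 2 * (real CARD('n) - 1) * lap x - (real CARD('n) - 1) * (real CARD('n) - 2) * nrm x"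
    by (simp add: algebra_simps)
  finally show ?thesis .
qed

end

section \<open>Positivity for the exponential of a function without critical points\<close>

lemma quadratic_form_continuous:
  fixes a :: "'x::topological_space \<Rightarrow> real^'n^'n"
  assumes "continuous_on K a"
  shows "continuous_on (K \<times> T) (\<lambda>z. snd z \<bullet> (a (fst z) *v snd z))"
proof -
  have "continuous_on (K \<times> T) (\<lambda>z. a (fst z))"
    by (rule continuous_on_compose2[OF assms]) (auto intro!: continuous_intros)
  then show ?thesis
    unfolding inner_vec_def matrix_vector_mult_def
    by (simp, intro continuous_on_sum continuous_on_mult continuous_on_component continuous_intros)
qed

text \<open>The form is continuous on the compact product of \<open>K\<close> with the unit sphere
  and attains its infimum there, so pointwise positivity becomes a uniform lower bound.\<close>

lemma quadratic_form_bounds: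
  fixes a :: "real^'m \<Rightarrow> real^'n^'n"
  assumes K: "compact K" and a: "continuous_on K a"
  shows "\<exists>C\<ge>0. \<forall>x\<in>K. \<forall>v. norm v = 1 \<longrightarrow> - C \<le> v \<bullet> (a x *v v)"
    and "(\<And>x v. x \<in> K \<Longrightarrow> v \<noteq> 0 \<Longrightarrow> 0 < v \<bullet> (a x *v v)) \<Longrightarrow> \<exists>m>0. \<forall>x\<in>K. \<forall>v. norm v = 1 \<longrightarrow> m \<le> v \<bullet> (a x *v v)"
proof -
  let ?f = "\<lambda>z. snd z \<bullet> (a (fst z) *v snd z)" and ?C = "K \<times> sphere (0::real^'n) 1"
  have c: "continuous_on ?C ?f" by (rule quadratic_form_continuous[OF a])
  have cpt: "compact ?C" by (intro compact_Times K compact_sphere)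
  have inf: "\<exists>z\<in>?C. \<forall>y\<in>?C. ?f z \<le> ?f y" if "K \<noteq> {}"
  proof (rule continuous_attains_inf[OF cpt _ c])
    show "?C \<noteq> {}" using that by simp
  qed
  show "\<exists>C\<ge>0. \<forall>x\<in>K. \<forall>v. norm v = 1 \<longrightarrow> - C \<le> v \<bullet> (a x *v v)"
  proof (cases "K = {}")
    case False
    then obtain z where z: "z \<in> ?C" "\<forall>y\<in>?C. ?f z \<le> ?f y" using inf by blast
    have "- \<bar>?f z\<bar> \<le> v \<bullet> (a x *v v)" if "x \<in> K" "norm v = 1" for x v
    proof -
      have "?f z \<le> ?f (x, v)" using z(2) that by (intro bspec[OF z(2)]) auto
      then show ?thesis by simp
    qed
    then show ?thesis by (intro exI[of _ "\<bar>?f z\<bar>"]) auto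
  qed auto
  assume pos: "\<And>x v. x \<in> K \<Longrightarrow> v \<noteq> 0 \<Longrightarrow> 0 < v \<bullet> (a x *v v)"
  show "\<exists>m>0. \<forall>x\<in>K. \<forall>v. norm v = 1 \<longrightarrow> m \<le> v \<bullet> (a x *v v)"
  proof (cases "K = {}")
    case True then show ?thesis by (intro exI[of _ 1]) auto
  next
    case False
    then obtain z where z: "z \<in> ?C" "\<forall>y\<in>?C. ?f z \<le> ?f y" using inf by blast
    have "snd z \<noteq> 0" using z(1) by auto
    then have "0 < ?f z" using pos[of "fst z" "snd z"] z(1) by auto
    moreover have "?f z \<le> v \<bullet> (a x *v v)" if "x \<in> K" "norm v = 1" for x v
    proof -
      have "?f z \<le> ?f (x, v)" using z(2) that by (intro bspec[OF z(2)]) auto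
      then show ?thesis by simp
    qed
    ultimately show ?thesis by (intro exI[of _ "?f z"]) auto
  qed
qed

text \<open>The quadratic form of \<open>n - 2\<close> times the modified Schouten tensor; the
  scaling is positive, so the sign is the same and the formulas are free of fractions in
  \<open>n - 2\<close>.\<close>

definition schouten_form :: "real \<Rightarrow> (real^'n) set \<Rightarrow> (real^'n \<Rightarrow> real^'n^'n) \<Rightarrow> real^'n \<Rightarrow> real^'n::finite \<Rightarrow> real" where
  "schouten_form \<tau> S g x v = v \<bullet> (ricci S g x *v v)
     - \<tau> / (2 * (real CARD('n) - 1)) * scalar_curvature S g x * bform g x v v"

context metric_patch
begin

lemma smooth_riemann: "smooth_on S (riemann S g l q i j)"
  unfolding riemann_def[abs_def] pd_dd
  by (intro smooth_on_add smooth_on_diff smooth_on_sum smooth_on_mult smooth_christoffel smooth_on_dd[OF hopen])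

lemma smooth_ricci: "smooth_on S (ricci S g)"
  by (rule smooth_on_vec, rule smooth_on_vec) (simp add: ricci_def smooth_on_sum smooth_riemann)

lemma smooth_scalar_curvature: "smooth_on S (scalar_curvature S g)"
  unfolding scalar_curvature_def[abs_def]
  by (intro smooth_on_sum smooth_on_mult smooth_on_nth smooth_inv smooth_ricci)

end

context conformal_patch
begin

lemma nrm_B_U: "x \<in> S \<Longrightarrow> nrm x = B x (U x) (U x)"
  by (simp add: B_U nrm_def)

lemma nrm_pos:
  assumes "x \<in> S" "du x v \<noteq> 0" shows "0 < nrm x"
proof -
  have "U x \<noteq> 0" using assms B_U[of x v] by (auto simp: bform_def)
  then show ?thesis using B_pos[OF assms(1)] nrm_B_U[OF assms(1)] by simp
qed

text \<open>The exponential in the scalar curvature cancels against that of the metric, so that only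
  derivatives of \<open>u\<close> up to second order remain, with no conformal factor.\<close>

lemma modified_schouten_form:
  assumes x: "x \<in> S" and n: "real CARD('n) > 2"
  shows "schouten_form \<tau> S gu x v = schouten_form \<tau> S g x v
     - (real CARD('n) - 2) * hess x v v + (\<tau> - 1) * lap x * B x v v
     + (real CARD('n) - 2) * (du x v)\<^sup>2 + (real CARD('n) - 2) * (\<tau> / 2 - 1) * nrm x * B x v v"
proof -
  let ?n = "real CARD('n)"
  have "\<tau> / (2 * (?n - 1)) * scalar_curvature S gu x * bform gu x v v
      = \<tau> / (2 * (?n - 1)) * (exp (2 * u x) * scalar_curvature S gu x) * B x v v"
    by (simp add: B_gu)
  also have "\<dots> = \<tau> / (2 * (?n - 1)) * scalar_curvature S g x * B x v v - \<tau> * lap x * B x v v - \<tau> / 2 * (?n - 2) * nrm x * B x v v"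
    unfolding scalar_curvature_u[OF x] using n by (simp add: field_simps)
  finally have *: "\<tau> / (2 * (?n - 1)) * scalar_curvature S gu x * bform gu x v v = \<dots>" .
  show ?thesis
    unfolding schouten_form_def * ricci_u[OF x] by (simp add: power2_eq_square algebra_simps)
qed

end

text \<open>Two conformal changes share one background metric: names qualified by \<open>F\<close>
  belong to the potential \<open>F\<close>, unqualified ones to its exponential
  \<open>\<phi>\<close>.\<close>

locale exp_potential = F: conformal_patch k S g F
  for k :: "'n::finite" and S g and F :: "real^'n \<Rightarrow> real" +
  fixes \<mu> :: real
begin

abbreviation "\<phi> x \<equiv> exp (\<mu> * F x)"

sublocale conformal_patch k S g \<phi>
  by unfold_locales (intro smooth_on_exp smooth_on_mult smooth_on_const F.smooth_u)

lemma du_exp: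
  assumes x: "x \<in> S" shows "du x v = \<mu> * \<phi> x * F.du x v"
proof -
  have "(\<phi> has_derivative (\<lambda>v. (\<mu> * F.du x v) * \<phi> x)) (at x within S)"
    by (rule has_derivative_exp[OF has_derivative_mult_right[OF has_derivative_dd[OF F.hopen F.smooth_u x]], THEN has_derivative_eq_rhs]) (simp add: mult.commute)
  from dd_eqI[OF this F.hopen x] show ?thesis by simp
qed

lemma hess_exp:
  assumes x: "x \<in> S" shows "hess x z w = \<mu> * \<phi> x * F.hess x z w + \<mu>\<^sup>2 * \<phi> x * (F.du x z * F.du x w)"
proof -
  have "((\<lambda>y. (\<mu> * \<phi> y) * F.du y w) has_derivative (\<lambda>z. (\<mu> * \<phi> x) * dd S (dd S F w) z x + (\<mu> * du x z) * F.du x w)) (at x within S)"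
    by (intro has_derivative_mult has_derivative_mult_right has_derivative_dd[OF F.hopen smooth_u x] has_derivative_dd[OF F.hopen smooth_on_dd[OF F.hopen F.smooth_u] x])
  from dd_eqI[OF this F.hopen x]
  have "dd S (\<lambda>y. (\<mu> * \<phi> y) * F.du y w) z x = (\<mu> * \<phi> x) * dd S (dd S F w) z x + (\<mu> * du x z) * F.du x w" .
  moreover have "dd S (dd S \<phi> w) z x = dd S (\<lambda>y. (\<mu> * \<phi> y) * F.du y w) z x"
    by (rule dd_cong[OF x]) (rule du_exp)
  ultimately show ?thesis
    by (simp add: hess_def F.hess_def du_exp[OF x] power2_eq_square algebra_simps)
qed

lemma nrm_exp:
  assumes x: "x \<in> S" shows "nrm x = \<mu>\<^sup>2 * (\<phi> x)\<^sup>2 * F.nrm x"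
  unfolding nrm_form[OF x, symmetric] F.nrm_form[OF x, symmetric] sum_distrib_left
  by (intro sum.cong refl) (simp add: du_exp[OF x] power2_eq_square)

lemma lap_exp:
  assumes x: "x \<in> S" shows "lap x = \<mu> * \<phi> x * F.lap x + \<mu>\<^sup>2 * \<phi> x * F.nrm x"
  unfolding lap_form[OF x, symmetric] F.lap_form[OF x, symmetric] F.nrm_form[OF x, symmetric] sum_distrib_left sum.distrib[symmetric]
  by (intro sum.cong refl) (simp add: hess_exp[OF x] algebra_simps)

end

text \<open>The form is bounded below by a positive multiple of
  \<open>\<mu> * (\<mu> * m - C0 - C1)\<close>. The claim is made for all large
  \<open>\<mu>\<close>, so that one value can serve finitely many cells.\<close>

lemma (in conformal_patch) exp_potential_positive:
  assumes n: "CARD('n) \<ge> 3" and \<tau>: "\<tau> \<ge> 2" and K: "compact K" "K \<subseteq> S"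
    and nz: "\<And>x. x \<in> K \<Longrightarrow> \<exists>v. du x v \<noteq> 0" and nonneg: "\<And>x. x \<in> K \<Longrightarrow> 0 \<le> u x"
  shows "\<exists>\<Lambda>. \<forall>\<mu>\<ge>\<Lambda>. \<forall>x\<in>K. \<forall>v. v \<noteq> 0 \<longrightarrow>
    0 < schouten_form \<tau> S (\<lambda>y. exp (2 * exp (\<mu> * u y)) *\<^sub>R g y) x v"
proof -
  let ?n = "real CARD('n)"
  have n2: "?n > 2" using n by simp
  \<comment> \<open>The matrices \<open>a0\<close>, \<open>a1\<close> and \<open>a2\<close> hold the
    background term, the coefficient of \<open>\<mu> * exp (\<mu> * u x)\<close> and the positive
    form that occurs at second order in \<open>\<mu>\<close>.\<close>
  define a0 where "a0 x = ricci S g x - (\<tau> / (2 * (?n - 1)) * scalar_curvature S g x) *\<^sub>R g x" for x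
  define hm where "hm x = (\<chi> i j. hess x (axis i 1) (axis j 1))" for x
  define a1 where "a1 x = ((\<tau> - 1) * lap x) *\<^sub>R g x - (?n - 2) *\<^sub>R hm x" for x
  define a2 where "a2 x = nrm x *\<^sub>R g x" for x
  have sh: "smooth_on S (\<lambda>x. hess x (axis i 1) (axis j 1))" for i j
  proof -
    have "hess x (axis i 1) (axis j 1) = dd S (dd S u (axis j 1)) (axis i 1) x - (\<Sum>l\<in>UNIV. \<Gamma> x (axis i 1) (axis j 1) $ l * du x (axis l 1))" if "x \<in> S" for x
      using linear_axis_sum_real[OF linear_du[OF that], of "\<Gamma> x (axis i 1) (axis j 1)"] by (simp add: hess_def mult.commute)
    moreover have "smooth_on S (\<lambda>x. dd S (dd S u (axis j 1)) (axis i 1) x - (\<Sum>l\<in>UNIV. \<Gamma> x (axis i 1) (axis j 1) $ l * du x (axis l 1)))"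
      by (intro smooth_on_diff smooth_on_sum smooth_on_mult smooth_on_nth smooth_Gam smooth_on_dd[OF hopen] smooth_u)
    ultimately show ?thesis by (intro smooth_on_cong[where g="\<lambda>x. hess x (axis i 1) (axis j 1)"]) auto
  qed
  have sl: "smooth_on S lap"
    by (rule smooth_on_cong[OF _ lap_form], intro smooth_on_sum smooth_on_mult smooth_on_nth smooth_inv sh)
  have sn: "smooth_on S nrm"
    by (rule smooth_on_cong[OF _ nrm_form], intro smooth_on_sum smooth_on_mult smooth_on_nth smooth_inv smooth_on_dd[OF hopen] smooth_u)
  have shm: "smooth_on S hm"
    by (rule smooth_on_vec, rule smooth_on_vec) (simp add: hm_def sh)
  have "smooth_on S a0" "smooth_on S a1" "smooth_on S a2"
    unfolding a0_def a1_def a2_def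
    by (intro smooth_on_diff smooth_on_scaleR smooth_on_mult smooth_on_const smooth_ricci smooth_scalar_curvature smooth_g sl sn shm)+
  then have cont: "continuous_on K a0" "continuous_on K a1" "continuous_on K a2"
    using smooth_on_continuous continuous_on_subset K(2) by blast+
  have q2: "v \<bullet> (a2 x *v v) = nrm x * B x v v" for x v
    by (simp add: a2_def bform_def scaleR_matrix_vector_assoc[symmetric])
  have qh: "v \<bullet> (hm x *v v) = hess x v v" if "x \<in> S" for x v
  proof -
    have "v \<bullet> (hm x *v v) = (\<Sum>i\<in>UNIV. v $ i * (\<Sum>j\<in>UNIV. hess x (axis i 1) (axis j 1) * v $ j))"
      by (simp add: hm_def inner_vec_def matrix_vector_mult_def)
    also have "\<dots> = hess x v v"
      using linear_axis_sum_real[OF linear_hess(2)[OF that]] linear_axis_sum_real[OF linear_hess(1)[OF that], of v v]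
      by (simp add: mult.commute)
    finally show ?thesis .
  qed
  have q1: "v \<bullet> (a1 x *v v) = (\<tau> - 1) * lap x * B x v v - (?n - 2) * hess x v v" if "x \<in> S" for x v
    using qh[OF that]
    by (simp add: a1_def bform_def matrix_vector_mult_diff_rdistrib scaleR_matrix_vector_assoc[symmetric] inner_diff_right)
  have q0: "schouten_form \<tau> S g x v = v \<bullet> (a0 x *v v)" for x v
    by (simp add: schouten_form_def a0_def bform_def matrix_vector_mult_diff_rdistrib scaleR_matrix_vector_assoc[symmetric] inner_diff_right)
  obtain C0 where C0: "C0 \<ge> 0" "\<forall>x\<in>K. \<forall>v. norm v = 1 \<longrightarrow> - C0 \<le> v \<bullet> (a0 x *v v)"
    using quadratic_form_bounds(1)[OF K(1) cont(1)] by blast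
  obtain C1 where C1: "C1 \<ge> 0" "\<forall>x\<in>K. \<forall>v. norm v = 1 \<longrightarrow> - C1 \<le> v \<bullet> (a1 x *v v)"
    using quadratic_form_bounds(1)[OF K(1) cont(2)] by blast
  have "0 < v \<bullet> (a2 x *v v)" if "x \<in> K" "v \<noteq> 0" for x v
  proof -
    have "x \<in> S" using that K(2) by blast
    then show ?thesis using nz[OF that(1)] nrm_pos B_pos that(2) by (auto simp: q2)
  qed
  then obtain m where m: "m > 0" "\<forall>x\<in>K. \<forall>v. norm v = 1 \<longrightarrow> m \<le> v \<bullet> (a2 x *v v)"
    using quadratic_form_bounds(2)[OF K(1) cont(3)] by blast
  \<comment> \<open>The quotient makes \<open>\<mu> * m\<close> exceed \<open>C0 + C1\<close>; the
    summand 1 gives \<open>\<mu> \<ge> 1\<close>.\<close>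
  define \<Lambda> where "\<Lambda> = 1 + (C0 + C1) / m"
  show ?thesis
  proof (intro exI[of _ \<Lambda>] allI impI ballI)
    fix \<mu> x and v :: "real^'n" assume \<mu>: "\<Lambda> \<le> \<mu>" and x: "x \<in> K" and v: "v \<noteq> 0"
    interpret E: exp_potential k S g u \<mu> by unfold_locales
    have xS: "x \<in> S" using x K(2) by blast
    have \<mu>1: "1 \<le> \<mu>" using \<mu> C0 C1 m by (simp add: \<Lambda>_def) (smt (verit) divide_nonneg_pos)
    let ?e = "exp (\<mu> * u x)"
    have e1: "1 \<le> ?e" using nonneg[OF x] \<mu>1 by simp
    have "(C0 + C1) / m < \<mu>" using \<mu> by (simp add: \<Lambda>_def)
    then have big: "C0 + C1 < \<mu> * m" using m(1) by (simp add: divide_less_eq)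
    define w where "w = (1 / norm v) *\<^sub>R v"
    have w: "norm w = 1" using v by (simp add: w_def)
    have vw: "v = norm v *\<^sub>R w" using v by (simp add: w_def)
    have hom: "v \<bullet> (A *v v) = (norm v)\<^sup>2 * (w \<bullet> (A *v w))" for A :: "real^'n^'n"
      by (subst (1 2) vw) (simp add: matrix_vector_mult_scaleR power2_eq_square)
    let ?a = "v \<bullet> (a0 x *v v)" and ?b = "v \<bullet> (a1 x *v v)" and ?c = "v \<bullet> (a2 x *v v)" and ?s = "(norm v)\<^sup>2"
    have s: "?s > 0" using v by simp
    have b0: "- C0 * ?s \<le> ?a" unfolding hom[of "a0 x"] using mult_right_mono[OF C0(2)[rule_format, OF x w], of ?s] by (simp add: mult.commute)
    have b1: "- C1 * ?s \<le> ?b" unfolding hom[of "a1 x"] using mult_right_mono[OF C1(2)[rule_format, OF x w], of ?s] by (simp add: mult.commute)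
    have b2: "m * ?s \<le> ?c" unfolding hom[of "a2 x"] using mult_right_mono[OF m(2)[rule_format, OF x w], of ?s] by (simp add: mult.commute)
    have eg: "(\<lambda>y. exp (2 * exp (\<mu> * u y)) *\<^sub>R g y) = E.gu" by (simp add: E.gu_def fun_eq_iff)
    have main: "schouten_form \<tau> S E.gu x v
      = ?a + \<mu> * ?e * ?b + \<mu>\<^sup>2 * ?e * ((\<tau> - 1) * ?c - (?n - 2) * (du x v)\<^sup>2)
        + \<mu>\<^sup>2 * ?e\<^sup>2 * ((?n - 2) * (du x v)\<^sup>2 + (?n - 2) * (\<tau> / 2 - 1) * ?c)" (is "_ = ?r")
      unfolding E.modified_schouten_form[OF xS n2] q0 q1[OF xS] q2 E.hess_exp[OF xS] E.lap_exp[OF xS] E.nrm_exp[OF xS] E.du_exp[OF xS]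
      by (simp add: power2_eq_square algebra_simps)
    have ge: "?e * ?s * (\<mu> * (\<mu> * m - C0 - C1)) \<le> ?r"
    proof -
      have c0: "0 \<le> ?c" using b2 m(1) s mult_pos_pos[of m ?s] by linarith
      have le: "1 \<le> \<mu> * ?e" using mult_mono[of 1 \<mu> 1 ?e] \<mu>1 e1 by simp
      \<comment> \<open>The background bound has no factor \<open>\<mu> * ?e\<close>; as this factor
        is at least 1, it may be inserted and all bounds get the same shape.\<close>
      have "1 * (C0 * ?s) \<le> (\<mu> * ?e) * (C0 * ?s)" using le C0(1) s by (intro mult_right_mono) auto
      then have t0: "- (\<mu> * ?e * (C0 * ?s)) \<le> ?a" using b0 by linarith
      have t1: "- (\<mu> * ?e * (C1 * ?s)) \<le> \<mu> * ?e * ?b"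
        using mult_left_mono[OF b1, of "\<mu> * ?e"] le by simp
      have "1 * ?c \<le> (\<tau> - 1) * ?c" using \<tau> c0 by (intro mult_right_mono) auto
      then have t2: "\<mu>\<^sup>2 * ?e * (m * ?s) \<le> \<mu>\<^sup>2 * ?e * ((\<tau> - 1) * ?c)"
        using b2 by (intro mult_left_mono) auto
      \<comment> \<open>Here nonnegativity of \<open>u\<close> enters: the square of du with factor
        \<open>?e\<^sup>2\<close> outweighs the negative one with factor \<open>?e\<close>.\<close>
      have "?e \<le> ?e\<^sup>2" using e1 self_le_power[of ?e 2] by simp
      then have t3: "\<mu>\<^sup>2 * ?e * ((?n - 2) * (du x v)\<^sup>2) \<le> \<mu>\<^sup>2 * ?e\<^sup>2 * ((?n - 2) * (du x v)\<^sup>2)"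
        using n2 by (intro mult_right_mono mult_left_mono) auto
      have t4: "0 \<le> \<mu>\<^sup>2 * ?e\<^sup>2 * ((?n - 2) * (\<tau> / 2 - 1) * ?c)"
        using n2 \<tau> c0 by (intro mult_nonneg_nonneg) auto
      show ?thesis using t0 t1 t2 t3 t4 by (simp add: algebra_simps power2_eq_square)
    qed
    have "0 < ?e * ?s * (\<mu> * (\<mu> * m - C0 - C1))"
      using s \<mu>1 big by (intro mult_pos_pos) auto
    with ge main show "0 < schouten_form \<tau> S (\<lambda>y. exp (2 * exp (\<mu> * u y)) *\<^sub>R g y) x v"
      unfolding eg by linarith
  qed
qed

subsection \<open>Cut-off functions\<close>

text \<open>The powers of \<open>inverse t\<close> make the family closed under differentiation up
  to linear combinations, so smoothness of all members follows by one induction.\<close>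

definition flat :: "nat \<Rightarrow> real \<Rightarrow> real" where
  "flat j t = (if t \<le> 0 then 0 else exp (- inverse t) * inverse t ^ j)"

lemma flat_tendsto_0: "(flat j \<longlongrightarrow> 0) (at 0)"
proof (rule filterlim_split_at)
  show "(flat j \<longlongrightarrow> 0) (at_left 0)"
    by (rule tendsto_eventually) (auto simp: eventually_at_filter flat_def)
  have "((\<lambda>t::real. inverse t ^ j / exp (inverse t)) \<longlongrightarrow> 0) (at_right 0)"
    by (rule filterlim_compose[OF tendsto_power_div_exp_0 filterlim_inverse_at_top_right])
  moreover have "\<forall>\<^sub>F t in at_right 0. inverse t ^ j / exp (inverse t) = flat j t"
    by (auto simp: eventually_at_filter flat_def exp_minus divide_inverse)
  ultimately show "(flat j \<longlongrightarrow> 0) (at_right 0)"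
    by (rule Lim_transform_eventually)
qed

text \<open>Away from 0 this is calculus; at 0 the difference quotient of \<open>flat j\<close> is
  \<open>flat (Suc j)\<close>, which tends to 0 because the exponential beats every power.\<close>

lemma flat_has_derivative: "(flat j has_real_derivative flat (j + 2) t - j * flat (j + 1) t) (at t)"
proof (cases t "0::real" rule: linorder_cases)
  case less
  have "((\<lambda>t. 0) has_real_derivative 0) (at t)" by simp
  then have "(flat j has_real_derivative 0) (at t)"
    by (rule has_field_derivative_transform_within_open[where S="{..<0}"]) (use less in \<open>auto simp: flat_def\<close>)
  then show ?thesis using less by (simp add: flat_def)
next
  case equal
  have "((\<lambda>h. flat j h / h) \<longlongrightarrow> 0) (at 0)"
  proof (rule Lim_transform_eventually[OF flat_tendsto_0[of "Suc j"]])
    show "\<forall>\<^sub>F h in at 0. flat (Suc j) h = flat j h / h"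
      by (simp add: flat_def divide_inverse)
  qed
  then show ?thesis using equal by (simp add: DERIV_def flat_def)
next
  case greater
  have "((\<lambda>t. exp (- inverse t) * inverse t ^ j) has_real_derivative flat (j + 2) t - j * flat (j + 1) t) (at t)"
    using greater
    by (auto intro!: derivative_eq_intros simp: flat_def power2_eq_square)
      (cases j; simp add: field_simps)
  then show ?thesis
    by (rule has_field_derivative_transform_within_open[where S="{0<..}"]) (use greater in \<open>auto simp: flat_def\<close>)
qed

lemma Ck_on_flat: "Ck_on m UNIV (flat j)"
proof (induction m arbitrary: j)
  case 0
  show ?case
    using flat_has_derivative DERIV_isCont continuous_at_imp_continuous_on by (metis Ck_on.simps(1))
next
  case (Suc m)
  show ?case
  proof (rule Ck_on_SucI[where f'="\<lambda>t v. (flat (j + 2) t + (- real j) * flat (j + 1) t) * v"])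
    show "Ck_on m UNIV (\<lambda>t. (flat (j + 2) t + (- real j) * flat (j + 1) t) * v)" for v
      by (intro Ck_on_bilinear[OF _ bounded_bilinear_mult] Ck_on_add Ck_on_const Suc) auto
    show "(flat j has_derivative (\<lambda>v. (flat (j + 2) t + (- real j) * flat (j + 1) t) * v)) (at t)" for t
      using flat_has_derivative[of j t] by (simp add: has_field_derivative_def)
  qed simp
qed

text \<open>The quotient \<open>?p / (?p + ?q)\<close>, where \<open>?p\<close> vanishes off the
  ball of radius \<open>2 * r\<close> and \<open>?q\<close> vanishes on the ball of radius
  \<open>r\<close>. They never vanish together, so the denominator is positive.\<close>

lemma smooth_bump:
  fixes a :: "'a::euclidean_space"
  assumes r: "r > 0"
  obtains \<eta> :: "'a \<Rightarrow> real" where "smooth_on UNIV \<eta>" "\<And>x. x \<in> cball a r \<Longrightarrow> \<eta> x = 1" "\<And>x. x \<notin> ball a (2 * r) \<Longrightarrow> \<eta> x = 0"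
    "\<And>x. 0 \<le> \<eta> x" "\<And>x. \<eta> x \<le> 1"
proof
  let ?s = "\<lambda>x. (x - a) \<bullet> (x - a)"
  let ?p = "\<lambda>x. flat 0 (4 * r\<^sup>2 - ?s x)" and ?q = "\<lambda>x. flat 0 (?s x - r\<^sup>2)"
  define \<eta> where "\<eta> x = ?p x * inverse (?p x + ?q x)" for x
  have s: "smooth_on UNIV ?s"
    by (intro smooth_on_inner smooth_on_diff smooth_on_id smooth_on_const)
  have comp: "smooth_on UNIV (\<lambda>x. flat 0 (f x))" if "smooth_on UNIV f" for f :: "'a \<Rightarrow> real"
    by (rule smooth_on_compose[OF that smooth_on_open[OF open_UNIV Ck_on_flat]]) auto
  have nonneg: "0 \<le> flat 0 t" for t by (simp add: flat_def)
  have fpos: "0 < flat 0 t \<longleftrightarrow> 0 < t" for t by (simp add: flat_def)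
  have pos: "0 < ?p x + ?q x" for x
  proof (cases "?s x < 4 * r\<^sup>2")
    case True then show ?thesis using nonneg[of "?s x - r\<^sup>2"] fpos[of "4 * r\<^sup>2 - ?s x"] by linarith
  next
    case False
    moreover have "0 < r\<^sup>2" using r by simp
    ultimately have "0 < ?s x - r\<^sup>2" by linarith
    then show ?thesis using nonneg[of "4 * r\<^sup>2 - ?s x"] fpos[of "?s x - r\<^sup>2"] by linarith
  qed
  show "smooth_on UNIV \<eta>" unfolding \<eta>_def
    by (intro smooth_on_mult smooth_on_inverse smooth_on_add comp smooth_on_diff smooth_on_const s) (use pos in \<open>auto simp: less_le\<close>)
  show "0 \<le> \<eta> x" for x using pos[of x] nonneg by (simp add: \<eta>_def)
  show "\<eta> x \<le> 1" for x using pos[of x] nonneg by (simp add: \<eta>_def field_simps)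
  have sq: "?s x = (dist a x)\<^sup>2" for x by (simp add: dist_norm power2_norm_eq_inner inner_diff_left inner_diff_right inner_commute)
  show "\<eta> x = 1" if "x \<in> cball a r" for x
  proof -
    have "?s x \<le> r\<^sup>2" using that r unfolding sq by (intro power_mono) auto
    then have "?q x = 0" by (simp add: flat_def)
    then show ?thesis using pos[of x] by (simp add: \<eta>_def)
  qed
  show "\<eta> x = 0" if "x \<notin> ball a (2 * r)" for x
  proof -
    have "(2 * r)\<^sup>2 \<le> ?s x" using that r unfolding sq by (intro power_mono) auto
    then have "?p x = 0" by (simp add: flat_def power_mult_distrib)
    then show ?thesis by (simp add: \<eta>_def)
  qed
qed

lemma smooth_on_UNIV_has_derivative:
  assumes "smooth_on UNIV f"
  shows "(f has_derivative fderiv f x) (at x)"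
proof -
  obtain W h where W: "open W" "x \<in> W" "\<forall>m. Ck_on m W h" "\<forall>y. y \<in> UNIV \<longrightarrow> y \<in> W \<longrightarrow> h y = f y"
    using smooth_onD[OF assms UNIV_I[of x]] by (elim exE conjE)
  have "(h has_derivative fderiv h x) (at x)"
    using Ck_on_deriv[OF W(3)[rule_format, of "Suc 0"] W(2)] .
  then have "(f has_derivative fderiv h x) (at x)"
    by (rule has_derivative_transform_within_open[OF _ W(1,2)]) (use W(4) in auto)
  then show ?thesis using frechet_derivative_works differentiableI by blast
qed

lemma smooth_on_UNIV_continuous_derivative:
  assumes "smooth_on UNIV f"
  shows "continuous_on UNIV (\<lambda>x. fderiv f x v)"
proof -
  have "isCont (\<lambda>x. fderiv f x v) x" for x
  proof -
    obtain W h where W: "open W" "x \<in> W" "\<forall>m. Ck_on m W h" "\<forall>y. y \<in> UNIV \<longrightarrow> y \<in> W \<longrightarrow> h y = f y"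
      using smooth_onD[OF assms UNIV_I[of x]] by (elim exE conjE)
    have "Ck_on 1 W f" by (rule Ck_on_cong[OF W(1) _ W(3)[rule_format]]) (use W(4) in auto)
    then have "continuous_on W (\<lambda>x. fderiv f x v)" by simp
    then show ?thesis using W by (simp add: continuous_on_eq_continuous_at)
  qed
  then show ?thesis by (simp add: continuous_at_imp_continuous_on)
qed

text \<open>The derivative is bounded on the compact ball by continuity and vanishes off it; the
  mean value inequality turns this into a Lipschitz bound.\<close>

lemma compact_support_lipschitz:
  fixes \<eta> :: "'a::euclidean_space \<Rightarrow> real"
  assumes \<eta>: "smooth_on UNIV \<eta>" and supp: "\<And>x. x \<notin> cball a r \<Longrightarrow> \<eta> x = 0"
  obtains L where "L > 0" "\<And>x v. \<bar>fderiv \<eta> x v\<bar> \<le> L * norm v" "\<And>x y. \<bar>\<eta> x - \<eta> y\<bar> \<le> L * norm (x - y)"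
proof -
  let ?D = "\<lambda>x. fderiv \<eta> x"
  have lin: "linear (?D x)" for x using smooth_on_UNIV_has_derivative[OF \<eta>] has_derivative_linear by blast
  have "continuous_on UNIV (\<lambda>x. \<Sum>b\<in>Basis. \<bar>?D x b\<bar>)"
    by (intro continuous_on_sum continuous_on_rabs smooth_on_UNIV_continuous_derivative[OF \<eta>])
  then have "compact ((\<lambda>x. \<Sum>b\<in>Basis. \<bar>?D x b\<bar>) ` cball a r)"
    by (intro compact_continuous_image) (auto intro: continuous_on_subset)
  from bounded_imp_bdd_above[OF compact_imp_bounded[OF this]]
  obtain L where L: "\<forall>x\<in>cball a r. (\<Sum>b\<in>Basis. \<bar>?D x b\<bar>) \<le> L"
    unfolding bdd_above_def ball_simps by (elim exE)
  \<comment> \<open>Taking the maximum with 1 makes the constant strictly positive.\<close>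
  have D: "\<bar>?D x v\<bar> \<le> max L 1 * norm v" for x v
  proof (cases "x \<in> cball a r")
    case True
    have "?D x v = ?D x (\<Sum>b\<in>Basis. (v \<bullet> b) *\<^sub>R b)" by (simp add: euclidean_representation)
    also have "\<dots> = (\<Sum>b\<in>Basis. (v \<bullet> b) * ?D x b)" by (simp add: linear_sum[OF lin] linear_cmul[OF lin])
    finally have "\<bar>?D x v\<bar> \<le> (\<Sum>b\<in>Basis. \<bar>v \<bullet> b\<bar> * \<bar>?D x b\<bar>)"
      using sum_abs[of "\<lambda>b. (v \<bullet> b) * ?D x b" Basis] by (simp add: abs_mult)
    also have "\<dots> \<le> (\<Sum>b\<in>Basis. norm v * \<bar>?D x b\<bar>)"
      by (intro sum_mono mult_right_mono Basis_le_norm) auto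
    also have "\<dots> \<le> norm v * L"
      unfolding sum_distrib_left[symmetric] using L True by (intro mult_left_mono) auto
    also have "\<dots> \<le> norm v * max L 1" by (intro mult_left_mono) auto
    finally show ?thesis by (simp add: mult.commute)
  next
    case False
    have "((\<lambda>x. 0) has_derivative (\<lambda>v. 0)) (at x)" by simp
    then have "(\<eta> has_derivative (\<lambda>v. 0)) (at x)"
      by (rule has_derivative_transform_within_open[where s="- cball a r"]) (use False supp in auto)
    then have "?D x = (\<lambda>v. 0)" using frechet_derivative_at by metis
    then show ?thesis by (simp add: mult_nonneg_nonneg)
  qed
  have "norm (\<eta> x - \<eta> y) \<le> max L 1 * norm (x - y)" for x y
  proof (rule differentiable_bound[where f'="?D" and S=UNIV])
    show "onorm (?D x) \<le> max L 1" for x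
      by (rule onorm_bound) (use D[of x] in auto)
  qed (use smooth_on_UNIV_has_derivative[OF \<eta>] in auto)
  with D show thesis by (intro that[of "max L 1"]) auto
qed

text \<open>The constant \<open>L\<close> controls differences as well as derivatives: the first
  yields injectivity of the displaced identity, the second invertibility of its
  differential.\<close>

definition cutoff :: "'a::euclidean_space \<Rightarrow> real \<Rightarrow> ('a \<Rightarrow> real) \<Rightarrow> real \<Rightarrow> bool" where
  "cutoff a r \<eta> L \<longleftrightarrow> 0 < L \<and> smooth_on UNIV \<eta> \<and> (\<forall>x\<in>cball a r. \<eta> x = 1) \<and> (\<forall>x. x \<notin> ball a (2 * r) \<longrightarrow> \<eta> x = 0)
     \<and> (\<forall>x. 0 \<le> \<eta> x \<and> \<eta> x \<le> 1) \<and> (\<forall>x w. \<bar>fderiv \<eta> x w\<bar> \<le> L * norm w)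
     \<and> (\<forall>x y. \<bar>\<eta> x - \<eta> y\<bar> \<le> L * norm (x - y))"

lemma exists_cutoff:
  fixes a :: "'a::euclidean_space"
  assumes "0 < r" shows "\<exists>\<eta> L. cutoff a r \<eta> L"
proof -
  obtain \<eta> :: "'a \<Rightarrow> real" where \<eta>: "smooth_on UNIV \<eta>" "\<And>x. x \<in> cball a r \<Longrightarrow> \<eta> x = 1" "\<And>x. x \<notin> ball a (2 * r) \<Longrightarrow> \<eta> x = 0"
    "\<And>x. 0 \<le> \<eta> x" "\<And>x. \<eta> x \<le> 1" using smooth_bump[OF assms, of a] by blast
  have supp: "\<eta> x = 0" if "x \<notin> cball a (2 * r)" for x using that by (intro \<eta>(3)) auto
  obtain L where "L > 0" "\<And>x w. \<bar>fderiv \<eta> x w\<bar> \<le> L * norm w" "\<And>x y. \<bar>\<eta> x - \<eta> y\<bar> \<le> L * norm (x - y)"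
    using compact_support_lipschitz[OF \<eta>(1) supp] by blast
  with \<eta> show ?thesis unfolding cutoff_def by blast
qed

subsection \<open>Removing critical points\<close>

lemma has_derivative_chain:
  assumes "hopen k S" "smooth_on S a" "x \<in> S" "hopen l T" "smooth_on T b" "a ` S \<subseteq> T"
  shows "((\<lambda>x. b (a x)) has_derivative (\<lambda>v. dd T b (dd S a v x) (a x))) (at x within S)"
proof (rule has_derivative_in_compose[OF has_derivative_dd[OF assms(1-3)]])
  have "a x \<in> T" using assms by auto
  then show "(b has_derivative (\<lambda>v. dd T b v (a x))) (at (a x) within a ` S)"
    by (rule has_derivative_subset[OF has_derivative_dd[OF assms(4,5)] assms(6)])
qed

lemma dd_chain:
  assumes "hopen k S" "smooth_on S a" "x \<in> S" "hopen l T" "smooth_on T b" "a ` S \<subseteq> T"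
  shows "dd S (\<lambda>x. b (a x)) v x = dd T b (dd S a v x) (a x)"
  by (rule dd_eqI[OF has_derivative_chain[OF assms] assms(1,3)])

lemma dd_subset:
  assumes "hopen k S" "hopen k T" "T \<subseteq> S" "smooth_on S f" "x \<in> T"
  shows "dd T f v x = dd S f v x"
proof -
  have "x \<in> S" using assms(3,5) by auto
  from has_derivative_subset[OF has_derivative_dd[OF assms(1,4) this] assms(3)]
  show ?thesis by (rule dd_eqI[OF _ assms(2,5)])
qed

lemma smooth_on_local_hopen:
  assumes "\<And>x. x \<in> S \<Longrightarrow> \<exists>T h. hopen k T \<and> x \<in> T \<and> smooth_on T h \<and> (\<forall>y\<in>T. f y = h y)" and "S \<subseteq> halfspace k"
  shows "smooth_on S f"
proof (rule smooth_on_local)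
  fix x assume x: "x \<in> S"
  obtain T h where T: "hopen k T" "x \<in> T" "smooth_on T h" "\<forall>y\<in>T. f y = h y"
    using assms(1)[OF x] by (elim exE conjE)
  obtain U where U: "open U" "T = halfspace k \<inter> U" using T(1) by (auto simp: openin_open)
  then have sub: "S \<inter> U \<subseteq> T" using assms(2) by auto
  show "\<exists>U g. open U \<and> x \<in> U \<and> smooth_on (S \<inter> U) g \<and> (\<forall>y\<in>S \<inter> U. f y = g y)"
    using U T(2,4) sub smooth_on_subset[OF T(3) sub] by (intro exI[of _ U] exI[of _ h] conjI) auto
qed

section \<open>Charts and critical points\<close>

abbreviation "local_rep f c \<equiv> \<lambda>x. f (chart_inv c x)"

locale compact_manifold =
  fixes k :: "'n::finite" and M :: "'a::t2_space set" and \<A> :: "('a, 'n) chart set"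
  assumes mfd: "smooth_manifold_with_boundary k M \<A>" and cpt: "compact M"
begin

lemma is_chart: "c \<in> \<A> \<Longrightarrow> is_chart k M c"
  using mfd by (simp add: smooth_manifold_with_boundary_def)

lemma chart_homeo: "c \<in> \<A> \<Longrightarrow> homeomorphism (fst c) (chart_image c) (snd c) (chart_inv c)"
  using is_chart by (simp add: is_chart_def)

lemma openin_chart: "c \<in> \<A> \<Longrightarrow> openin (top_of_set M) (fst c)"
  using is_chart by (simp add: is_chart_def)

lemma chart_sub: "c \<in> \<A> \<Longrightarrow> fst c \<subseteq> M"
  by (rule openin_imp_subset[OF openin_chart])

lemma hopen_image: "c \<in> \<A> \<Longrightarrow> hopen k (chart_image c)"
  using is_chart by (simp add: is_chart_def)

lemma image_sub: "c \<in> \<A> \<Longrightarrow> chart_image c \<subseteq> halfspace k"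
  by (rule openin_imp_subset[OF hopen_image])

lemma chart_in: "p \<in> fst c \<Longrightarrow> snd c p \<in> chart_image c"
  by (simp add: chart_image_def)

lemma inv_chart: "c \<in> \<A> \<Longrightarrow> p \<in> fst c \<Longrightarrow> chart_inv c (snd c p) = p"
  by (rule homeomorphism_apply1[OF chart_homeo])

lemma chart_inv: "c \<in> \<A> \<Longrightarrow> x \<in> chart_image c \<Longrightarrow> snd c (chart_inv c x) = x"
  by (rule homeomorphism_apply2[OF chart_homeo])

lemma inv_in: "c \<in> \<A> \<Longrightarrow> x \<in> chart_image c \<Longrightarrow> chart_inv c x \<in> fst c"
  using homeomorphism_image2[OF chart_homeo] by blast

lemma cont_chart: "c \<in> \<A> \<Longrightarrow> continuous_on (fst c) (snd c)"
  by (rule homeomorphism_cont1[OF chart_homeo])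

lemma cont_inv: "c \<in> \<A> \<Longrightarrow> continuous_on (chart_image c) (chart_inv c)"
  by (rule homeomorphism_cont2[OF chart_homeo])

lemma exists_chart: "p \<in> M \<Longrightarrow> \<exists>c\<in>\<A>. p \<in> fst c"
  using mfd by (auto simp: smooth_manifold_with_boundary_def)

lemma overlap_iff: "c \<in> \<A> \<Longrightarrow> x \<in> overlap c d \<longleftrightarrow> x \<in> chart_image c \<and> chart_inv c x \<in> fst d"
  by (auto simp: overlap_def inv_chart chart_in) (metis IntI chart_inv inv_in image_eqI)

lemma hopen_overlap:
  assumes "c \<in> \<A>" "d \<in> \<A>" shows "hopen k (overlap c d)"
proof -
  have "chart_inv c \<in> chart_image c \<rightarrow> M" using inv_in[OF assms(1)] chart_sub[OF assms(1)] by auto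
  then have "openin (top_of_set (chart_image c)) (chart_image c \<inter> chart_inv c -` fst d)"
    by (rule continuous_openin_preimage[OF cont_inv[OF assms(1)] _ openin_chart[OF assms(2)]])
  moreover have "overlap c d = chart_image c \<inter> chart_inv c -` fst d"
    using overlap_iff[OF assms(1), of _ d] by blast
  ultimately show ?thesis using openin_trans hopen_image[OF assms(1)] by metis
qed

lemma smooth_trans:
  assumes "c \<in> \<A>" "d \<in> \<A>" shows "smooth_on (overlap c d) (\<lambda>x. snd d (chart_inv c x))"
proof -
  have "smooth_on (overlap c d) (transition c d)"
    using mfd assms unfolding smooth_manifold_with_boundary_def by blast
  then show ?thesis unfolding transition_def o_def .
qed

lemma trans_in: "c \<in> \<A> \<Longrightarrow> d \<in> \<A> \<Longrightarrow> x \<in> overlap c d \<Longrightarrow> snd d (chart_inv c x) \<in> chart_image d"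
  by (simp add: overlap_iff chart_in)

lemma smooth_fun_rep:
  assumes "smooth_function \<A> f" "c \<in> \<A>" shows "smooth_on (chart_image c) (local_rep f c)"
proof -
  have "smooth_on (chart_image c) (f \<circ> chart_inv c)"
    using assms unfolding smooth_function_def by blast
  then show ?thesis unfolding o_def .
qed

definition crit :: "('a, 'n) chart \<Rightarrow> ('a \<Rightarrow> real) \<Rightarrow> real^'n \<Rightarrow> bool" where
  "crit c f x \<longleftrightarrow> (\<forall>v. dd (chart_image c) (local_rep f c) v x = 0)"

definition Crit :: "('a \<Rightarrow> real) \<Rightarrow> 'a set" where
  "Crit f = {p. \<exists>c\<in>\<A>. p \<in> fst c \<and> crit c f (snd c p)}"

lemma Crit_sub: "Crit f \<subseteq> M"
  using chart_sub by (auto simp: Crit_def)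

text \<open>On the overlap one local representation is the other one composed with the transition
  map, so the chain rule carries a zero differential over.\<close>

lemma crit_transfer:
  assumes c: "c \<in> \<A>" and d: "d \<in> \<A>" and f: "smooth_function \<A> f"
    and p: "p \<in> fst c" "p \<in> fst d" and cr: "crit d f (snd d p)"
  shows "crit c f (snd c p)"
  unfolding crit_def
proof
  fix v
  let ?O = "overlap c d" and ?x = "snd c p" and ?t = "\<lambda>x. snd d (chart_inv c x)"
  have x: "?x \<in> ?O" using p by (auto simp: overlap_def)
  have tx: "?t ?x = snd d p" by (simp add: inv_chart[OF c p(1)])
  have sub: "?O \<subseteq> chart_image c" using overlap_iff[OF c] by blast
  have "dd (chart_image c) (local_rep f c) v ?x = dd ?O (local_rep f c) v ?x"
    by (rule dd_subset[OF hopen_image[OF c] hopen_overlap[OF c d] sub smooth_fun_rep[OF f c] x, symmetric])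
  also have "\<dots> = dd ?O (\<lambda>x. f (chart_inv d (?t x))) v ?x"
  proof (rule dd_cong[OF x])
    fix y assume "y \<in> ?O"
    then have "chart_inv c y \<in> fst d" using overlap_iff[OF c] by blast
    then show "f (chart_inv c y) = f (chart_inv d (?t y))" by (simp add: inv_chart[OF d])
  qed
  also have "\<dots> = dd (chart_image d) (local_rep f d) (dd ?O ?t v ?x) (?t ?x)"
    by (rule dd_chain[OF hopen_overlap[OF c d] smooth_trans[OF c d] x hopen_image[OF d] smooth_fun_rep[OF f d]])
      (use trans_in[OF c d] in blast)
  also have "\<dots> = 0" using cr unfolding tx crit_def by blast
  finally show "dd (chart_image c) (local_rep f c) v ?x = 0" .
qed

lemma Crit_chart:
  assumes "c \<in> \<A>" "smooth_function \<A> f" "p \<in> fst c"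
  shows "p \<in> Crit f \<longleftrightarrow> crit c f (snd c p)"
  using crit_transfer[OF assms(1) _ assms(2,3)] assms(1,3) by (auto simp: Crit_def)

text \<open>The part of \<open>M\<close> over \<open>K\<close> is compact, hence closed in a
  Hausdorff space, so a point outside the chart domain has a neighbourhood avoiding it. This lets
  data given in one chart be extended smoothly to all of \<open>M\<close>.\<close>

lemma outside_nbhd:
  assumes c: "c \<in> \<A>" and d: "d \<in> \<A>" and K: "compact K" "K \<subseteq> chart_image c"
    and x: "x \<in> chart_image d" "chart_inv d x \<notin> fst c"
  shows "\<exists>T. hopen k T \<and> T \<subseteq> chart_image d \<and> x \<in> T \<and> (\<forall>y\<in>T. chart_inv d y \<in> fst c \<longrightarrow> snd c (chart_inv d y) \<notin> K)"
proof -
  have "compact (chart_inv c ` K)"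
    using K continuous_on_subset[OF cont_inv[OF c]] by (intro compact_continuous_image) auto
  then have "open (- (chart_inv c ` K))" by (intro open_Compl compact_imp_closed)
  then have "openin (top_of_set (chart_image d)) (chart_image d \<inter> chart_inv d -` (- (chart_inv c ` K)))"
    by (rule continuous_openin_preimage_gen[OF cont_inv[OF d]])
  from openin_trans[OF this hopen_image[OF d]]
  have T: "hopen k (chart_image d \<inter> chart_inv d -` (- (chart_inv c ` K)))" .
  have "chart_inv d x \<notin> chart_inv c ` K" using x(2) inv_in[OF c] K(2) by auto
  moreover have "snd c (chart_inv d y) \<notin> K" if "chart_inv d y \<notin> chart_inv c ` K" "chart_inv d y \<in> fst c" for y
    using that inv_chart[OF c that(2)] by (metis image_eqI)
  ultimately show ?thesis using T x(1)
    by (intro exI[of _ "chart_image d \<inter> chart_inv d -` (- (chart_inv c ` K))"]) auto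
qed

lemma smooth_patch:
  assumes c: "c \<in> \<A>" and f: "smooth_function \<A> f" and K: "compact K" "K \<subseteq> chart_image c"
    and a: "smooth_on (chart_image c) a" "\<And>x. x \<in> chart_image c \<Longrightarrow> x \<notin> K \<Longrightarrow> a x = f (chart_inv c x)"
  shows "smooth_function \<A> (\<lambda>p. if p \<in> fst c then a (snd c p) else f p)" (is "smooth_function \<A> ?F")
  unfolding smooth_function_def
proof
  fix d assume d: "d \<in> \<A>"
  show "smooth_on (chart_image d) (?F \<circ> chart_inv d)"
  proof (rule smooth_on_local_hopen[OF _ image_sub[OF d]])
    fix x assume x: "x \<in> chart_image d"
    show "\<exists>T h. hopen k T \<and> x \<in> T \<and> smooth_on T h \<and> (\<forall>y\<in>T. (?F \<circ> chart_inv d) y = h y)"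
    proof (cases "chart_inv d x \<in> fst c")
      case True
      have "smooth_on (overlap d c) (\<lambda>x. a (snd c (chart_inv d x)))"
        by (rule smooth_on_compose[OF smooth_trans[OF d c] a(1)]) (use trans_in[OF d c] in blast)
      moreover have "(?F \<circ> chart_inv d) y = a (snd c (chart_inv d y))" if "y \<in> overlap d c" for y
        using that overlap_iff[OF d] by simp
      moreover have "x \<in> overlap d c" using x True overlap_iff[OF d] by blast
      ultimately show ?thesis using hopen_overlap[OF d c]
        by (intro exI[of _ "overlap d c"] exI[of _ "\<lambda>x. a (snd c (chart_inv d x))"] conjI) auto
    next
      case False
      obtain T where T: "hopen k T" "T \<subseteq> chart_image d" "x \<in> T" "\<forall>y\<in>T. chart_inv d y \<in> fst c \<longrightarrow> snd c (chart_inv d y) \<notin> K"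
        using outside_nbhd[OF c d K x False] by (elim exE conjE)
      have "(?F \<circ> chart_inv d) y = f (chart_inv d y)" if "y \<in> T" for y
        using T(4) that a(2)[of "snd c (chart_inv d y)"] by (auto simp: chart_in inv_chart[OF c])
      then show ?thesis using T(1,3) smooth_on_subset[OF smooth_fun_rep[OF f d] T(2)]
        by (intro exI[of _ T] exI[of _ "\<lambda>x. f (chart_inv d x)"] conjI) auto
    qed
  qed
qed

text \<open>Speaking only about the effect on functions avoids a notion of smooth map between manifolds.\<close>

definition push_map :: "('a \<Rightarrow> 'a) \<Rightarrow> bool" where
  "push_map \<Phi> \<longleftrightarrow> \<Phi> ` M \<subseteq> M \<and> inj_on \<Phi> M \<and>
     (\<forall>f. smooth_function \<A> f \<longrightarrow> smooth_function \<A> (f \<circ> \<Phi>) \<and> \<Phi> ` Crit (f \<circ> \<Phi>) \<subseteq> Crit f)"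

lemma push_map_comp:
  assumes "push_map \<Phi>" "push_map \<Psi>" shows "push_map (\<Psi> \<circ> \<Phi>)"
  unfolding push_map_def
proof (intro conjI allI impI)
  show "(\<Psi> \<circ> \<Phi>) ` M \<subseteq> M" "inj_on (\<Psi> \<circ> \<Phi>) M"
    using assms by (auto simp: push_map_def intro: comp_inj_on inj_on_subset)
  fix f assume "smooth_function \<A> f"
  then have "smooth_function \<A> (f \<circ> \<Psi>)" "\<Psi> ` Crit (f \<circ> \<Psi>) \<subseteq> Crit f"
    using assms(2) unfolding push_map_def by blast+
  moreover from this(1) have "smooth_function \<A> ((f \<circ> \<Psi>) \<circ> \<Phi>)" "\<Phi> ` Crit ((f \<circ> \<Psi>) \<circ> \<Phi>) \<subseteq> Crit (f \<circ> \<Psi>)"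
    using assms(1) unfolding push_map_def by blast+
  ultimately show "smooth_function \<A> (f \<circ> (\<Psi> \<circ> \<Phi>))" "(\<Psi> \<circ> \<Phi>) ` Crit (f \<circ> (\<Psi> \<circ> \<Phi>)) \<subseteq> Crit f"
    by (auto simp: o_assoc)
qed

text \<open>Inside the chart the chain rule applies, and surjectivity of the differential of
  \<open>E\<close> turns a critical point of the composition into one of \<open>f\<close> at the
  image. Outside the chart the map is locally the identity.\<close>

lemma push_mapI:
  assumes c: "c \<in> \<A>" and K: "compact K" "K \<subseteq> chart_image c"
    and E: "smooth_on (chart_image c) E" "E ` chart_image c \<subseteq> chart_image c" "inj_on E (chart_image c)"
      "\<And>x. x \<in> chart_image c \<Longrightarrow> x \<notin> K \<Longrightarrow> E x = x"
      "\<And>x. x \<in> chart_image c \<Longrightarrow> surj (\<lambda>v. dd (chart_image c) E v x)"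
  shows "push_map (\<lambda>p. if p \<in> fst c then chart_inv c (E (snd c p)) else p)" (is "push_map ?\<Phi>")
  unfolding push_map_def
proof (intro conjI allI impI)
  have in_c: "?\<Phi> p \<in> fst c" if "p \<in> fst c" for p
  proof -
    have "E (snd c p) \<in> chart_image c" using chart_in[OF that] E(2) by (simp add: image_subset_iff)
    then show ?thesis using that inv_in[OF c] by simp
  qed
  show "?\<Phi> ` M \<subseteq> M" using in_c chart_sub[OF c] by (auto split: if_splits)
  show "inj_on ?\<Phi> M"
  proof (rule inj_onI)
    fix p q assume pq: "p \<in> M" "q \<in> M" "?\<Phi> p = ?\<Phi> q"
    show "p = q"
    proof (cases "p \<in> fst c")
      case True
      then have "q \<in> fst c" using in_c[of p] pq(3) by metis
      then have "chart_inv c (E (snd c p)) = chart_inv c (E (snd c q))" using True pq by simp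
      then have "E (snd c p) = E (snd c q)"
        using chart_inv[OF c] E(2) chart_in True \<open>q \<in> fst c\<close> by (metis image_subset_iff)
      then have "snd c p = snd c q" using E(3) chart_in True \<open>q \<in> fst c\<close> by (metis inj_onD)
      then show ?thesis using inv_chart[OF c] True \<open>q \<in> fst c\<close> by metis
    next
      case False
      then show ?thesis using in_c[of q] pq(3) by (metis (full_types))
    qed
  qed
  fix f assume f: "smooth_function \<A> f"
  have "smooth_function \<A> (\<lambda>p. if p \<in> fst c then f (chart_inv c (E (snd c p))) else f p)"
    by (rule smooth_patch[OF c f K, where a="\<lambda>x. f (chart_inv c (E x))"])
      (auto simp: E(4) intro: smooth_on_compose[OF E(1) smooth_fun_rep[OF f c] E(2)])
  moreover have eq: "f \<circ> ?\<Phi> = (\<lambda>p. if p \<in> fst c then f (chart_inv c (E (snd c p))) else f p)" by auto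
  ultimately show sm: "smooth_function \<A> (f \<circ> ?\<Phi>)" by simp
  show "?\<Phi> ` Crit (f \<circ> ?\<Phi>) \<subseteq> Crit f"
  proof (rule image_subsetI)
    fix p assume p: "p \<in> Crit (f \<circ> ?\<Phi>)"
    show "?\<Phi> p \<in> Crit f"
    proof (cases "p \<in> fst c")
      case True
      let ?x = "snd c p" and ?V = "chart_image c"
      have x: "?x \<in> ?V" by (rule chart_in[OF True])
      have cr: "crit c (f \<circ> ?\<Phi>) ?x" using Crit_chart[OF c sm True] p by blast
      have "dd ?V (local_rep f c) (dd ?V E v ?x) (E ?x) = 0" for v
      proof -
        have "dd ?V (local_rep f c) (dd ?V E v ?x) (E ?x) = dd ?V (\<lambda>x. f (chart_inv c (E x))) v ?x"
          by (rule dd_chain[OF hopen_image[OF c] E(1) x hopen_image[OF c] smooth_fun_rep[OF f c] E(2), symmetric])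
        also have "\<dots> = dd ?V (\<lambda>x. (f \<circ> ?\<Phi>) (chart_inv c x)) v ?x"
          by (rule dd_cong[OF x]) (simp add: inv_in[OF c] chart_inv[OF c])
        also have "\<dots> = 0" using cr unfolding crit_def by blast
        finally show ?thesis .
      qed
      note zero = this
      have "crit c f (E ?x)" unfolding crit_def
      proof
        fix w
        from surjD[OF E(5)[OF x], of w] obtain v where "w = dd ?V E v ?x" by (elim exE)
        then show "dd ?V (local_rep f c) w (E ?x) = 0" using zero[of v] by simp
      qed
      moreover have "snd c (?\<Phi> p) = E ?x" using True x E(2) chart_inv[OF c] by auto
      ultimately show ?thesis using Crit_chart[OF c f in_c[OF True]] by simp
    next
      case False
      have "p \<in> M" using p Crit_sub by auto
      then obtain d where d: "d \<in> \<A>" "p \<in> fst d" using exists_chart by blast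
      let ?x = "snd d p" and ?V = "chart_image d"
      have "chart_inv d ?x \<notin> fst c" using False inv_chart[OF d] by simp
      from outside_nbhd[OF c d(1) K chart_in[OF d(2)] this]
      obtain T where T: "hopen k T" "T \<subseteq> ?V" "?x \<in> T" "\<forall>y\<in>T. chart_inv d y \<in> fst c \<longrightarrow> snd c (chart_inv d y) \<notin> K"
        by (elim exE conjE)
      have same: "(f \<circ> ?\<Phi>) (chart_inv d y) = f (chart_inv d y)" if "y \<in> T" for y
        using T(4) that E(4)[of "snd c (chart_inv d y)"] by (auto simp: chart_in inv_chart[OF c])
      have "dd ?V (local_rep f d) v ?x = 0" for v
      proof -
        have "dd ?V (local_rep f d) v ?x = dd T (local_rep f d) v ?x"
          by (rule dd_subset[OF hopen_image[OF d(1)] T(1,2) smooth_fun_rep[OF f d(1)] T(3), symmetric])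
        also have "\<dots> = dd T (\<lambda>x. (f \<circ> ?\<Phi>) (chart_inv d x)) v ?x"
          by (rule dd_cong[OF T(3)]) (rule same[symmetric])
        also have "\<dots> = dd ?V (\<lambda>x. (f \<circ> ?\<Phi>) (chart_inv d x)) v ?x"
          by (rule dd_subset[OF hopen_image[OF d(1)] T(1,2) smooth_fun_rep[OF sm d(1)] T(3)])
        also have "\<dots> = 0" using p Crit_chart[OF d(1) sm d(2)] unfolding crit_def by blast
        finally show ?thesis .
      qed
      then have "p \<in> Crit f" using Crit_chart[OF d(1) f d(2)] unfolding crit_def by blast
      then show ?thesis using False by simp
    qed
  qed
qed

end

section \<open>Local pushes and avoidable points\<close>

lemma closed_halfspace: "closed (halfspace k)"
  unfolding halfspace_def by (intro closed_Collect_le continuous_intros)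

context compact_manifold
begin

text \<open>In the chart a translation by \<open>v\<close> where \<open>\<eta>\<close> is 1, fading
  out to the identity.\<close>

definition bump_push :: "('a, 'n) chart \<Rightarrow> (real^'n \<Rightarrow> real) \<Rightarrow> real^'n \<Rightarrow> 'a \<Rightarrow> 'a" where
  "bump_push c \<eta> v p = (if p \<in> fst c then chart_inv c (snd c p + \<eta> (snd c p) *\<^sub>R v) else p)"

text \<open>The bound by \<open>r\<close> keeps displaced points in the ball of radius
  \<open>3 * r\<close>. The bound on \<open>L * norm v\<close> makes the displacement a contraction
  by 1/2, so the map and its differential are injective. The last condition keeps the image in the
  half-space: either the push points inwards or the ball stays clear of the outside.\<close>

lemma push_map_bump_push:
  assumes c: "c \<in> \<A>" and r: "0 < r" "cball a (3 * r) \<inter> halfspace k \<subseteq> chart_image c"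
    and cut: "cutoff a r \<eta> L"
    and v: "norm v \<le> r" "L * norm v \<le> 1/2" "0 \<le> v $ k \<or> cball a (3 * r) \<subseteq> halfspace k"
  shows "push_map (bump_push c \<eta> v)"
proof -
  have \<eta>: "smooth_on UNIV \<eta>" "\<And>x. x \<notin> ball a (2 * r) \<Longrightarrow> \<eta> x = 0" "\<And>x. 0 \<le> \<eta> x" "\<And>x. \<eta> x \<le> 1"
    and L: "\<And>x w. \<bar>fderiv \<eta> x w\<bar> \<le> L * norm w" "\<And>x y. \<bar>\<eta> x - \<eta> y\<bar> \<le> L * norm (x - y)"
    using cut unfolding cutoff_def by blast+
  let ?V = "chart_image c" and ?E = "\<lambda>x. x + \<eta> x *\<^sub>R v"
  have E_in: "?E x \<in> ?V" if x: "x \<in> ?V" for x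
  proof (cases "x \<in> ball a (2 * r)")
    case True
    have "norm (\<eta> x *\<^sub>R v) \<le> 1 * r"
      unfolding norm_scaleR using \<eta>(3,4)[of x] v(1) by (intro mult_mono) auto
    moreover have "dist a (?E x) \<le> dist a x + norm (\<eta> x *\<^sub>R v)"
      using dist_triangle[of a "?E x" x] by (simp add: dist_norm)
    ultimately have "?E x \<in> cball a (3 * r)" using True by simp
    moreover have "?E x \<in> halfspace k" if "0 \<le> v $ k"
      using that image_sub[OF c] x \<eta>(3)[of x] by (auto simp: halfspace_def)
    ultimately show ?thesis using v(3) r(2) by blast
  next
    case False then show ?thesis using \<eta>(2)[of x] x by simp
  qed
  have inj: "norm (?E x - ?E y) \<ge> norm (x - y) / 2" for x y
  proof -
    have "norm ((\<eta> x - \<eta> y) *\<^sub>R v) \<le> (L * norm (x - y)) * norm v"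
      unfolding norm_scaleR using L(2)[of x y] by (intro mult_right_mono) auto
    also have "\<dots> = (L * norm v) * norm (x - y)" by simp
    also have "\<dots> \<le> (1/2) * norm (x - y)" using v(2) by (intro mult_right_mono) auto
    finally have "norm ((\<eta> x - \<eta> y) *\<^sub>R v) \<le> norm (x - y) / 2" by simp
    moreover have "norm (x - y) \<le> norm (?E x - ?E y) + norm ((\<eta> x - \<eta> y) *\<^sub>R v)"
      using norm_triangle_ineq4[of "?E x - ?E y" "(\<eta> x - \<eta> y) *\<^sub>R v"] by (simp add: algebra_simps)
    ultimately show ?thesis by linarith
  qed
  have "push_map (\<lambda>p. if p \<in> fst c then chart_inv c (?E (snd c p)) else p)"
  proof (rule push_mapI[OF c, where K="cball a (2 * r) \<inter> halfspace k"])
    show "compact (cball a (2 * r) \<inter> halfspace k)" using closed_halfspace by (intro compact_Int_closed) auto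
    show "cball a (2 * r) \<inter> halfspace k \<subseteq> ?V" using r by auto
    show "smooth_on ?V ?E"
      by (intro smooth_on_add smooth_on_id smooth_on_scaleR smooth_on_const smooth_on_subset[OF \<eta>(1)]) auto
    show "?E ` ?V \<subseteq> ?V" using E_in by blast
    show "inj_on ?E ?V"
    proof (rule inj_onI)
      fix x y assume "?E x = ?E y"
      then show "x = y" using inj[of x y] by simp
    qed
    show "?E x = x" if "x \<in> ?V" "x \<notin> cball a (2 * r) \<inter> halfspace k" for x
    proof -
      have "x \<notin> ball a (2 * r)" using that image_sub[OF c] by auto
      then show ?thesis using \<eta>(2) by simp
    qed
    show "surj (\<lambda>w. dd ?V ?E w x)" if x: "x \<in> ?V" for x
    proof -
      let ?D = "\<lambda>w. w + fderiv \<eta> x w *\<^sub>R v"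
      have d\<eta>: "(\<eta> has_derivative fderiv \<eta> x) (at x)"
        by (rule smooth_on_UNIV_has_derivative[OF \<eta>(1)])
      then have "(?E has_derivative ?D) (at x within ?V)"
        by (intro has_derivative_add has_derivative_ident has_derivative_scaleR_left has_derivative_at_withinI[OF d\<eta>])
      then have eq: "(\<lambda>w. dd ?V ?E w x) = ?D" using dd_eqI[OF _ hopen_image[OF c] x] by blast
      have lin: "linear ?D"
        using has_derivative_linear[OF d\<eta>] by (auto intro!: linearI simp: linear_add linear_cmul algebra_simps)
      moreover have "inj ?D"
      proof (rule linear_injective_0[OF lin, THEN iffD2], intro allI impI)
        fix w assume "?D w = 0"
        then have "norm w = norm (fderiv \<eta> x w *\<^sub>R v)"
          by (metis add_eq_0_iff norm_minus_cancel)
        also have "\<dots> \<le> (L * norm w) * norm v"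
          unfolding norm_scaleR using L(1)[of x w] by (intro mult_right_mono) auto
        also have "\<dots> = (L * norm v) * norm w" by simp
        also have "\<dots> \<le> (1/2) * norm w" using v(2) by (intro mult_right_mono) auto
        finally show "w = 0" by simp
      qed
      ultimately show ?thesis unfolding eq by (rule linear_inj_imp_surj)
    qed
  qed
  then show ?thesis by (simp add: bump_push_def[abs_def])
qed

lemma chart_ball:
  assumes "c \<in> \<A>" "p \<in> fst c"
  obtains r where "0 < r" "cball (snd c p) r \<inter> halfspace k \<subseteq> chart_image c"
  using hopen_image[OF assms(1)] chart_in[OF assms(2)] unfolding openin_contains_cball by blast

definition avoidable :: "'a \<Rightarrow> bool" where
  "avoidable p \<longleftrightarrow> (\<exists>\<Phi>. push_map \<Phi> \<and> p \<notin> \<Phi> ` M)"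

text \<open>If \<open>\<Psi>\<close> misses \<open>q\<close>, then \<open>\<Phi>\<close> after
  \<open>\<Psi>\<close> misses \<open>\<Phi> q\<close>, because \<open>\<Phi>\<close> is
  injective.\<close>

lemma avoidable_image:
  assumes "avoidable q" "push_map \<Phi>" "q \<in> M" shows "avoidable (\<Phi> q)"
proof -
  obtain \<Psi> where \<Psi>: "push_map \<Psi>" "q \<notin> \<Psi> ` M" using assms(1) unfolding avoidable_def by blast
  have "\<Phi> q \<notin> (\<Phi> \<circ> \<Psi>) ` M"
  proof
    assume "\<Phi> q \<in> (\<Phi> \<circ> \<Psi>) ` M"
    then obtain p where p: "p \<in> M" "\<Phi> q = \<Phi> (\<Psi> p)" by auto
    have "inj_on \<Phi> M" "\<Psi> p \<in> M" using assms(2) \<Psi>(1) p(1) by (auto simp: push_map_def)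
    then have "q = \<Psi> p" using p(2) assms(3) by (metis inj_onD)
    then show False using \<Psi>(2) p(1) by blast
  qed
  then show ?thesis using push_map_comp[OF \<Psi>(1) assms(2)] unfolding avoidable_def by blast
qed

lemma openin_chart_ball:
  assumes "c \<in> \<A>" shows "openin (top_of_set M) {q \<in> fst c. snd c q \<in> ball a r}"
proof -
  have "openin (top_of_set (fst c)) (fst c \<inter> snd c -` ball a r)"
    by (rule continuous_openin_preimage_gen[OF cont_chart[OF assms] open_ball])
  from openin_trans[OF this openin_chart[OF assms]] show ?thesis by (simp add: Int_def vimage_def)
qed

text \<open>After a push inwards by \<open>t\<close> every image point close to the boundary point
  has height at least \<open>t\<close>, whereas the points within distance \<open>t\<close> of it
  are lower.\<close>

lemma avoidable_near_boundary:
  assumes c: "c \<in> \<A>" and p: "p \<in> fst c" "snd c p $ k = 0"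
  shows "\<exists>T. openin (top_of_set M) T \<and> p \<in> T \<and> (\<forall>q\<in>T. avoidable q)"
proof -
  let ?a = "snd c p"
  obtain r0 where r0: "0 < r0" "cball ?a r0 \<inter> halfspace k \<subseteq> chart_image c" by (rule chart_ball[OF c p(1)])
  define r where "r = r0 / 3"
  have r: "0 < r" "cball ?a (3 * r) \<inter> halfspace k \<subseteq> chart_image c" using r0 by (auto simp: r_def)
  obtain \<eta> L where cut: "cutoff ?a r \<eta> L" using exists_cutoff[OF r(1)] by blast
  then have L: "L > 0" and \<eta>: "\<And>x. x \<in> cball ?a r \<Longrightarrow> \<eta> x = 1" "\<And>x. x \<notin> ball ?a (2 * r) \<Longrightarrow> \<eta> x = 0" "\<And>x. 0 \<le> \<eta> x" "\<And>x. \<eta> x \<le> 1"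
    unfolding cutoff_def by blast+
  define t where "t = min (r / 2) (1 / (2 * L))"
  have t: "0 < t" "t \<le> r / 2" "L * t \<le> 1/2"
  proof -
    show "0 < t" "t \<le> r / 2" using r L by (auto simp: t_def)
    have "L * t \<le> L * (1 / (2 * L))" using L by (intro mult_left_mono) (auto simp: t_def)
    then show "L * t \<le> 1/2" using L by simp
  qed
  let ?v = "t *\<^sub>R axis k 1 :: real^'n"
  have push: "push_map (bump_push c \<eta> ?v)"
    by (rule push_map_bump_push[OF c r cut]) (use t in auto)
  have "avoidable q" if q: "q \<in> fst c" "snd c q \<in> ball ?a t" for q
    unfolding avoidable_def
  proof (intro exI conjI)
    show "q \<notin> bump_push c \<eta> ?v ` M"
    proof
      assume "q \<in> bump_push c \<eta> ?v ` M"
      then obtain q' where q': "q = bump_push c \<eta> ?v q'" by auto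
      then have in_c: "q' \<in> fst c" using q(1) by (auto simp: bump_push_def split: if_splits)
      let ?x = "snd c q'"
      have "?x + \<eta> ?x *\<^sub>R ?v \<in> chart_image c"
      proof (cases "?x \<in> ball ?a (2 * r)")
        case True
        have "norm (\<eta> ?x *\<^sub>R ?v) \<le> 1 * t"
          using \<eta>(3,4)[of ?x] t by (simp add: mult_left_le_one_le)
        then have "dist ?a (?x + \<eta> ?x *\<^sub>R ?v) \<le> 3 * r"
          using True t dist_triangle[of ?a "?x + \<eta> ?x *\<^sub>R ?v" ?x] by (simp add: dist_norm)
        moreover have "?x + \<eta> ?x *\<^sub>R ?v \<in> halfspace k"
          using image_sub[OF c] chart_in[OF in_c] \<eta>(3)[of ?x] t by (auto simp: halfspace_def)
        ultimately show ?thesis using r(2) by auto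
      next
        case False then show ?thesis using \<eta>(2) chart_in[OF in_c] by simp
      qed
      then have x: "snd c q = ?x + \<eta> ?x *\<^sub>R ?v"
        using q' in_c chart_inv[OF c] by (simp add: bump_push_def)
      have "norm (\<eta> ?x *\<^sub>R ?v) \<le> t"
        using \<eta>(3,4)[of ?x] t by (simp add: mult_left_le_one_le)
      \<comment> \<open>The image is within \<open>t\<close> of the centre and was moved by at most
        \<open>t\<close>, and \<open>2 * t \<le> r\<close>; so the source lies where the cut-off is
        1 and received the full height.\<close>
      then have "dist ?a ?x \<le> r"
        using q(2) t x dist_triangle[of ?a ?x "snd c q"] by (simp add: dist_norm)
      then have "\<eta> ?x = 1" using \<eta>(1) by simp
      then have "t \<le> snd c q $ k"
        using x image_sub[OF c] chart_in[OF in_c] by (auto simp: halfspace_def)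
      moreover have "\<bar>(snd c q - ?a) $ k\<bar> < t"
        using component_le_norm_cart[of "snd c q - ?a" k] q(2) by (simp add: dist_norm norm_minus_commute)
      ultimately show False using p(2) by simp
    qed
  qed (rule push)
  then show ?thesis using openin_chart_ball[OF c, of ?a t] p(1) t(1)
    by (intro exI[of _ "{q \<in> fst c. snd c q \<in> ball ?a t}"]) auto
qed

text \<open>Any two nearby points are exchanged by a localized translation, and avoidability travels
  along push maps.\<close>

lemma avoidable_near_interior:
  assumes c: "c \<in> \<A>" and p: "p \<in> fst c" "0 < snd c p $ k"
  shows "\<exists>T. openin (top_of_set M) T \<and> p \<in> T \<and> (\<forall>q\<in>T. \<forall>q'\<in>T. avoidable q \<longrightarrow> avoidable q')"
proof -
  let ?a = "snd c p"
  obtain r0 where r0: "0 < r0" "cball ?a r0 \<inter> halfspace k \<subseteq> chart_image c" by (rule chart_ball[OF c p(1)])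
  \<comment> \<open>The height of the centre bounds \<open>3 * r\<close>, so the large ball stays in
    the half-space and pushes in all directions are allowed.\<close>
  define r where "r = min r0 (?a $ k) / 3"
  have r: "0 < r" "cball ?a (3 * r) \<inter> halfspace k \<subseteq> chart_image c" using r0 p(2) by (auto simp: r_def)
  have sub: "cball ?a (3 * r) \<subseteq> halfspace k"
  proof
    fix y assume "y \<in> cball ?a (3 * r)"
    then have "norm (?a - y) \<le> ?a $ k" by (simp add: r_def dist_norm)
    then show "y \<in> halfspace k" using component_le_norm_cart[of "?a - y" k] by (simp add: halfspace_def)
  qed
  obtain \<eta> L where cut: "cutoff ?a r \<eta> L" using exists_cutoff[OF r(1)] by blast
  then have L: "L > 0" and \<eta>: "\<And>x. x \<in> cball ?a r \<Longrightarrow> \<eta> x = 1" "\<And>x. x \<notin> ball ?a (2 * r) \<Longrightarrow> \<eta> x = 0" "\<And>x. 0 \<le> \<eta> x" "\<And>x. \<eta> x \<le> 1"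
    unfolding cutoff_def by blast+
  \<comment> \<open>The translation vector joins two points of a ball of radius \<open>t\<close> and
    may have length \<open>2 * t\<close>, hence the 4.\<close>
  define t where "t = min (r / 2) (1 / (4 * L))"
  have t: "0 < t" "t \<le> r / 2" "L * (2 * t) \<le> 1/2"
  proof -
    show "0 < t" "t \<le> r / 2" using r L by (auto simp: t_def)
    have "L * (2 * t) \<le> L * (2 * (1 / (4 * L)))" using L by (intro mult_left_mono) (auto simp: t_def)
    then show "L * (2 * t) \<le> 1/2" using L by simp
  qed
  have "avoidable q'" if q: "q \<in> fst c" "snd c q \<in> ball ?a t" and q': "q' \<in> fst c" "snd c q' \<in> ball ?a t" and av: "avoidable q" for q q'
  proof -
    let ?v = "snd c q' - snd c q"
    have nv: "norm ?v \<le> 2 * t"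
      using dist_triangle3[of "snd c q'" "snd c q" ?a] q(2) q'(2) by (simp add: dist_norm norm_minus_commute)
    then have "L * norm ?v \<le> L * (2 * t)" using L by (intro mult_left_mono) auto
    then have "push_map (bump_push c \<eta> ?v)"
      by (intro push_map_bump_push[OF c r cut]) (use t nv sub in auto)
    from avoidable_image[OF av this] have "avoidable (bump_push c \<eta> ?v q)" using q(1) chart_sub[OF c] by auto
    moreover have "\<eta> (snd c q) = 1" using q(2) t r by (intro \<eta>(1)) auto
    ultimately show ?thesis using q(1) inv_chart[OF c q'(1)] by (simp add: bump_push_def)
  qed
  then show ?thesis using openin_chart_ball[OF c, of ?a t] p(1) t(1)
    by (intro exI[of _ "{q \<in> fst c. snd c q \<in> ball ?a t}"]) auto
qed

lemma all_avoidable: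
  assumes conn: "connected M" and bd: "manifold_boundary k \<A> \<noteq> {}" and p: "p \<in> M"
  shows "avoidable p"
proof -
  obtain c0 p0 where p0: "c0 \<in> \<A>" "p0 \<in> fst c0" "snd c0 p0 $ k = 0" using bd by (auto simp: manifold_boundary_def)
  have av0: "avoidable p0" using avoidable_near_boundary[OF p0] by blast
  have p0M: "p0 \<in> M" using p0(2) chart_sub[OF p0(1)] by blast
  show ?thesis
  proof (rule connected_induction_simple[OF conn p0M p, where P=avoidable, OF av0])
    fix a assume "a \<in> M"
    then obtain c where c: "c \<in> \<A>" "a \<in> fst c" using exists_chart by blast
    have "0 \<le> snd c a $ k" using image_sub[OF c(1)] chart_in[OF c(2)] by (auto simp: halfspace_def)
    then consider "snd c a $ k = 0" | "0 < snd c a $ k" by linarith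
    then show "\<exists>T. openin (top_of_set M) T \<and> a \<in> T \<and> (\<forall>x\<in>T. \<forall>y\<in>T. avoidable x \<longrightarrow> avoidable y)"
    proof cases
      case 1 then show ?thesis using avoidable_near_boundary[OF c] by blast
    next
      case 2 then show ?thesis by (rule avoidable_near_interior[OF c])
    qed
  qed
qed

lemma remove_critical_points:
  assumes conn: "connected M" and bd: "manifold_boundary k \<A> \<noteq> {}"
    and f: "smooth_function \<A> f" "finite (Crit f)"
  shows "\<exists>h. smooth_function \<A> h \<and> Crit h = {}"
  using f
proof (induction "card (Crit f)" arbitrary: f rule: less_induct)
  case (less f)
  show ?case
  proof (cases "Crit f = {}")
    case True then show ?thesis using less.prems by blast
  next
    case False
    then obtain p where p: "p \<in> Crit f" by blast
    then obtain \<Phi> where \<Phi>: "push_map \<Phi>" "p \<notin> \<Phi> ` M"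
      using all_avoidable[OF conn bd] Crit_sub unfolding avoidable_def by blast
    have sm: "smooth_function \<A> (f \<circ> \<Phi>)" and im: "\<Phi> ` Crit (f \<circ> \<Phi>) \<subseteq> Crit f"
      using \<Phi>(1) less.prems(1) unfolding push_map_def by blast+
    have inj: "inj_on \<Phi> (Crit (f \<circ> \<Phi>))"
    proof (rule inj_on_subset[OF _ Crit_sub])
      show "inj_on \<Phi> M" using \<Phi>(1) by (simp add: push_map_def)
    qed
    \<comment> \<open>Strict because the image of \<open>\<Phi>\<close> misses the critical point
      \<open>p\<close>.\<close>
    have sub: "\<Phi> ` Crit (f \<circ> \<Phi>) \<subset> Crit f" using im p \<Phi>(2) Crit_sub by blast
    have "finite (Crit (f \<circ> \<Phi>))" using inj im less.prems(2) by (metis finite_imageD finite_subset)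
    moreover have "card (Crit (f \<circ> \<Phi>)) < card (Crit f)"
      using psubset_card_mono[OF less.prems(2) sub] card_image[OF inj] by simp
    ultimately show ?thesis using less.hyps sm by blast
  qed
qed

end

subsection \<open>Perturbation to finitely many critical points\<close>

text \<open>The library states Sard's theorem for well-ordered index types only.\<close>

typedef 'n ordered_index = "UNIV :: 'n set" ..

instance ordered_index :: (finite) finite
proof
  have "range Abs_ordered_index = (UNIV :: 'a ordered_index set)"
    by (metis Rep_ordered_index_inverse surjI)
  then show "finite (UNIV :: 'a ordered_index set)" by (metis finite finite_imageI)
qed

definition index_number :: "'n::finite ordered_index \<Rightarrow> nat" where
  "index_number = (SOME f. inj f)"

lemma inj_index_number: "inj (index_number :: 'n::finite ordered_index \<Rightarrow> nat)"
proof -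
  have "\<exists>f :: 'n ordered_index \<Rightarrow> nat. inj f"
    using finite_imp_inj_to_nat_seg[OF finite[of "UNIV :: 'n ordered_index set"]] by blast
  then show ?thesis unfolding index_number_def by (rule someI_ex)
qed

text \<open>The order is pulled back from the naturals along an arbitrary injection, which makes it
  well-founded.\<close>

instantiation ordered_index :: (finite) wellorder
begin

definition "i \<le> j \<longleftrightarrow> index_number i \<le> index_number (j :: 'a ordered_index)"
definition "i < j \<longleftrightarrow> index_number i < index_number (j :: 'a ordered_index)"

instance
proof
  fix i j :: "'a ordered_index"
  show "i \<le> j \<Longrightarrow> j \<le> i \<Longrightarrow> i = j"
    using inj_index_number by (auto simp: less_eq_ordered_index_def dest: injD)
next
  fix P :: "'a ordered_index \<Rightarrow> bool" and i :: "'a ordered_index"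
  assume step: "\<And>i. (\<And>j. j < i \<Longrightarrow> P j) \<Longrightarrow> P i"
  show "P i"
    by (induction "index_number i" arbitrary: i rule: less_induct)
      (rule step, simp add: less_ordered_index_def)
qed (auto simp: less_eq_ordered_index_def less_ordered_index_def)

end

lemma card_ordered_index: "CARD('n::finite ordered_index) = CARD('n)"
  by (rule type_definition.card[OF type_definition_ordered_index])

text \<open>Relabelling coordinates by the mutually inverse linear maps \<open>P\<close> and
  \<open>Q\<close> conjugates \<open>f\<close> to a map over the ordered index type. Singularity of
  the differential survives conjugation, and linear images of negligible sets are
  negligible.\<close>

lemma Sard_same_dimension:
  fixes f :: "real^'n \<Rightarrow> real^'n"
  assumes der: "\<And>x. x \<in> S \<Longrightarrow> (f has_derivative f' x) (at x within S)"
    and det: "\<And>x. x \<in> S \<Longrightarrow> det (matrix (f' x)) = 0"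
  shows "negligible (f ` S)"
proof -
  define P :: "real^'n \<Rightarrow> real^('n ordered_index)" where "P v = (\<chi> i. v $ Rep_ordered_index i)" for v
  define Q :: "real^('n ordered_index) \<Rightarrow> real^'n" where "Q v = (\<chi> i. v $ Abs_ordered_index i)" for v
  have PQ: "P (Q v) = v" "Q (P w) = w" for v w
    by (simp_all add: P_def Q_def vec_eq_iff Rep_ordered_index_inverse Abs_ordered_index_inverse)
  have linP: "linear P" and linQ: "linear Q"
    by (auto intro!: linearI simp: P_def Q_def vec_eq_iff)
  have "negligible ((P \<circ> f \<circ> Q) ` (P ` S))"
  proof (rule baby_Sard[OF order_refl])
    fix y assume "y \<in> P ` S"
    then obtain x where x: "x \<in> S" "y = P x" by blast
    have QS: "Q ` (P ` S) = S" by (simp add: image_image PQ)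
    have "(f has_derivative f' (Q y)) (at (Q y) within Q ` (P ` S))"
      using der[OF x(1)] x(2) by (simp add: QS PQ)
    then have "(f \<circ> Q has_derivative f' (Q y) \<circ> Q) (at y within P ` S)"
      using diff_chain_within[of Q Q y "P ` S" f "f' (Q y)"] linear_imp_has_derivative[OF linQ] has_derivative_at_withinI by blast
    then have "(P \<circ> (f \<circ> Q) has_derivative P \<circ> (f' (Q y) \<circ> Q)) (at y within P ` S)"
      using diff_chain_within[of "f \<circ> Q" _ y "P ` S" P P] linear_imp_has_derivative[OF linP] has_derivative_at_withinI by blast
    then show "((P \<circ> f \<circ> Q) has_derivative (P \<circ> f' (Q y) \<circ> Q)) (at y within P ` S)" by (simp add: o_assoc)
    have lin: "linear (f' x)" using der[OF x(1)] has_derivative_linear by blast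
    then have "\<not> inj (f' x)" using det_nz_iff_inj det[OF x(1)] by metis
    then obtain a b where ab: "a \<noteq> b" "f' x a = f' x b" by (auto simp: inj_def)
    have "(P \<circ> f' (Q y) \<circ> Q) (P a) = (P \<circ> f' (Q y) \<circ> Q) (P b)" using ab x(2) by (simp add: PQ)
    moreover have "P a \<noteq> P b" using ab PQ(2) by metis
    ultimately have "\<not> inj (P \<circ> f' (Q y) \<circ> Q)" by (meson injD)
    moreover have "linear (P \<circ> f' (Q y) \<circ> Q)"
      using lin x(2) by (simp add: PQ linear_compose linP linQ)
    ultimately have "det (matrix (P \<circ> f' (Q y) \<circ> Q)) = 0" using det_nz_iff_inj by blast
    then show "rank (matrix (P \<circ> f' (Q y) \<circ> Q)) < CARD('n ordered_index)" by (simp add: det_eq_0_rank)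
  qed
  moreover have "(P \<circ> f \<circ> Q) ` (P ` S) = P ` f ` S" by (simp add: image_image PQ)
  ultimately have neg: "negligible (P ` f ` S)" by simp
  have "negligible (Q ` (P ` f ` S))"
    by (rule negligible_differentiable_image_negligible[OF _ neg])
      (auto simp: card_ordered_index intro: linear_imp_differentiable_on linQ)
  then show ?thesis by (simp add: image_image PQ)
qed

section \<open>Gradients, Hessians and nondegeneracy under linear perturbation\<close>

lemma dd_lincomb:
  fixes F :: "real^'n \<Rightarrow> real"
  assumes S: "hopen k S" "x \<in> S" and F: "smooth_on S F" and b: "\<And>l. smooth_on S (b l)"
  shows "dd S (\<lambda>x. F x + (\<Sum>l\<in>UNIV. s l * b (l :: 'm::finite) x)) v x = dd S F v x + (\<Sum>l\<in>UNIV. s l * dd S (b l) v x)"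
proof (rule dd_eqI[OF _ S])
  show "((\<lambda>x. F x + (\<Sum>l\<in>UNIV. s l * b l x)) has_derivative (\<lambda>v. dd S F v x + (\<Sum>l\<in>UNIV. s l * dd S (b l) v x))) (at x within S)"
    by (intro has_derivative_add has_derivative_sum has_derivative_mult_right has_derivative_dd[OF S(1) _ S(2)] F b)
qed

definition grad :: "(real^'n) set \<Rightarrow> (real^'n \<Rightarrow> real) \<Rightarrow> real^'n \<Rightarrow> real^'n::finite" where
  "grad S F x = (\<chi> i. dd S F (axis i 1) x)"

text \<open>The plain coordinate Hessian; its determinant matters only at zeros of the gradient,
  where the Christoffel correction vanishes.\<close>

definition hessian :: "(real^'n) set \<Rightarrow> (real^'n \<Rightarrow> real) \<Rightarrow> real^'n \<Rightarrow> real^'n^'n::finite" where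
  "hessian S F x = (\<chi> i j. dd S (dd S F (axis i 1)) (axis j 1) x)"

lemma smooth_on_grad: "hopen k S \<Longrightarrow> smooth_on S F \<Longrightarrow> smooth_on S (grad S F)"
  by (rule smooth_on_vec) (simp add: grad_def smooth_on_dd)

lemma smooth_on_hessian: "hopen k S \<Longrightarrow> smooth_on S F \<Longrightarrow> smooth_on S (hessian S F)"
  by (rule smooth_on_vec, rule smooth_on_vec) (simp add: hessian_def smooth_on_dd)

lemma matrix_dd_grad:
  assumes "hopen k S" "smooth_on S F" "x \<in> S"
  shows "matrix (\<lambda>v. dd S (grad S F) v x) = hessian S F x"
proof -
  have "dd S (grad S F) v x $ i = dd S (dd S F (axis i 1)) v x" for v i
    using dd_linear_comp[OF bounded_linear_vec_nth[of i] assms(1) smooth_on_grad[OF assms(1,2)] assms(3), of v]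
    by (simp add: grad_def)
  then show ?thesis by (simp add: matrix_def hessian_def vec_eq_iff)
qed

lemma grad_lincomb:
  assumes "hopen k S" "x \<in> S" "smooth_on S F" "\<And>l. smooth_on S (b l)"
  shows "grad S (\<lambda>x. F x + (\<Sum>l\<in>UNIV. s l * b (l :: 'm::finite) x)) x = grad S F x + (\<Sum>l\<in>UNIV. s l *\<^sub>R grad S (b l) x)"
  by (simp add: grad_def vec_eq_iff dd_lincomb[OF assms])

lemma hessian_lincomb:
  assumes "hopen k S" "x \<in> S" "smooth_on S F" "\<And>l. smooth_on S (b l)"
  shows "hessian S (\<lambda>x. F x + (\<Sum>l\<in>UNIV. s l * b (l :: 'm::finite) x)) x = hessian S F x + (\<Sum>l\<in>UNIV. s l *\<^sub>R hessian S (b l) x)"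
proof -
  have "dd S (dd S (\<lambda>x. F x + (\<Sum>l\<in>UNIV. s l * b l x)) v) w x = dd S (dd S F v) w x + (\<Sum>l\<in>UNIV. s l * dd S (dd S (b l) v) w x)" for v w
    using dd_lincomb[OF assms(1,2), of "dd S F v" "\<lambda>l. dd S (b l) v" s w] assms
    by (subst dd_cong[OF assms(2) dd_lincomb[OF assms(1) _ assms(3,4)]]) (auto intro: smooth_on_dd)
  then show ?thesis by (simp add: hessian_def vec_eq_iff)
qed

definition nondegenerate_on :: "(real^'n) set \<Rightarrow> (real^'n::finite) set \<Rightarrow> (real^'n \<Rightarrow> real) \<Rightarrow> bool" where
  "nondegenerate_on S K F \<longleftrightarrow> (\<forall>x\<in>K. grad S F x \<noteq> 0 \<or> det (hessian S F x) \<noteq> 0)"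

abbreviation "perturbed F b s \<equiv> \<lambda>x. F x + (\<Sum>l\<in>UNIV. s $ l * b l x)"

text \<open>Nondegeneracy at a point means that \<open>\<rho>\<close> is positive there. It has a
  positive minimum over \<open>K\<close> at parameter 0, and uniform continuity on a compact
  parameter set preserves positivity nearby.\<close>

lemma nondegenerate_stable:
  assumes S: "hopen k S" and K: "compact K" "K \<subseteq> S"
    and F: "smooth_on S F" and b: "\<And>l. smooth_on S (b l)" and nd: "nondegenerate_on S K F"
  shows "\<exists>\<delta>>0. \<forall>s::real^'m::finite. norm s < \<delta> \<longrightarrow> nondegenerate_on S K (perturbed F b s)"
proof (cases "K = {}")
  case True then show ?thesis by (intro exI[of _ 1]) (simp add: nondegenerate_on_def)
next
  case False
  define G where "G z = grad S F (snd z) + (\<Sum>l\<in>UNIV. fst z $ l *\<^sub>R grad S (b l) (snd z))" for z :: "(real^'m) \<times> (real^'a)"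
  define H where "H z = hessian S F (snd z) + (\<Sum>l\<in>UNIV. fst z $ l *\<^sub>R hessian S (b l) (snd z))" for z :: "(real^'m) \<times> (real^'a)"
  define \<rho> where "\<rho> z = (norm (G z))\<^sup>2 + (det (H z))\<^sup>2" for z
  let ?C = "cball (0::real^'m) 1 \<times> K"
  have cK: "continuous_on ?C (\<lambda>z. f (snd z))" if "smooth_on S f" for f :: "real^'a \<Rightarrow> 'c::real_normed_vector"
    by (rule continuous_on_compose2[OF smooth_on_continuous[OF that] continuous_on_snd[OF continuous_on_id]]) (use K(2) in auto)
  have cG: "continuous_on ?C G" unfolding G_def
    by (intro continuous_on_add continuous_on_sum continuous_on_scaleR cK smooth_on_grad[OF S] F b continuous_intros)
  have cH: "continuous_on ?C H" unfolding H_def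
    by (intro continuous_on_add continuous_on_sum continuous_on_scaleR cK smooth_on_hessian[OF S] F b continuous_intros)
  have "continuous_on ?C (\<lambda>z. det (H z))" unfolding det_def
    by (intro continuous_on_sum continuous_on_mult continuous_on_prod continuous_on_const continuous_on_component cH)
  then have c\<rho>: "continuous_on ?C \<rho>" unfolding \<rho>_def
    by (intro continuous_on_add continuous_on_power continuous_on_norm cG)
  have rep: "\<rho> (s, x) = (norm (grad S (perturbed F b s) x))\<^sup>2 + (det (hessian S (perturbed F b s) x))\<^sup>2"
    if "x \<in> K" for s x
    using grad_lincomb[OF S _ F b, of x "\<lambda>l. s $ l"] hessian_lincomb[OF S _ F b, of x "\<lambda>l. s $ l"] that K(2)
    by (auto simp: \<rho>_def G_def H_def)
  have pos: "0 < \<rho> (0, x)" if "x \<in> K" for x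
    using nd that rep[OF that, of 0] by (auto simp: nondegenerate_on_def add_pos_nonneg add_nonneg_pos)
  have "continuous_on K (\<lambda>x. \<rho> (0, x))"
    by (rule continuous_on_compose2[OF c\<rho>]) (auto intro!: continuous_intros)
  then obtain x0 where x0: "x0 \<in> K" "\<And>x. x \<in> K \<Longrightarrow> \<rho> (0, x0) \<le> \<rho> (0, x)"
    using continuous_attains_inf[OF K(1) False] by blast
  have "uniformly_continuous_on ?C \<rho>"
    by (rule compact_uniformly_continuous[OF c\<rho>]) (intro compact_Times compact_cball K)
  then obtain d where d: "d > 0" "\<And>z z'. z \<in> ?C \<Longrightarrow> z' \<in> ?C \<Longrightarrow> dist z' z < d \<Longrightarrow> dist (\<rho> z') (\<rho> z) < \<rho> (0, x0)"
    using pos[OF x0(1)] unfolding uniformly_continuous_on_def by blast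
  \<comment> \<open>The bound 1 keeps the parameter in the compact ball on which uniform continuity
    was obtained.\<close>
  have "nondegenerate_on S K (perturbed F b s)" if s: "norm s < min d 1" for s :: "real^'m"
    unfolding nondegenerate_on_def
  proof
    fix x assume x: "x \<in> K"
    have "dist (\<rho> (s, x)) (\<rho> (0, x)) < \<rho> (0, x0)"
      by (rule d(2)) (use s x in \<open>auto simp: dist_Pair_Pair\<close>)
    then have "0 < \<rho> (s, x)" using x0(2)[OF x] by (simp add: dist_real_def)
    then show "grad S (perturbed F b s) x \<noteq> 0 \<or> det (hessian S (perturbed F b s) x) \<noteq> 0"
      using rep[OF x] by auto
  qed
  then show ?thesis using d(1) by (intro exI[of _ "min d 1"]) auto
qed

text \<open>Infinitely many zeros would accumulate in the compact set. At the limit the gradient map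
  vanishes and has an injective differential, so it grows at least linearly and has no other zero
  nearby.\<close>

lemma nondegenerate_finite_zeros:
  assumes S: "hopen k S" and K: "compact K" "K \<subseteq> S" and F: "smooth_on S F" and nd: "nondegenerate_on S K F"
  shows "finite {x\<in>K. grad S F x = 0}"
proof (rule ccontr)
  let ?Z = "{x\<in>K. grad S F x = 0}"
  assume "infinite ?Z"
  then obtain x where x: "x \<in> K" "x islimpt ?Z"
    using K(1) unfolding compact_eq_Bolzano_Weierstrass by (metis (no_types, lifting) mem_Collect_eq subsetI)
  have "continuous_on K (grad S F)" using smooth_on_continuous[OF smooth_on_grad[OF S F]] continuous_on_subset K(2) by blast
  then have "closed ?Z" using continuous_closed_preimage_constant[OF _ compact_imp_closed[OF K(1)]] by simp
  then have gx: "grad S F x = 0" using x(2) closed_limpt by blast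
  have xS: "x \<in> S" using x(1) K(2) by blast
  let ?D = "\<lambda>v. dd S (grad S F) v x"
  have der: "(grad S F has_derivative ?D) (at x within S)" by (rule has_derivative_dd[OF S smooth_on_grad[OF S F] xS])
  have lin: "linear ?D" using der has_derivative_linear by blast
  have "det (matrix ?D) \<noteq> 0" using nd gx x(1) by (auto simp: nondegenerate_on_def matrix_dd_grad[OF S F xS])
  then have "inj ?D" using det_nz_iff_inj[OF lin] by blast
  then obtain B where B: "B > 0" "\<And>v. B * norm v \<le> norm (?D v)"
    using linear_inj_bounded_below_pos[OF lin] by metis
  have "B / 2 > 0" using B by simp
  then obtain d where d: "d > 0" "\<And>y. y \<in> S \<Longrightarrow> norm (y - x) < d \<Longrightarrow> norm (grad S F y - grad S F x - ?D (y - x)) \<le> B / 2 * norm (y - x)"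
    using der unfolding has_derivative_within_alt by blast
  obtain y where y: "y \<in> ?Z" "y \<noteq> x" "dist y x < d" using x(2) d(1) unfolding islimpt_approachable by blast
  have "norm (?D (y - x)) \<le> B / 2 * norm (y - x)"
    using d(2)[of y] y K(2) gx by (auto simp: dist_norm)
  then have "B * norm (y - x) \<le> B / 2 * norm (y - x)" using B(2)[of "y - x"] by linarith
  then show False using B(1) y(2) by simp
qed

lemma finite_uniform_radius:
  fixes R :: "'q \<Rightarrow> 'v::real_normed_vector \<Rightarrow> bool"
  assumes "finite P" "\<And>q. q \<in> P \<Longrightarrow> \<exists>\<delta>>0. \<forall>s. norm s < \<delta> \<longrightarrow> R q s"
  shows "\<exists>\<delta>>0. \<forall>q\<in>P. \<forall>s. norm s < \<delta> \<longrightarrow> R q s"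
  using assms
proof (induction P rule: finite_induct)
  case empty then show ?case by (intro exI[of _ 1]) auto
next
  case (insert q P)
  obtain d where d: "d > 0" "\<forall>q\<in>P. \<forall>s. norm s < d \<longrightarrow> R q s" using insert by blast
  obtain e where e: "e > 0" "\<forall>s. norm s < e \<longrightarrow> R q s" using insert by blast
  show ?case using d e by (intro exI[of _ "min d e"]) auto
qed

section \<open>Finite covers by coordinate cells and Morse functions\<close>

context compact_manifold
begin

text \<open>Radius \<open>4 * r\<close> leaves room for a cut-off that is 1 on the ball of radius
  \<open>2 * r\<close>, well around the cell of radius \<open>r\<close>, and vanishes before the
  chart ends.\<close>

definition piece :: "('a, 'n) chart \<Rightarrow> real^'n \<Rightarrow> real \<Rightarrow> bool" where
  "piece c a r \<longleftrightarrow> c \<in> \<A> \<and> 0 < r \<and> cball a (4 * r) \<inter> halfspace k \<subseteq> chart_image c"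

abbreviation "cell a r \<equiv> cball a r \<inter> halfspace k"

lemma cell_sub: "piece c a r \<Longrightarrow> cell a r \<subseteq> chart_image c"
  unfolding piece_def using subset_cball[of r "4 * r" a] by fastforce

lemma compact_cell: "compact (cell a r)"
  using closed_halfspace by (intro compact_Int_closed) auto

lemma finite_piece_cover:
  obtains P where "finite P" "\<forall>(c, a, r)\<in>P. piece c a r" "M \<subseteq> (\<Union>(c, a, r)\<in>P. {q \<in> fst c. snd c q \<in> cell a r})"
proof -
  let ?T = "\<lambda>(c, a, r). {q \<in> fst c. snd c q \<in> ball a r}"
  let ?Q = "{(c, a, r). piece c a r}"
  have op: "openin (top_of_set M) (?T q)" if "q \<in> ?Q" for q
    using that openin_chart_ball by (auto simp: piece_def split: prod.splits)
  have cov: "\<exists>q\<in>?Q. p \<in> ?T q" if p: "p \<in> M" for p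
  proof -
    obtain c where c: "c \<in> \<A>" "p \<in> fst c" using exists_chart[OF p] by blast
    obtain r where r: "0 < r" "cball (snd c p) r \<inter> halfspace k \<subseteq> chart_image c" by (rule chart_ball[OF c])
    have "(c, snd c p, r / 4) \<in> ?Q" "p \<in> ?T (c, snd c p, r / 4)" using c r by (auto simp: piece_def)
    then show ?thesis by blast
  qed
  have "(\<forall>c\<in>?T ` ?Q. openin (top_of_set M) c) \<and> M \<subseteq> \<Union>(?T ` ?Q)" using op cov by blast
  then obtain D where D: "D \<subseteq> ?T ` ?Q" "finite D" "M \<subseteq> \<Union>D"
    using cpt[unfolded compact_eq_openin_cover] by (elim allE[of _ "?T ` ?Q"] impE) auto
  from finite_subset_image[OF D(2,1)]
  obtain P where P: "P \<subseteq> ?Q" "finite P" "D = ?T ` P" by (elim exE conjE)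
  show thesis
  proof (rule that[OF P(2)])
    show "\<forall>(c, a, r)\<in>P. piece c a r" using P(1) by auto
    show "M \<subseteq> (\<Union>(c, a, r)\<in>P. {q \<in> fst c. snd c q \<in> cell a r})"
    proof
      fix p assume p: "p \<in> M"
      then obtain c a r where q: "(c, a, r) \<in> P" "p \<in> ?T (c, a, r)" using D(3) P(3) by auto
      then have "c \<in> \<A>" using P(1) by (auto simp: piece_def)
      then have "snd c p \<in> halfspace k" using q(2) chart_in[of p c] image_sub[of c] by auto
      then show "p \<in> (\<Union>(c, a, r)\<in>P. {q \<in> fst c. snd c q \<in> cell a r})"
        by (intro UN_I[OF q(1)]) (use q(2) in auto)
    qed
  qed
qed

definition morse_on :: "('a \<Rightarrow> real) \<Rightarrow> ('a, 'n) chart \<Rightarrow> real^'n \<Rightarrow> real \<Rightarrow> bool" where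
  "morse_on f c a r \<longleftrightarrow> nondegenerate_on (chart_image c) (cell a r) (local_rep f c)"

text \<open>On the cell a linear function is added, which shifts the gradient by \<open>s\<close>
  and leaves the Hessian alone. Nondegeneracy then says that \<open>- s\<close> is not a singular
  value of the gradient map on the cell, which holds for almost all \<open>s\<close>; taking
  \<open>s\<close> small preserves the pieces already treated.\<close>

lemma perturb_piece:
  assumes f: "smooth_function \<A> f" and q: "piece c a r"
    and P: "finite P" "\<forall>(c, a, r)\<in>P. piece c a r \<and> morse_on f c a r"
  shows "\<exists>h. smooth_function \<A> h \<and> (\<forall>(c, a, r)\<in>insert (c, a, r) P. morse_on h c a r)"
proof -
  have c: "c \<in> \<A>" and r: "0 < r" "cball a (4 * r) \<inter> halfspace k \<subseteq> chart_image c" using q by (auto simp: piece_def)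
  let ?S = "chart_image c" and ?F = "\<lambda>x. f (chart_inv c x)"
  note S = hopen_image[OF c]
  obtain \<eta> where \<eta>: "smooth_on UNIV \<eta>" "\<And>x. x \<in> cball a (2 * r) \<Longrightarrow> \<eta> x = (1::real)" "\<And>x. x \<notin> ball a (2 * (2 * r)) \<Longrightarrow> \<eta> x = 0"
    using smooth_bump[of "2 * r" a] r(1) by (metis mult_pos_pos zero_less_numeral)
  define \<beta> where "\<beta> l p = (if p \<in> fst c then \<eta> (snd c p) * snd c p $ l else 0)" for l p
  have s\<beta>: "smooth_function \<A> (\<beta> l)" for l
    unfolding \<beta>_def
  proof (rule smooth_patch[OF c, where a="\<lambda>x. \<eta> x * x $ l"])
    show "smooth_function \<A> (\<lambda>x. 0)" by (simp add: smooth_function_def o_def smooth_on_const)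
    show "compact (cell a (4 * r))" by (rule compact_cell)
    show "smooth_on ?S (\<lambda>x. \<eta> x * x $ l)"
      by (intro smooth_on_mult smooth_on_nth smooth_on_id smooth_on_subset[OF \<eta>(1)]) auto
    show "\<eta> x * x $ l = 0" if "x \<in> ?S" "x \<notin> cell a (4 * r)" for x
      using that image_sub[OF c] \<eta>(3)[of x] by auto
  qed (rule r(2))
  define h where "h s p = f p + (\<Sum>l\<in>UNIV. s $ l * \<beta> l p)" for s :: "real^'n" and p
  have sh: "smooth_function \<A> (h s)" for s
    unfolding smooth_function_def o_def h_def
    by (intro ballI smooth_on_add smooth_on_sum smooth_on_mult smooth_on_const smooth_fun_rep f s\<beta>)
  have near: "\<exists>\<delta>>0. \<forall>s. norm s < \<delta> \<longrightarrow> (case q of (c, a, r) \<Rightarrow> morse_on (h s) c a r)" if "q \<in> P" for q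
  proof (cases q)
    case (fields d b t)
    have d: "piece d b t" "morse_on f d b t" using P(2) that fields by auto
    then have dA: "d \<in> \<A>" by (simp add: piece_def)
    have "\<exists>\<delta>>0. \<forall>s::real^'n. norm s < \<delta> \<longrightarrow> nondegenerate_on (chart_image d) (cell b t)
        (\<lambda>x. f (chart_inv d x) + (\<Sum>l\<in>UNIV. s $ l * \<beta> l (chart_inv d x)))"
      by (rule nondegenerate_stable[OF hopen_image[OF dA] compact_cell cell_sub[OF d(1)] smooth_fun_rep[OF f dA] smooth_fun_rep[OF s\<beta> dA]
        d(2)[unfolded morse_on_def]])
    then show ?thesis by (simp add: fields morse_on_def h_def)
  qed
  from finite_uniform_radius[where R="\<lambda>q s. case q of (c, a, r) \<Rightarrow> morse_on (h s) c a r", OF P(1) near]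
  obtain \<delta> where \<delta>: "\<delta> > 0" "\<forall>q\<in>P. \<forall>s. norm s < \<delta> \<longrightarrow> (case q of (c, a, r) \<Rightarrow> morse_on (h s) c a r)" by blast
  \<comment> \<open>On this relatively open set the cut-off is 1 and each \<open>\<beta> l\<close>
    is a coordinate function, so its derivatives can be computed; it contains the closed
    cell.\<close>
  let ?T = "ball a (2 * r) \<inter> halfspace k"
  have T: "hopen k ?T" by (auto simp: openin_open)
  have TS: "?T \<subseteq> ?S" using r by auto
  have sF: "smooth_on ?S ?F" by (rule smooth_fun_rep[OF f c])
  have sb: "smooth_on ?S (\<lambda>x. \<beta> l (chart_inv c x))" for l by (rule smooth_fun_rep[OF s\<beta> c])
  have bT: "\<beta> l (chart_inv c x) = x $ l" if "x \<in> ?T" for x l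
  proof -
    have "x \<in> ?S" using that TS by blast
    then show ?thesis using that \<eta>(2)[of x] by (simp add: \<beta>_def inv_in[OF c] chart_inv[OF c])
  qed
  have d1: "dd ?S (\<lambda>x. \<beta> l (chart_inv c x)) v x = v $ l" if x: "x \<in> ?T" for x l v
  proof -
    have "dd ?S (\<lambda>x. \<beta> l (chart_inv c x)) v x = dd ?T (\<lambda>x. \<beta> l (chart_inv c x)) v x"
      by (rule dd_subset[OF S T TS sb x, symmetric])
    also have "\<dots> = dd ?T (\<lambda>x. x $ l) v x" by (rule dd_cong[OF x]) (rule bT)
    also have "\<dots> = v $ l"
      by (rule dd_eqI[OF bounded_linear_imp_has_derivative[OF bounded_linear_vec_nth] T x])
    finally show ?thesis .
  qed
  have d2: "dd ?S (dd ?S (\<lambda>x. \<beta> l (chart_inv c x)) v) w x = 0" if x: "x \<in> ?T" for x l v w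
  proof -
    have "dd ?S (dd ?S (\<lambda>x. \<beta> l (chart_inv c x)) v) w x = dd ?T (dd ?S (\<lambda>x. \<beta> l (chart_inv c x)) v) w x"
      by (rule dd_subset[OF S T TS smooth_on_dd[OF S sb] x, symmetric])
    also have "\<dots> = dd ?T (\<lambda>x. v $ l) w x" by (rule dd_cong[OF x]) (rule d1)
    also have "\<dots> = 0" by (rule dd_eqI[OF has_derivative_const T x])
    finally show ?thesis .
  qed
  let ?Z = "{x\<in>?T. det (hessian ?S ?F x) = 0}"
  have "negligible (grad ?S ?F ` ?Z)"
  proof (rule Sard_same_dimension[where f'="\<lambda>x v. dd ?S (grad ?S ?F) v x"])
    fix x assume x: "x \<in> ?Z"
    then have xS: "x \<in> ?S" using TS by blast
    show "(grad ?S ?F has_derivative (\<lambda>v. dd ?S (grad ?S ?F) v x)) (at x within ?Z)"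
      by (rule has_derivative_subset[OF has_derivative_dd[OF S smooth_on_grad[OF S sF] xS]]) (use TS in blast)
    show "det (matrix (\<lambda>v. dd ?S (grad ?S ?F) v x)) = 0" using x by (simp add: matrix_dd_grad[OF S sF xS])
  qed
  \<comment> \<open>A ball has positive measure, so some arbitrarily small vector is not a singular
    value.\<close>
  moreover have "\<not> negligible (ball (0::real^'n) \<delta>)" using \<delta>(1) by (intro open_not_negligible) auto
  ultimately have "\<not> ball 0 \<delta> \<subseteq> grad ?S ?F ` ?Z" using negligible_subset by blast
  then obtain t where "t \<in> ball 0 \<delta>" and t: "t \<notin> grad ?S ?F ` ?Z" unfolding subset_iff by meson
  then have t: "norm t < \<delta>" "t \<notin> grad ?S ?F ` ?Z" by simp_all
  \<comment> \<open>Critical points of the perturbed function in the cell solve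
    \<open>grad F = t\<close>, and there the Hessian is invertible by the choice of
    \<open>t\<close>.\<close>
  define s where "s = - t"
  have "morse_on (h s) c a r"
    unfolding morse_on_def nondegenerate_on_def
  proof
    fix x assume "x \<in> cell a r"
    then have x: "x \<in> ?T" using r(1) by auto
    have xS: "x \<in> ?S" using x TS by blast
    have "(\<Sum>l\<in>UNIV. s $ l *\<^sub>R grad ?S (\<lambda>x. \<beta> l (chart_inv c x)) x) = s"
      by (simp add: vec_eq_iff grad_def d1[OF x] sum_axis)
    then have g: "grad ?S (\<lambda>x. h s (chart_inv c x)) x = grad ?S ?F x + s"
      unfolding h_def by (simp add: grad_lincomb[OF S xS sF sb])
    have "hessian ?S (\<lambda>x. \<beta> l (chart_inv c x)) x = 0" for l
      by (simp add: hessian_def d2[OF x] vec_eq_iff)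
    then have H: "hessian ?S (\<lambda>x. h s (chart_inv c x)) x = hessian ?S ?F x"
      unfolding h_def by (simp add: hessian_lincomb[OF S xS sF sb])
    show "grad ?S (\<lambda>x. h s (chart_inv c x)) x \<noteq> 0 \<or> det (hessian ?S (\<lambda>x. h s (chart_inv c x)) x) \<noteq> 0"
      unfolding g H using t(2) x by (auto simp: s_def)
  qed
  moreover have "\<forall>(c, a, r)\<in>P. morse_on (h s) c a r" using \<delta>(2) t(1) by (fastforce simp: s_def)
  ultimately show ?thesis using sh by (intro exI[of _ "h s"]) auto
qed

lemma exists_morse:
  assumes "finite P" "\<forall>(c, a, r)\<in>P. piece c a r"
  shows "\<exists>f. smooth_function \<A> f \<and> (\<forall>(c, a, r)\<in>P. morse_on f c a r)"
  using assms
proof (induction P rule: finite_induct)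
  case empty
  show ?case by (intro exI[of _ "\<lambda>p. 0"]) (simp add: smooth_function_def o_def smooth_on_const)
next
  case (insert q P)
  obtain c a r where q: "q = (c, a, r)" by (cases q)
  obtain f where "smooth_function \<A> f" "\<forall>(c, a, r)\<in>P. morse_on f c a r" using insert by auto
  then show ?case unfolding q
    by (intro perturb_piece[of f c a r P]) (use insert q in auto)
qed

theorem exists_noncritical:
  assumes conn: "connected M" and bd: "manifold_boundary k \<A> \<noteq> {}"
  shows "\<exists>f. smooth_function \<A> f \<and> Crit f = {}"
proof -
  obtain P where P: "finite P" "\<forall>(c, a, r)\<in>P. piece c a r" "M \<subseteq> (\<Union>(c, a, r)\<in>P. {q \<in> fst c. snd c q \<in> cell a r})"
    by (rule finite_piece_cover)
  obtain f where f: "smooth_function \<A> f" "\<forall>(c, a, r)\<in>P. morse_on f c a r" using exists_morse[OF P(1,2)] by blast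
  let ?Z = "\<lambda>(c, a, r). chart_inv c ` {x\<in>cell a r. grad (chart_image c) (local_rep f c) x = 0}"
  have "finite (?Z q)" if "q \<in> P" for q
  proof (cases q)
    case (fields c a r)
    then have q: "piece c a r" "morse_on f c a r" using that P(2) f(2) by auto
    then have c: "c \<in> \<A>" by (simp add: piece_def)
    have "finite {x\<in>cell a r. grad (chart_image c) (local_rep f c) x = 0}"
      by (rule nondegenerate_finite_zeros[OF hopen_image[OF c] compact_cell cell_sub[OF q(1)] smooth_fun_rep[OF f(1) c] q(2)[unfolded morse_on_def]])
    then show ?thesis by (simp add: fields)
  qed
  then have "finite (\<Union>q\<in>P. ?Z q)" using P(1) by blast
  moreover have "Crit f \<subseteq> (\<Union>q\<in>P. ?Z q)"
  proof
    fix p assume p: "p \<in> Crit f"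
    then have "p \<in> M" using Crit_sub by blast
    then obtain c a r where q: "(c, a, r) \<in> P" "p \<in> fst c" "snd c p \<in> cell a r" using P(3) by auto
    then have c: "c \<in> \<A>" using P(2) by (auto simp: piece_def)
    have "crit c f (snd c p)" using Crit_chart[OF c f(1) q(2)] p by blast
    then have "grad (chart_image c) (local_rep f c) (snd c p) = 0" by (simp add: grad_def crit_def vec_eq_iff)
    then have "p \<in> ?Z (c, a, r)" using q(3) inv_chart[OF c q(2)] by (auto intro!: image_eqI[of _ _ "snd c p"])
    then show "p \<in> (\<Union>q\<in>P. ?Z q)" using q(1) by blast
  qed
  ultimately have "finite (Crit f)" by (rule finite_subset[rotated])
  then show ?thesis by (rule remove_critical_points[OF conn bd f(1)])
qed

end

subsection \<open>Positivity of the modified Schouten tensor\<close>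

lemma matrix_eq_formI:
  fixes A B :: "real^'n^'n"
  assumes "\<And>v w. v \<bullet> (A *v w) = v \<bullet> (B *v w)" shows "A = B"
proof -
  have "A $ i $ j = B $ i $ j" for i j
    using assms[of "axis i 1" "axis j 1"] by (simp add: inner_axis' matrix_vector_mult_basis column_def)
  then show ?thesis by (simp add: vec_eq_iff)
qed

lemma pullback_form:
  fixes A J :: "real^'n^'n"
  shows "v \<bullet> ((transpose J ** A ** J) *v w) = (J *v v) \<bullet> (A *v (J *v w))"
proof -
  have "v \<bullet> ((transpose J ** A ** J) *v w) = v \<bullet> (transpose J *v (A *v (J *v w)))"
    by (simp add: matrix_vector_mul_assoc matrix_mul_assoc)
  also have "\<dots> = (J *v v) \<bullet> (A *v (J *v w))"
    by (simp add: transpose_matrix_vector inner_commute[of v] dot_lmul_matrix) (simp add: inner_commute)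
  finally show ?thesis .
qed

section \<open>Locality and coordinate invariance of the curvature\<close>

context metric_patch
begin

lemma metric_patch_subset: "hopen k T \<Longrightarrow> T \<subseteq> S \<Longrightarrow> metric_patch k T g"
  using smooth_g pos smooth_on_subset by unfold_locales auto

text \<open>Transition maps live on overlaps, whereas the tensors are defined with derivatives
  within whole chart images; restricting to a relatively open subset does not alter
  derivatives.\<close>

lemma christoffel_subset:
  assumes T: "hopen k T" "T \<subseteq> S" and x: "x \<in> T"
  shows "christoffel T g l i j x = christoffel S g l i j x"
  unfolding christoffel_def pd_dd
  by (simp add: dd_subset[OF hopen T smooth_on_nth[OF smooth_on_nth[OF smooth_g]] x])

lemma riemann_subset:
  assumes T: "hopen k T" "T \<subseteq> S" and x: "x \<in> T"
  shows "riemann T g l q i j x = riemann S g l q i j x"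
proof -
  have "dd T (christoffel T g l i j) v x = dd S (christoffel S g l i j) v x" for l i j v
  proof -
    have "dd T (christoffel T g l i j) v x = dd T (christoffel S g l i j) v x"
      by (rule dd_cong[OF x]) (rule christoffel_subset[OF T])
    also have "\<dots> = dd S (christoffel S g l i j) v x"
      by (rule dd_subset[OF hopen T smooth_christoffel x])
    finally show ?thesis .
  qed
  then show ?thesis unfolding riemann_def pd_dd by (simp add: christoffel_subset[OF T x])
qed

lemma ricci_subset: "hopen k T \<Longrightarrow> T \<subseteq> S \<Longrightarrow> x \<in> T \<Longrightarrow> ricci T g x = ricci S g x"
  by (simp add: ricci_def riemann_subset)

lemma scalar_curvature_subset: "hopen k T \<Longrightarrow> T \<subseteq> S \<Longrightarrow> x \<in> T \<Longrightarrow> scalar_curvature T g x = scalar_curvature S g x"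
  by (simp add: scalar_curvature_def ricci_subset)

text \<open>Symmetry of Ricci turns the double sum into the trace of an endomorphism, which is
  invariant under conjugation.\<close>

lemma scalar_curvature_trace:
  assumes x: "x \<in> S" shows "scalar_curvature S g x = trace (matrix_inv (g x) ** ricci S g x)"
proof -
  have "ricci S g x $ i $ j = ricci S g x $ j $ i" for i j
    using ricci_symmetric[OF x] by (simp add: transpose_def vec_eq_iff)
  then have "scalar_curvature S g x = (\<Sum>i\<in>UNIV. \<Sum>j\<in>UNIV. matrix_inv (g x) $ i $ j * ricci S g x $ j $ i)"
    by (simp add: scalar_curvature_def)
  then show ?thesis by (simp add: trace_def matrix_matrix_mult_def)
qed

end

text \<open>Metric and Ricci form are both pulled back by the differential, so the endomorphisms
  \<open>?X1\<close> and \<open>?X2\<close> are conjugate under it and have equal trace.\<close>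

lemma (in isometric_patches) scalar_curvature_law:
  assumes x: "x \<in> S1" shows "scalar_curvature S1 g1 x = scalar_curvature S2 g2 (y x)"
proof -
  have yx: "y x \<in> S2" using maps x by auto
  let ?J = "matrix (J x)"
  have J: "?J *v v = J x v" for v by (rule fun_cong[OF matrix_vector_mul(2)[OF linear_J[OF x]]])
  have R: "ricci S1 g1 x = transpose ?J ** ricci S2 g2 (y x) ** ?J"
    by (rule matrix_eq_formI) (simp add: pullback_form J ricci_law[OF x])
  have G: "g1 x = transpose ?J ** g2 (y x) ** ?J"
    by (rule matrix_eq_formI) (use iso[OF x] in \<open>simp add: pullback_form J bform_def\<close>)
  obtain K where K: "K ** ?J = mat 1"
    using inj_J[OF x] linear_J[OF x] matrix_left_invertible_injective[of "matrix (J x)"] by auto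
  then have JK: "?J ** K = mat 1" using matrix_left_right_inverse by blast
  have "transpose (?J ** K) = mat 1" using JK by (simp add: transpose_mat)
  then have KT: "transpose K ** transpose ?J = mat 1" by (simp add: matrix_transpose_mul)
  let ?X1 = "matrix_inv (g1 x) ** ricci S1 g1 x" and ?X2 = "matrix_inv (g2 (y x)) ** ricci S2 g2 (y x)"
  have "g1 x ** ?X1 = ricci S1 g1 x"
    by (simp add: matrix_mul_assoc matrix_inv_works(1)[OF p1.inv_g[OF x]])
  then have "transpose ?J ** (g2 (y x) ** (?J ** ?X1)) = transpose ?J ** (ricci S2 g2 (y x) ** ?J)"
    by (simp add: G R matrix_mul_assoc)
  then have "transpose K ** (transpose ?J ** (g2 (y x) ** (?J ** ?X1))) = transpose K ** (transpose ?J ** (ricci S2 g2 (y x) ** ?J))"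
    by simp
  then have "g2 (y x) ** (?J ** ?X1) = ricci S2 g2 (y x) ** ?J"
    unfolding matrix_mul_assoc KT matrix_mul_lid .
  then have "matrix_inv (g2 (y x)) ** (g2 (y x) ** (?J ** ?X1)) = matrix_inv (g2 (y x)) ** (ricci S2 g2 (y x) ** ?J)"
    by simp
  then have JX: "?J ** ?X1 = ?X2 ** ?J"
    unfolding matrix_mul_assoc matrix_inv_works(2)[OF p2.inv_g[OF yx]] matrix_mul_lid .
  have "trace ?X1 = trace (K ** (?J ** ?X1))" by (simp add: matrix_mul_assoc K)
  also have "\<dots> = trace ((?X2 ** ?J) ** K)" unfolding JX by (rule trace_mul_sym)
  also have "\<dots> = trace ?X2" by (simp add: matrix_mul_assoc[symmetric] JK)
  finally show ?thesis by (simp add: p1.scalar_curvature_trace[OF x] p2.scalar_curvature_trace[OF yx])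
qed

lemma finite_uniform_threshold:
  fixes R :: "'q \<Rightarrow> real \<Rightarrow> bool"
  assumes "finite P" "\<And>q. q \<in> P \<Longrightarrow> \<exists>\<Lambda>. \<forall>t\<ge>\<Lambda>. R q t"
  shows "\<exists>t. \<forall>q\<in>P. R q t"
proof -
  have "\<exists>\<Lambda>. \<forall>t\<ge>\<Lambda>. \<forall>q\<in>P. R q t"
    using assms
  proof (induction P rule: finite_induct)
    case (insert q P)
    obtain a where "\<forall>t\<ge>a. \<forall>q\<in>P. R q t" using insert by blast
    moreover obtain b where "\<forall>t\<ge>b. R q t" using insert by blast
    ultimately show ?case by (intro exI[of _ "max a b"]) auto
  qed auto
  then show ?thesis by blast
qed

section \<open>The modified Schouten tensor in all charts\<close>

context compact_manifold
begin

lemma metric_patch_chart: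
  assumes "riemannian_metric \<A> g" "c \<in> \<A>" shows "metric_patch k (chart_image c) (g c)"
  using assms hopen_image[OF assms(2)] by unfold_locales (auto simp: riemannian_metric_def tensor_positive_def)

text \<open>The transformation law of the metric says precisely that transition maps are isometries
  of patches.\<close>

lemma isometric_charts:
  assumes g: "riemannian_metric \<A> g" and c: "c \<in> \<A>" and d: "d \<in> \<A>"
  shows "isometric_patches k (overlap c d) (g c) (chart_image d) (g d) (\<lambda>x. snd d (chart_inv c x))"
proof -
  let ?O = "overlap c d" and ?t = "\<lambda>x. snd d (chart_inv c x)"
  interpret c: metric_patch k "chart_image c" "g c" by (rule metric_patch_chart[OF g c])
  have sub: "?O \<subseteq> chart_image c" using overlap_iff[OF c] by blast
  interpret p1: metric_patch k ?O "g c" by (rule c.metric_patch_subset[OF hopen_overlap[OF c d] sub])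
  interpret p2: metric_patch k "chart_image d" "g d" by (rule metric_patch_chart[OF g d])
  show ?thesis
  proof
    show "smooth_on ?O ?t" by (rule smooth_trans[OF c d])
    show "?t ` ?O \<subseteq> chart_image d" using trans_in[OF c d] by (rule image_subsetI)
    fix x v w assume x: "x \<in> ?O"
    let ?J = "jacobian (transition c d) (at x within ?O)"
    have t: "transition c d = ?t" by (simp add: transition_def o_def)
    have "?J = matrix (\<lambda>v. dd ?O ?t v x)" by (simp add: t jacobian_def dd_def)
    then have J: "?J *v v = dd ?O ?t v x" for v
      using fun_cong[OF matrix_vector_mul(2)[OF linear_dd[OF hopen_overlap[OF c d] smooth_trans[OF c d] x]]] by simp
    have "g c x = transpose ?J ** g d (transition c d x) ** ?J"
      using g c d x by (simp add: riemannian_metric_def tensor_law_def Let_def)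
    then have "bform (g c) x v w = v \<bullet> ((transpose ?J ** g d (?t x) ** ?J) *v w)" by (simp add: bform_def t)
    then show "bform (g c) x v w = bform (g d) (?t x) (dd ?O ?t v x) (dd ?O ?t w x)"
      unfolding pullback_form J by (simp add: bform_def)
  qed
qed

lemma modified_schouten_quadratic:
  fixes g :: "('a, 'n) tensor2"
  shows "v \<bullet> (modified_schouten \<tau> g c x *v v) = 1 / (real CARD('n) - 2) * schouten_form \<tau> (chart_image c) (g c) x v"
  by (simp add: modified_schouten_def Let_def schouten_form_def bform_def matrix_vector_mult_diff_rdistrib
      scaleR_matrix_vector_assoc[symmetric] inner_diff_right)

lemma modified_schouten_transpose:
  assumes g: "riemannian_metric \<A> g" and c: "c \<in> \<A>" and x: "x \<in> chart_image c"
  shows "transpose (modified_schouten \<tau> g c x) = modified_schouten \<tau> g c x"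
proof -
  interpret metric_patch k "chart_image c" "g c" by (rule metric_patch_chart[OF g c])
  show ?thesis
    using ricci_symmetric[OF x] g_sym[OF x]
    by (simp add: modified_schouten_def Let_def transpose_def vec_eq_iff)
qed

text \<open>The form at \<open>v\<close> in one chart equals the form at \<open>J x v\<close> in the
  other, and an injective differential keeps nonzero vectors nonzero.\<close>

lemma modified_schouten_change_chart:
  assumes g: "riemannian_metric \<A> g" and c: "c \<in> \<A>" and d: "d \<in> \<A>" and x: "x \<in> overlap c d"
    and pos: "\<And>w. w \<noteq> 0 \<Longrightarrow> 0 < w \<bullet> (modified_schouten \<tau> g d (snd d (chart_inv c x)) *v w)" and v: "v \<noteq> 0"
  shows "0 < v \<bullet> (modified_schouten \<tau> g c x *v v)"
proof -
  let ?O = "overlap c d" and ?t = "\<lambda>x. snd d (chart_inv c x)"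
  interpret c: metric_patch k "chart_image c" "g c" by (rule metric_patch_chart[OF g c])
  interpret isometric_patches k ?O "g c" "chart_image d" "g d" ?t by (rule isometric_charts[OF g c d])
  have sub: "?O \<subseteq> chart_image c" using overlap_iff[OF c] by blast
  note O = hopen_overlap[OF c d] sub x
  have "J x v \<noteq> 0"
    using inj_J[OF x] v linear_0[OF linear_J[OF x]] by (metis injD)
  from pos[OF this] have "0 < J x v \<bullet> (modified_schouten \<tau> g d (?t x) *v J x v)" .
  also have "\<dots> = v \<bullet> (modified_schouten \<tau> g c x *v v)"
    unfolding modified_schouten_quadratic schouten_form_def ricci_law[OF x, symmetric] scalar_curvature_law[OF x, symmetric] iso[OF x, symmetric]
      c.ricci_subset[OF O] c.scalar_curvature_subset[OF O] ..
  finally show ?thesis .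
qed

lemma riemannian_conformal:
  assumes g: "riemannian_metric \<A> g" and u: "smooth_function \<A> u"
  shows "riemannian_metric \<A> (conformal_metric u g)"
  unfolding riemannian_metric_def
proof (intro conjI ballI)
  fix c assume c: "c \<in> \<A>"
  have gc: "smooth_on (chart_image c) (g c)" using g c by (auto simp: riemannian_metric_def)
  show "smooth_on (chart_image c) (conformal_metric u g c)"
    unfolding conformal_metric_def[abs_def]
    by (intro smooth_on_scaleR smooth_on_exp smooth_on_mult smooth_on_const smooth_fun_rep[OF u c] gc)
next
  show "tensor_positive \<A> (conformal_metric u g)"
    unfolding tensor_positive_def
  proof (intro ballI)
    fix c x assume "c \<in> \<A>" "x \<in> chart_image c"
    then have "positive_definite (g c x)" using g unfolding riemannian_metric_def tensor_positive_def by blast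
    then show "positive_definite (conformal_metric u g c x)"
      by (simp add: positive_definite_def conformal_metric_def transpose_scalar scaleR_matrix_vector_assoc[symmetric])
  qed
next
  show "tensor_law \<A> (conformal_metric u g)"
    unfolding tensor_law_def Let_def
  proof (intro ballI)
    fix c d x assume c: "c \<in> \<A>" and d: "d \<in> \<A>" and x: "x \<in> overlap c d"
    let ?J = "jacobian (transition c d) (at x within overlap c d)"
    have "chart_inv c x \<in> fst d" using x overlap_iff[OF c] by blast
    \<comment> \<open>Both charts see the same point of \<open>M\<close>, hence the same value of
      the conformal factor.\<close>
    then have p: "chart_inv d (transition c d x) = chart_inv c x" by (simp add: transition_def inv_chart[OF d])
    have "g c x = transpose ?J ** g d (transition c d x) ** ?J"
      using g c d x by (simp add: riemannian_metric_def tensor_law_def Let_def)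
    then show "conformal_metric u g c x = transpose ?J ** conformal_metric u g d (transition c d x) ** ?J"
      by (simp add: conformal_metric_def p bounded_bilinear.scaleR_left[OF bounded_bilinear_matrix_mult]
          bounded_bilinear.scaleR_right[OF bounded_bilinear_matrix_mult])
  qed
qed

text \<open>The differential is multiplied by a positive factor. The exponential makes a function
  without critical points nonnegative, as the estimate requires.\<close>

lemma Crit_exp:
  assumes f: "smooth_function \<A> f" shows "Crit (\<lambda>p. exp (f p)) = Crit f"
proof -
  have "crit c (\<lambda>p. exp (f p)) (snd c p) \<longleftrightarrow> crit c f (snd c p)" if c: "c \<in> \<A>" and p: "p \<in> fst c" for c p
    unfolding crit_def
    using dd_eqI[OF has_derivative_exp[OF has_derivative_dd[OF hopen_image[OF c] smooth_fun_rep[OF f c] chart_in[OF p]]] hopen_image[OF c] chart_in[OF p]]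
    by simp
  then show ?thesis unfolding Crit_def by blast
qed

text \<open>Every cell has a threshold beyond which positivity holds on it, and finitely many
  thresholds have a common upper bound. A point seen in any chart lies in some cell, from which
  positivity is transferred.\<close>

lemma exists_positive_conformal:
  assumes n: "CARD('n) \<ge> 3" and conn: "connected M" and bd: "manifold_boundary k \<A> \<noteq> {}"
    and g: "riemannian_metric \<A> g" and \<tau>: "\<tau> \<ge> 2"
  shows "\<exists>u. smooth_function \<A> u \<and> tensor_positive \<A> (modified_schouten \<tau> (conformal_metric u g))"
proof -
  obtain P where P: "finite P" "\<forall>(c, a, r)\<in>P. piece c a r" "M \<subseteq> (\<Union>(c, a, r)\<in>P. {q \<in> fst c. snd c q \<in> cell a r})"
    by (rule finite_piece_cover)
  obtain f0 where f0: "smooth_function \<A> f0" "Crit f0 = {}" using exists_noncritical[OF conn bd] by blast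
  define f where "f = (\<lambda>p. exp (f0 p))"
  have f: "smooth_function \<A> f" "Crit f = {}"
    unfolding f_def Crit_exp[OF f0(1)] using f0(2)
    by (auto simp: smooth_function_def o_def intro: smooth_on_exp smooth_fun_rep[OF f0(1)])
  let ?u = "\<lambda>t p. exp (t * f p)"
  define good where "good = (\<lambda>(c, a, r) t. \<forall>x\<in>cell a r. \<forall>v. v \<noteq> 0 \<longrightarrow>
     0 < v \<bullet> (modified_schouten \<tau> (conformal_metric (?u t) g) c x *v v))"
  have "\<exists>\<Lambda>. \<forall>t\<ge>\<Lambda>. good q t" if q: "q \<in> P" for q
  proof (cases q)
    case (fields c a r)
    have pc: "piece c a r" using P(2) q fields by auto
    then have c: "c \<in> \<A>" by (simp add: piece_def)
    interpret metric_patch k "chart_image c" "g c" by (rule metric_patch_chart[OF g c])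
    interpret conformal_patch k "chart_image c" "g c" "\<lambda>x. f (chart_inv c x)"
      by unfold_locales (rule smooth_fun_rep[OF f(1) c])
    have nz: "\<exists>v. du x v \<noteq> 0" if "x \<in> cell a r" for x
    proof -
      have x: "x \<in> chart_image c" using that cell_sub[OF pc] by blast
      have "chart_inv c x \<notin> Crit f" using f(2) by simp
      then have "\<not> crit c f x"
        using Crit_chart[OF c f(1) inv_in[OF c x]] by (simp add: chart_inv[OF c x])
      then show ?thesis by (simp add: crit_def)
    qed
    have nonneg: "0 \<le> f (chart_inv c x)" for x by (simp add: f_def)
    from exp_potential_positive[OF n \<tau> compact_cell cell_sub[OF pc] nz nonneg]
    obtain \<Lambda> where \<Lambda>: "\<forall>t\<ge>\<Lambda>. \<forall>x\<in>cell a r. \<forall>v. v \<noteq> 0 \<longrightarrow>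
      0 < schouten_form \<tau> (chart_image c) (\<lambda>y. exp (2 * exp (t * f (chart_inv c y))) *\<^sub>R g c y) x v" by blast
    have cm: "conformal_metric (?u t) g c = (\<lambda>y. exp (2 * exp (t * f (chart_inv c y))) *\<^sub>R g c y)" for t
      by (simp add: conformal_metric_def fun_eq_iff)
    have n2: "real CARD('n) - 2 > 0" using n by simp
    have "good q t" if t: "t \<ge> \<Lambda>" for t
      unfolding good_def fields prod.case modified_schouten_quadratic cm
    proof (intro ballI allI impI mult_pos_pos)
      show "0 < 1 / (real CARD('n) - 2)" using n2 by simp
      fix x and v :: "real^'n" assume "x \<in> cell a r" "v \<noteq> 0"
      then show "0 < schouten_form \<tau> (chart_image c) (\<lambda>y. exp (2 * exp (t * f (chart_inv c y))) *\<^sub>R g c y) x v" using \<Lambda> t by blast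
    qed
    then show ?thesis by blast
  qed
  from finite_uniform_threshold[where R=good, OF P(1) this]
  obtain t where t: "\<forall>q\<in>P. good q t" by blast
  have su: "smooth_function \<A> (?u t)"
    unfolding smooth_function_def o_def by (intro ballI smooth_on_exp smooth_on_mult smooth_on_const smooth_fun_rep[OF f(1)])
  let ?g = "conformal_metric (?u t) g"
  note rg = riemannian_conformal[OF g su]
  have "positive_definite (modified_schouten \<tau> ?g d x)" if d: "d \<in> \<A>" and x: "x \<in> chart_image d" for d x
    unfolding positive_definite_def
  proof (intro conjI allI impI)
    show "transpose (modified_schouten \<tau> ?g d x) = modified_schouten \<tau> ?g d x"
      by (rule modified_schouten_transpose[OF rg d x])
    fix v :: "real^'n" assume v: "v \<noteq> 0"
    have "chart_inv d x \<in> M" using inv_in[OF d x] chart_sub[OF d] by blast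
    then obtain c a r where q: "(c, a, r) \<in> P" "chart_inv d x \<in> fst c" "snd c (chart_inv d x) \<in> cell a r"
      using P(3) by auto
    have c: "c \<in> \<A>" using q(1) P(2) by (auto simp: piece_def)
    have ov: "x \<in> overlap d c" using overlap_iff[OF d] x q(2) by blast
    have "good (c, a, r) t" using t q(1) by blast
    then have pos: "0 < w \<bullet> (modified_schouten \<tau> ?g c (snd c (chart_inv d x)) *v w)" if "w \<noteq> 0" for w
      using q(3) that unfolding good_def prod.case by blast
    show "0 < v \<bullet> (modified_schouten \<tau> ?g d x *v v)"
      by (rule modified_schouten_change_chart[OF rg d c ov pos v])
  qed
  then show ?thesis using su by (intro exI[of _ "?u t"]) (simp add: tensor_positive_def)
qed

end

theorem theorem1p3:
  fixes M :: "'a::t2_space set"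
    and k :: "'n::finite"
    and \<A> :: "('a, 'n) chart set"
    and g :: "('a, 'n) tensor2"
  assumes "CARD('n) \<ge> 3"
    and "smooth_manifold_with_boundary k M \<A>"
    and "compact M"
    and "connected M"
    and "manifold_boundary k \<A> \<noteq> {}"
    and "riemannian_metric \<A> g"
  shows "\<forall>\<tau>\<ge>2. \<exists>u. smooth_function \<A> u \<and>
    tensor_positive \<A> (modified_schouten \<tau> (conformal_metric u g))"
proof -
  interpret compact_manifold k M \<A> using assms(2,3) by unfold_locales
  show ?thesis using exists_positive_conformal[OF assms(1,4,5,6)] by blast
qed

end
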